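(* Let $X$ be an infinite-dimensional complex Banach space and $A\in L(X)$. The following conditions are equivalent: (i) $A$ is right generalized Drazin-meromorphic invertible, i.e. there is $B\in L(X)$ such that $ABA=A^2B$, $AB^2=B$ and $A-ABA$ is meromorphic; (ii) there exists $C\in L(X)$ such that $ACA=A^2C$, $AC^2=C=CAC$ and $A-ACA$ is meromorphic; (iii) there exists $(M,N)\in Red(A)$ such that $A_M$ is right invertible and $A_N$ is meromorphic; (iv) there exists a projector $P\in L(X)$ commuting with $A$ such that $A+P$ is right Drazin invertible and $AP$ is meromorphic; (v) there exists a projector $P\in L(X)$ commuting with $A$ such that $A(I-P)+P$ is right Drazin invertible and $AP$ is meromorphic; (vi) there exist $C,D,P\in L(X)$ such that $C$ is right Drazin invertible, $D$ is meromorphic, $P$ is a projector commuting with $C$ and $D$, and $A=C(I-P)+DP$; (vii) $A$ is right meromorphic-quasipolar; (viii) $A$ admits a GS($\mathcal M$)D and $0\notin \mathrm{int}\,\sigma_r(A)$; (ix) $A$ admits a GS($\mathcal M$)D and the dual operator $A'$ has the SVEP at $0$; (x) $A$ admits a GS($\mathcal M$)D and $0\notin \mathrm{acc}\,\sigma_{D}^r(A)$; (xi) $A$ admits a GS($\mathcal M$)D and $0\notin \mathrm{int}\,\sigma_{D}^r(A)$; (xii) $A$ admits a GS($\mathcal M$)D and $0\notin \mathrm{acc}\,\sigma_{dsc}(A)$; (xiii) $A$ admits a GS($\mathcal M$)D and $0\notin \mathrm{int}\,\sigma_{dsc}(A)$; (xiv) $A$ admits a GS($\mathcal M$)D and $0\notin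 \mathrm{int}\,\sigma_{cp}(A)$.
   Context: $L(X)$ is the algebra of bounded linear operators on $X$; $\mathcal N(A)$, $\mathcal R(A)$ denote null-space and range; $A'$ is the dual operator on the dual space $X'$; a projector is an idempotent in $L(X)$. For $K\subset\mathbb C$, $\mathrm{int}\,K$ is its interior and $\mathrm{acc}\,K$ its set of accumulation points. The notions below are used for operators on any complex Banach space, in particular on closed invariant subspaces (possibly $\{0\}$). $(M,N)\in Red(A)$ means: $M,N$ are closed $A$-invariant subspaces with $X=M\oplus N$; $A_M:M\to M$, $A_N:N\to N$ are the restrictions of $A$. A subspace is complemented if it is closed and has a closed algebraic complement. The descent is $d(A)=\inf\{n\ge 0: \mathcal R(A)+ \mathcal N(A^n)=X\}$ ($\inf\emptyset=\infty$). $A$ is right Drazin invertible if $d(A)<\infty$ and $\mathcal N(A)\cap\mathcal R(A^{d(A)})$ is a complemented subspace. $A$ is meromorphic if every nonzero point of its spectrum is a pole of its resolvent. $A$ is Kato if $\mathcal R(A)$ is closed and $\mathcal N(A)\subset\mathcal R(A^n)$ for every $n\in\mathbb N$; $A$ is Saphar if it is Kato and $\mathcal N(A)$, $\mathcal R(A)$ are complemented. $A$ admits a GS($\mathcal M$)D (generalized Saphar-meromorphic decomposition) if there is $(M,N)\in Red(A)$ such that $A_M$ is Saphar and $A_N$ is meromorphic. $A$ is right meromorphic-quasipolar if there is a projector $Q\in L(X)$ with $AQ=QA$, $A(I-Q)$ meromorphic, and $Q\in AL(X)=\{AT:T\in L(X)\}$. An operator $T$ on a Banach space $Y$ has the SVEP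 at $\lambda_0$ if for every open disc $D_{\lambda_0}$ centered at $\lambda_0$ the only analytic $f:D_{\lambda_0}\to Y$ with $(T-\lambda I)f(\lambda)=0$ for all $\lambda\in D_{\lambda_0}$ is $f\equiv0$. Spectra: $\sigma_r(A)$ (right spectrum) and $\sigma_{D}^r(A)$ are the sets of $\lambda\in\mathbb C$ such that $A-\lambda I$ is not right invertible, not right Drazin invertible, respectively; $\sigma_{dsc}(A)=\{\lambda\in\mathbb C: d(A-\lambda I)=\infty\}$; $\sigma_{cp}(A)$ (compression spectrum) is the set of $\lambda\in\mathbb C$ such that $A-\lambda I$ does not have dense range. *)

theory Defs
  imports "HOL-Analysis.Analysis" "HOL-Library.Extended_Nat" "HOL-Library.Set_Algebras"
begin

section \<open>Complex Banach spaces\<close>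

class complex_normed_vector = real_normed_vector +
  fixes scaleC :: "complex \<Rightarrow> 'a \<Rightarrow> 'a"  (infixr "*\<^sub>C" 75)
  assumes scaleC_add_right: "a *\<^sub>C (x + y) = a *\<^sub>C x + a *\<^sub>C y"
    and scaleC_add_left: "(a + b) *\<^sub>C x = a *\<^sub>C x + b *\<^sub>C x"
    and scaleC_scaleC: "a *\<^sub>C (b *\<^sub>C x) = (a * b) *\<^sub>C x"
    and scaleC_one: "1 *\<^sub>C x = x"
    and scaleR_scaleC: "r *\<^sub>R x = complex_of_real r *\<^sub>C x"
    and norm_scaleC: "norm (a *\<^sub>C x) = cmod a * norm x"

class complex_banach = complex_normed_vector + banach

global_interpretation complex_vector: vector_space "scaleC :: complex \<Rightarrow> 'a \<Rightarrow> 'a::complex_normed_vector"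
  defines csubspace = complex_vector.subspace
    and cspan = complex_vector.span
  by unfold_locales (simp_all add: scaleC_add_right scaleC_add_left scaleC_scaleC scaleC_one)

definition finite_cdim :: "'a::complex_normed_vector itself \<Rightarrow> bool" where
  "finite_cdim _ \<longleftrightarrow> (\<exists>B :: 'a set. finite B \<and> cspan B = UNIV)"

instantiation complex :: complex_banach
begin

definition scaleC_complex :: "complex \<Rightarrow> complex \<Rightarrow> complex" where
  "scaleC_complex a x = a * x"

instance
  by intro_classes (simp_all add: scaleC_complex_def algebra_simps norm_mult scaleR_conv_of_real)

end

lemma bounded_linear_scaleC_const:
  "bounded_linear (\<lambda>x :: 'a::complex_normed_vector. a *\<^sub>C x)"
proof (rule bounded_linear_intro[where K = "cmod a"])
  show "a *\<^sub>C (r *\<^sub>R x) = r *\<^sub>R (a *\<^sub>C x)" for r :: real and x :: 'a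
    by (simp add: scaleR_scaleC scaleC_scaleC mult.commute)
qed (simp_all add: scaleC_add_right norm_scaleC)

instantiation blinfun :: (real_normed_vector, complex_normed_vector) complex_normed_vector
begin

lift_definition scaleC_blinfun :: "complex \<Rightarrow> ('a \<Rightarrow>\<^sub>L 'b) \<Rightarrow> ('a \<Rightarrow>\<^sub>L 'b)" is
  "\<lambda>a f x. a *\<^sub>C f x"
  by (rule bounded_linear_compose[OF bounded_linear_scaleC_const])

instance
proof
  fix a b :: complex and r :: real and x y :: "'a \<Rightarrow>\<^sub>L 'b"
  show "a *\<^sub>C (x + y) = a *\<^sub>C x + a *\<^sub>C y"
    by transfer (simp add: scaleC_add_right)
  show "(a + b) *\<^sub>C x = a *\<^sub>C x + b *\<^sub>C x"
    by transfer (simp add: scaleC_add_left)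
  show "a *\<^sub>C (b *\<^sub>C x) = (a * b) *\<^sub>C x"
    by transfer (simp add: scaleC_scaleC)
  show "1 *\<^sub>C x = x"
    by transfer (simp add: scaleC_one)
  show "r *\<^sub>R x = complex_of_real r *\<^sub>C x"
    by transfer (simp add: scaleR_scaleC)
  show "norm (a *\<^sub>C x) = cmod a * norm x"
  proof transfer
    fix a :: complex and f :: "'a \<Rightarrow> 'b"
    assume "bounded_linear f"
    then have "bounded_linear (\<lambda>x. cmod a *\<^sub>R f x)" and "onorm (\<lambda>x. cmod a *\<^sub>R f x) = cmod a * onorm f"
      by (simp_all add: bounded_linear_const_scaleR onorm_scaleR)
    then show "onorm (\<lambda>x. a *\<^sub>C f x) = cmod a * onorm f"
      by (simp add: onorm_def norm_scaleC)
  qed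
qed

end

instance blinfun :: (real_normed_vector, complex_banach) complex_banach ..

section \<open>Operators on a closed subspace\<close>

text \<open>
  Every notion takes as its first argument the Banach space \<open>M\<close> on which the operator lives: a
  closed complex subspace of the ambient space, the ambient space itself being \<open>UNIV\<close>.  An
  operator on \<open>M\<close> is given by a function on the ambient type whose values outside \<open>M\<close> are
  irrelevant, so that the restriction of \<open>A\<close> to an invariant subspace \<open>M\<close> is just \<open>A\<close>, used with
  carrier \<open>M\<close>.
\<close>

definition bounded_ops :: "'a::complex_normed_vector set \<Rightarrow> ('a \<Rightarrow> 'a) set" where
  "bounded_ops M = {T. T ` M \<subseteq> M
     \<and> (\<forall>x\<in>M. \<forall>y\<in>M. T (x + y) = T x + T y)
     \<and> (\<forall>c. \<forall>x\<in>M. T (c *\<^sub>C x) = c *\<^sub>C T x)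
     \<and> (\<exists>K. \<forall>x\<in>M. norm (T x) \<le> norm x * K)}"

definition onorm_on :: "'a::complex_normed_vector set \<Rightarrow> ('a \<Rightarrow> 'a) \<Rightarrow> real" where
  "onorm_on M T = (SUP x\<in>M. norm (T x) / norm x)"

definition shift :: "('a::complex_normed_vector \<Rightarrow> 'a) \<Rightarrow> complex \<Rightarrow> 'a \<Rightarrow> 'a" where
  "shift T z = (\<lambda>x. T x - z *\<^sub>C x)"

definition null_on :: "'a::complex_normed_vector set \<Rightarrow> ('a \<Rightarrow> 'a) \<Rightarrow> 'a set" where
  "null_on M T = {x \<in> M. T x = 0}"

definition projector :: "('a::complex_normed_vector \<Rightarrow> 'a) \<Rightarrow> bool" where
  "projector P \<longleftrightarrow> P \<in> bounded_ops UNIV \<and> P \<circ> P = P"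

definition complemented_in :: "'a::complex_normed_vector set \<Rightarrow> 'a set \<Rightarrow> bool" where
  "complemented_in M U \<longleftrightarrow> csubspace U \<and> closed U \<and> U \<subseteq> M
     \<and> (\<exists>V. csubspace V \<and> closed V \<and> V \<subseteq> M \<and> U \<inter> V = {0} \<and> U + V = M)"

definition Red :: "('a::complex_normed_vector \<Rightarrow> 'a) \<Rightarrow> ('a set \<times> 'a set) set" where
  "Red A = {(M, N). csubspace M \<and> closed M \<and> A ` M \<subseteq> M \<and> csubspace N \<and> closed N \<and> A ` N \<subseteq> N
     \<and> M \<inter> N = {0} \<and> M + N = UNIV}"

section \<open>Invertibility, spectrum, meromorphic operators\<close>

definition right_invertible_on :: "'a::complex_normed_vector set \<Rightarrow> ('a \<Rightarrow> 'a) \<Rightarrow> bool" where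
  "right_invertible_on M T \<longleftrightarrow> (\<exists>S\<in>bounded_ops M. \<forall>x\<in>M. T (S x) = x)"

definition invertible_on :: "'a::complex_normed_vector set \<Rightarrow> ('a \<Rightarrow> 'a) \<Rightarrow> bool" where
  "invertible_on M T \<longleftrightarrow> (\<exists>S\<in>bounded_ops M. \<forall>x\<in>M. T (S x) = x \<and> S (T x) = x)"

definition spectrum_on :: "'a::complex_normed_vector set \<Rightarrow> ('a \<Rightarrow> 'a) \<Rightarrow> complex set" where
  "spectrum_on M T = {z. \<not> invertible_on M (shift T z)}"

definition resolvent_on ::
    "'a::complex_normed_vector set \<Rightarrow> ('a \<Rightarrow> 'a) \<Rightarrow> complex \<Rightarrow> 'a \<Rightarrow> 'a" where
  "resolvent_on M T z = inv_into M (shift T z)"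

text \<open>Analyticity on an open set \<open>S\<close> with values in the bounded operators on \<open>M\<close>, in operator norm.\<close>

definition op_analytic_on ::
    "'a::complex_normed_vector set \<Rightarrow> (complex \<Rightarrow> 'a \<Rightarrow> 'a) \<Rightarrow> complex set \<Rightarrow> bool" where
  "op_analytic_on M G S \<longleftrightarrow> (\<forall>z\<in>S. G z \<in> bounded_ops M) \<and>
     (\<forall>z\<in>S. \<exists>D\<in>bounded_ops M.
        ((\<lambda>w. onorm_on M (\<lambda>x. inverse (w - z) *\<^sub>C (G w x - G z x) - D x)) \<longlongrightarrow> 0) (at z))"

text \<open>
  A pole of order \<open>p \<ge> 1\<close>: near \<open>a\<close> the resolvent is \<open>(z - a)\<^sup>-\<^sup>p G z\<close> with \<open>G\<close> analytic at \<open>a\<close> and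
  \<open>G a \<noteq> 0\<close>.  The library's \<open>is_pole\<close> (norm tending to infinity) would be wrong here: the resolvent
  norm tends to infinity at every isolated point of the spectrum, essential singularities included.
\<close>

definition pole_of_resolvent :: "'a::complex_normed_vector set \<Rightarrow> ('a \<Rightarrow> 'a) \<Rightarrow> complex \<Rightarrow> bool" where
  "pole_of_resolvent M T a \<longleftrightarrow> (\<exists>p\<ge>1::nat. \<exists>r>0. \<exists>G.
     op_analytic_on M G (ball a r) \<and> (\<exists>x\<in>M. G a x \<noteq> 0) \<and>
     (\<forall>z\<in>ball a r - {a}. z \<notin> spectrum_on M T \<and>
        (\<forall>x\<in>M. resolvent_on M T z x = inverse ((z - a) ^ p) *\<^sub>C G z x)))"

definition meromorphic_on :: "'a::complex_normed_vector set \<Rightarrow> ('a \<Rightarrow> 'a) \<Rightarrow> bool" where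
  "meromorphic_on M T \<longleftrightarrow> T \<in> bounded_ops M
     \<and> (\<forall>z\<in>spectrum_on M T. z \<noteq> 0 \<longrightarrow> pole_of_resolvent M T z)"

section \<open>Descent, right Drazin invertibility, Kato and Saphar operators\<close>

definition descent_on :: "'a::complex_normed_vector set \<Rightarrow> ('a \<Rightarrow> 'a) \<Rightarrow> enat" where
  "descent_on M T = Inf {enat n | n. T ` M + null_on M (T ^^ n) = M}"

definition right_Drazin_on :: "'a::complex_normed_vector set \<Rightarrow> ('a \<Rightarrow> 'a) \<Rightarrow> bool" where
  "right_Drazin_on M T \<longleftrightarrow> descent_on M T < \<infinity>
     \<and> complemented_in M (null_on M T \<inter> (T ^^ the_enat (descent_on M T)) ` M)"

definition Kato_on :: "'a::complex_normed_vector set \<Rightarrow> ('a \<Rightarrow> 'a) \<Rightarrow> bool" where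
  "Kato_on M T \<longleftrightarrow> closed (T ` M) \<and> (\<forall>n. null_on M T \<subseteq> (T ^^ n) ` M)"

definition Saphar_on :: "'a::complex_normed_vector set \<Rightarrow> ('a \<Rightarrow> 'a) \<Rightarrow> bool" where
  "Saphar_on M T \<longleftrightarrow> Kato_on M T \<and> complemented_in M (null_on M T) \<and> complemented_in M (T ` M)"

definition right_spectrum :: "'a::complex_normed_vector set \<Rightarrow> ('a \<Rightarrow> 'a) \<Rightarrow> complex set" where
  "right_spectrum M T = {z. \<not> right_invertible_on M (shift T z)}"

definition right_Drazin_spectrum :: "'a::complex_normed_vector set \<Rightarrow> ('a \<Rightarrow> 'a) \<Rightarrow> complex set" where
  "right_Drazin_spectrum M T = {z. \<not> right_Drazin_on M (shift T z)}"

definition descent_spectrum :: "'a::complex_normed_vector set \<Rightarrow> ('a \<Rightarrow> 'a) \<Rightarrow> complex set" where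
  "descent_spectrum M T = {z. descent_on M (shift T z) = \<infinity>}"

definition compression_spectrum :: "'a::complex_normed_vector set \<Rightarrow> ('a \<Rightarrow> 'a) \<Rightarrow> complex set" where
  "compression_spectrum M T = {z. closure (shift T z ` M) \<noteq> M}"

section \<open>Dual operator and the single-valued extension property\<close>

text \<open>
  The dual space consists of the complex-linear elements of the space of bounded real-linear maps
  into the complex numbers, with the operator norm.
\<close>

definition dual_space :: "('a::complex_normed_vector \<Rightarrow>\<^sub>L complex) set" where
  "dual_space = {\<phi>. \<forall>c x. blinfun_apply \<phi> (c *\<^sub>C x) = c * blinfun_apply \<phi> x}"

definition dual_op ::
    "('a::complex_normed_vector \<Rightarrow> 'a) \<Rightarrow> ('a \<Rightarrow>\<^sub>L complex) \<Rightarrow> ('a \<Rightarrow>\<^sub>L complex)" where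
  "dual_op A \<phi> = Blinfun (\<lambda>x. blinfun_apply \<phi> (A x))"

definition vec_analytic_on ::
    "'b::complex_normed_vector set \<Rightarrow> (complex \<Rightarrow> 'b) \<Rightarrow> complex set \<Rightarrow> bool" where
  "vec_analytic_on Y f S \<longleftrightarrow> (\<forall>z\<in>S. f z \<in> Y) \<and>
     (\<forall>z\<in>S. \<exists>d\<in>Y. (f has_derivative (\<lambda>h. h *\<^sub>C d)) (at z))"

definition SVEP_at :: "'b::complex_normed_vector set \<Rightarrow> ('b \<Rightarrow> 'b) \<Rightarrow> complex \<Rightarrow> bool" where
  "SVEP_at Y T a \<longleftrightarrow> (\<forall>r>0. \<forall>f. vec_analytic_on Y f (ball a r)
     \<and> (\<forall>z\<in>ball a r. shift T z (f z) = 0) \<longrightarrow> (\<forall>z\<in>ball a r. f z = 0))"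

section \<open>Decompositions and generalized inverses\<close>

definition right_gDM_invertible :: "('a::complex_normed_vector \<Rightarrow> 'a) \<Rightarrow> bool" where
  "right_gDM_invertible A \<longleftrightarrow> (\<exists>B\<in>bounded_ops UNIV.
     A \<circ> B \<circ> A = A \<circ> A \<circ> B \<and> A \<circ> B \<circ> B = B \<and> meromorphic_on UNIV (\<lambda>x. A x - A (B (A x))))"

definition right_meromorphic_quasipolar :: "('a::complex_normed_vector \<Rightarrow> 'a) \<Rightarrow> bool" where
  "right_meromorphic_quasipolar A \<longleftrightarrow> (\<exists>Q. projector Q \<and> A \<circ> Q = Q \<circ> A
     \<and> meromorphic_on UNIV (\<lambda>x. A (x - Q x)) \<and> (\<exists>T\<in>bounded_ops UNIV. Q = A \<circ> T))"

definition admits_GSMD :: "('a::complex_normed_vector \<Rightarrow> 'a) \<Rightarrow> bool" where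
  "admits_GSMD A \<longleftrightarrow> (\<exists>(M, N)\<in>Red A. Saphar_on M A \<and> meromorphic_on N A)"

end

theory Submission
  imports Defs "HOL-Complex_Analysis.Conformal_Mappings"
begin

text \<open>
  Every one of the conditions says that \<open>A\<close> splits along a commuting projector \<open>P\<close> into a right
  invertible operator on the range of \<open>P\<close> and a meromorphic operator on its kernel
  (\<open>right_inv_mero_split\<close>).  Between \<open>A\<close> with such a splitting and the generalized inverses, the
  quasipolar projector and the spectral conditions there is little more than bookkeeping with
  \<open>A C = P\<close>, where \<open>C\<close> is a right inverse on the range of \<open>P\<close> and zero on the kernel.  The
  substance lies in three facts.

  \<^item> Meromorphy is algebraic.  A point \<open>a\<close> is regular or a pole of the resolvent of \<open>T\<close> exactly if
    \<open>B = T - a\<close> is Drazin invertible, that is, \<open>B\<^sup>p\<^sup>+\<^sup>1 S = B\<^sup>p\<close> for some \<open>S\<close> commuting with \<open>B\<close>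
    (\<open>meromorphic_on_iff_Drazin\<close>).  At a pole, \<open>S\<close> is the constant Laurent coefficient of the
    resolvent, a circle mean, and the relation is Cauchy's theorem; conversely \<open>S\<close> gives the
    resolvent near \<open>a\<close> by an explicit formula.  In this form it is evident that meromorphy passes to
    direct summands and to direct sums.

  \<^item> A right Drazin invertible operator is the direct sum of a right invertible and a nilpotent one
    (\<open>right_Drazin_decomposition\<close>), so that in the conditions involving right Drazin invertibility
    the nilpotent part can be moved over to the meromorphic summand.  The projection onto the right
    invertible part is written down explicitly.

  \<^item> A Saphar operator \<open>T\<close> such that \<open>T - z\<close> has dense range, or finite descent, for a single small
    \<open>z\<close> is right invertible (\<open>Saphar_right_invertible\<close>).  If \<open>T S T = T\<close> and \<open>V\<^sub>z = (I - z S)\<^sup>-\<^sup>1\<close>,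
    then \<open>V\<^sub>z\<close> maps the range of \<open>T - z\<close> into the range of \<open>T\<close>; as the latter is closed and \<open>V\<^sub>z\<close> is
    onto, density of the former forces \<open>T\<close> to be onto.  If \<open>T\<close> is not onto, a functional \<open>\<phi>\<close>
    vanishing on its range yields the analytic family \<open>\<phi> \<circ> V\<^sub>z \<circ> P\<close> of eigenvectors of the dual
    operator, which contradicts the single-valued extension property.

  Conversely, if \<open>A\<close> splits, then close to \<open>0\<close> the operators \<open>A - z\<close> are right invertible on the range
  of \<open>P\<close>, while on the kernel they are invertible for a dense set of \<open>z\<close> and Drazin invertible for all
  \<open>z \<noteq> 0\<close>.  All the spectral conditions follow from this.
\<close>

section \<open>Separation of points from closed subspaces\<close>

definition sublinear :: "('a::real_vector \<Rightarrow> real) \<Rightarrow> bool" where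
  "sublinear p \<longleftrightarrow> (\<forall>x y. p (x + y) \<le> p x + p y) \<and> (\<forall>t\<ge>0. \<forall>x. p (t *\<^sub>R x) = t * p x)"

lemma sublinear_add: "sublinear p \<Longrightarrow> p (x + y) \<le> p x + p y"
  by (simp add: sublinear_def)

lemma sublinear_scale: "sublinear p \<Longrightarrow> 0 \<le> t \<Longrightarrow> p (t *\<^sub>R x) = t * p x"
  by (simp add: sublinear_def)

lemma sublinear_minus_le: "sublinear p \<Longrightarrow> - p (- x) \<le> p x"
  using sublinear_add[of p x "- x"] sublinear_scale[of p 0 x] by simp

lemma sublinearI:
  fixes p :: "'a::real_vector \<Rightarrow> real"
  assumes add: "\<And>x y. p (x + y) \<le> p x + p y" and zero: "p 0 = 0"
    and le: "\<And>t x. t > 0 \<Longrightarrow> p (t *\<^sub>R x) \<le> t * p x"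
  shows "sublinear p"
proof -
  have "p (t *\<^sub>R x) = t * p x" if "t \<ge> 0" for t x
  proof (cases "t = 0")
    case False
    then have t: "t > 0" using that by simp
    have "p x \<le> inverse t * p (t *\<^sub>R x)"
      using le[of "inverse t" "t *\<^sub>R x"] t by simp
    then have "t * p x \<le> p (t *\<^sub>R x)" using t by (simp add: field_simps)
    then show ?thesis using le[OF t, of x] by simp
  qed (simp add: zero)
  then show ?thesis unfolding sublinear_def using add by blast
qed

text \<open>
  The witness is \<open>r x = (INF t\<ge>0. q (x + t a) - t q a)\<close>. It serves twice: a minimal sublinear
  functional is its own lowering for every \<open>a\<close>, which makes it superadditive, and lowering a
  seminorm \<open>q\<close> in the direction \<open>a\<close> gives \<open>r (- a) \<le> - q a\<close>, so that linear functionals below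
  \<open>r\<close> take the value \<open>q a\<close> at \<open>a\<close>.
\<close>

lemma sublinear_lower:
  fixes q :: "'a::real_vector \<Rightarrow> real"
  assumes q: "sublinear q"
  shows "\<exists>r. sublinear r \<and> (\<forall>x. r x \<le> q x) \<and> (\<forall>x. r x \<le> q (x + a) - q a)"
proof -
  define r where "r x = (INF t\<in>{0..}. q (x + t *\<^sub>R a) - t * q a)" for x
  have lb: "- q (- x) \<le> q (x + t *\<^sub>R a) - t * q a" if "t \<ge> 0" for x and t :: real
    using sublinear_add[OF q, of "x + t *\<^sub>R a" "- x"] sublinear_scale[OF q that, of a] by simp
  have bdd: "bdd_below ((\<lambda>t. q (x + t *\<^sub>R a) - t * q a) ` {0..})" for x
    using lb by (intro bdd_belowI2[where m = "- q (- x)"]) auto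
  have le: "r x \<le> q (x + t *\<^sub>R a) - t * q a" if "t \<ge> 0" for x t
    unfolding r_def by (rule cINF_lower[OF bdd]) (use that in auto)
  have ge: "c \<le> r x" if "\<And>t. t \<ge> 0 \<Longrightarrow> c \<le> q (x + t *\<^sub>R a) - t * q a" for c x
    unfolding r_def by (rule cINF_greatest) (use that in auto)
  have add: "r (x + y) \<le> r x + r y" for x y
  proof -
    have *: "r (x + y) - (q (y + t *\<^sub>R a) - t * q a) \<le> r x" if t: "t \<ge> 0" for t
    proof (rule ge)
      fix s :: real assume s: "s \<ge> 0"
      have "r (x + y) \<le> q ((x + s *\<^sub>R a) + (y + t *\<^sub>R a)) - (s + t) * q a"
        using le[of "s + t" "x + y"] s t by (simp add: algebra_simps)
      also have "\<dots> \<le> q (x + s *\<^sub>R a) + q (y + t *\<^sub>R a) - (s + t) * q a"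
        using sublinear_add[OF q] by simp
      finally show "r (x + y) - (q (y + t *\<^sub>R a) - t * q a) \<le> q (x + s *\<^sub>R a) - s * q a"
        by (simp add: algebra_simps)
    qed
    have "r (x + y) - r x \<le> r y"
    proof (rule ge)
      show "r (x + y) - r x \<le> q (y + t *\<^sub>R a) - t * q a" if "t \<ge> 0" for t
        using *[OF that] by linarith
    qed
    then show ?thesis by simp
  qed
  have scale_le: "r (s *\<^sub>R x) \<le> s * r x" if s: "s > 0" for s x
  proof -
    have "r (s *\<^sub>R x) / s \<le> r x"
    proof (rule ge)
      fix t :: real assume t: "t \<ge> 0"
      have "r (s *\<^sub>R x) \<le> q (s *\<^sub>R (x + t *\<^sub>R a)) - (s * t) * q a"
        using le[of "s * t" "s *\<^sub>R x"] s t by (simp add: algebra_simps)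
      also have "\<dots> = s * (q (x + t *\<^sub>R a) - t * q a)"
        using sublinear_scale[OF q, of s "x + t *\<^sub>R a"] s by (simp add: right_diff_distrib)
      finally show "r (s *\<^sub>R x) / s \<le> q (x + t *\<^sub>R a) - t * q a"
        using s by (simp add: field_simps)
    qed
    then show ?thesis using s by (simp add: field_simps)
  qed
  have r0: "r 0 = 0"
  proof (rule antisym)
    show "r 0 \<le> 0" using le[of 0 0] sublinear_scale[OF q, of 0 0] by simp
    show "0 \<le> r 0" by (rule ge) (use sublinear_scale[OF q] in auto)
  qed
  show ?thesis
  proof (intro exI[of _ r] conjI allI)
    show "sublinear r" by (rule sublinearI[OF add r0 scale_le])
    show "r x \<le> q x" for x using le[of 0 x] by simp
    show "r x \<le> q (x + a) - q a" for x using le[of 1 x] by simp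
  qed
qed

text \<open>
  The pointwise infimum of a chain: subadditivity survives because of any two members one is
  below the other, and boundedness from below comes from \<open>- p (- x) \<le> q x\<close>.
\<close>

lemma sublinear_Inf_chain:
  fixes p :: "'a::real_vector \<Rightarrow> real"
  assumes p: "sublinear p" and ne: "C \<noteq> {}"
    and C: "\<And>q. q \<in> C \<Longrightarrow> sublinear q \<and> (\<forall>x. q x \<le> p x)"
    and chain: "\<And>q q'. q \<in> C \<Longrightarrow> q' \<in> C \<Longrightarrow> (\<forall>x. q x \<le> q' x) \<or> (\<forall>x. q' x \<le> q x)"
  shows "\<exists>r. sublinear r \<and> (\<forall>q\<in>C. \<forall>x. r x \<le> q x)"
proof -
  define r where "r x = (INF q\<in>C. q x)" for x
  have bdd: "bdd_below ((\<lambda>q. q x) ` C)" for x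
  proof (rule bdd_belowI2)
    fix q assume "q \<in> C"
    then have "q (- x) \<le> p (- x)" "- q (- x) \<le> q x"
      using C[of q] sublinear_minus_le[of q x] by auto
    then show "- p (- x) \<le> q x" by linarith
  qed
  have le: "r x \<le> q x" if "q \<in> C" for q x
    unfolding r_def by (rule cINF_lower[OF bdd that])
  have ge: "c \<le> r x" if "\<And>q. q \<in> C \<Longrightarrow> c \<le> q x" for c x
    unfolding r_def by (rule cINF_greatest[OF ne that])
  have add: "r (x + y) \<le> r x + r y" for x y
  proof -
    have *: "r (x + y) \<le> q x + q' y" if "q \<in> C" "q' \<in> C" for q q'
    proof -
      consider "\<forall>x. q x \<le> q' x" | "\<forall>x. q' x \<le> q x"
        using chain[OF \<open>q \<in> C\<close> \<open>q' \<in> C\<close>] by (elim disjE)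
      then show ?thesis
      proof cases
        case 1
        then have "q y \<le> q' y" ..
        moreover have "q (x + y) \<le> q x + q y" using C[OF that(1)] sublinear_add by blast
        ultimately show ?thesis using le[OF that(1), of "x + y"] by linarith
      next
        case 2
        then have "q' x \<le> q x" ..
        moreover have "q' (x + y) \<le> q' x + q' y" using C[OF that(2)] sublinear_add by blast
        ultimately show ?thesis using le[OF that(2), of "x + y"] by linarith
      qed
    qed
    have **: "r (x + y) - q' y \<le> r x" if "q' \<in> C" for q'
      by (rule ge) (use *[OF _ that] in \<open>simp add: algebra_simps\<close>)
    have "r (x + y) - r x \<le> r y"
    proof (rule ge)
      show "r (x + y) - r x \<le> q' y" if "q' \<in> C" for q'
        using **[OF that] by linarith
    qed
    then show ?thesis by simp
  qed
  have zero: "r 0 = 0"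
  proof -
    have "q 0 = 0" if "q \<in> C" for q using C[OF that] sublinear_scale[of q 0 0] by simp
    then have "(INF q\<in>C. q 0) = (INF q\<in>C. 0)" by (intro INF_cong) auto
    then show ?thesis using ne by (simp add: r_def)
  qed
  have scale_le: "r (t *\<^sub>R x) \<le> t * r x" if t: "t > 0" for t x
  proof -
    have "r (t *\<^sub>R x) / t \<le> r x"
    proof (rule ge)
      fix q assume q: "q \<in> C"
      then have "r (t *\<^sub>R x) \<le> t * q x"
        using le[OF q, of "t *\<^sub>R x"] C[OF q] sublinear_scale[of q t x] t by simp
      then show "r (t *\<^sub>R x) / t \<le> q x" using t by (simp add: field_simps)
    qed
    then show ?thesis using t by (simp add: field_simps)
  qed
  show ?thesis
    using sublinearI[OF add zero scale_le] le by (intro exI[of _ r]) blast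
qed

text \<open>
  Hahn-Banach through minimality instead of extension: by Zorn there is a minimal sublinear
  functional below \<open>p\<close>, and minimality against all its lowerings makes it additive.
\<close>

lemma linear_below_sublinear:
  fixes p :: "'a::real_vector \<Rightarrow> real"
  assumes p: "sublinear p"
  shows "\<exists>u. linear u \<and> (\<forall>x. u x \<le> p x)"
proof -
  define A where "A = {q. sublinear q \<and> (\<forall>x. q x \<le> p x)}"
  define P where "P q r \<longleftrightarrow> (\<forall>x. r x \<le> q x)" for q r :: "'a \<Rightarrow> real"
  have "\<exists>m\<in>A. \<forall>a\<in>A. P m a \<longrightarrow> a = m"
  proof (rule predicate_Zorn)
    show "partial_order_on A (relation_of P A)"
    proof (rule partial_order_on_relation_ofI)
      show "P a c" if "P a b" "P b c" for a b c
        unfolding P_def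
      proof
        fix x
        have "c x \<le> b x" "b x \<le> a x" using that by (simp_all add: P_def)
        then show "c x \<le> a x" by simp
      qed
      show "a = b" if "P a b" "P b a" for a b
        using that unfolding P_def by (intro ext) (simp add: order.eq_iff)
    qed (simp add: P_def)
    fix C assume "C \<in> Chains (relation_of P A)"
    then have CA: "C \<subseteq> A" and chain: "\<And>q r. q \<in> C \<Longrightarrow> r \<in> C \<Longrightarrow> P q r \<or> P r q"
      by (auto simp: Chains_def relation_of_def)
    show "\<exists>u\<in>A. \<forall>a\<in>C. P a u"
    proof (cases "C = {}")
      case True
      then show ?thesis using p by (auto simp: A_def)
    next
      case False
      have "\<exists>r. sublinear r \<and> (\<forall>q\<in>C. \<forall>x. r x \<le> q x)"
        by (rule sublinear_Inf_chain[OF p False]) (use CA chain in \<open>auto simp: A_def P_def\<close>)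
      then obtain r where r: "sublinear r" "\<And>q x. q \<in> C \<Longrightarrow> r x \<le> q x" by blast
      obtain q where "q \<in> C" using False by blast
      then have "\<forall>x. r x \<le> p x"
        using r(2)[of q] CA unfolding A_def by (auto intro: order_trans[where y = "q _"])
      then have "r \<in> A" using r(1) by (simp add: A_def)
      moreover have "\<forall>a\<in>C. P a r" using r(2) by (simp add: P_def)
      ultimately show ?thesis by blast
    qed
  qed
  then obtain q where "q \<in> A" and min: "\<And>r. r \<in> A \<Longrightarrow> P q r \<Longrightarrow> r = q" by blast
  then have q: "sublinear q" and qp: "\<And>x. q x \<le> p x" by (auto simp: A_def)
  have super: "q x + q a \<le> q (x + a)" for x a
  proof -
    obtain r where r: "sublinear r" "\<And>x. r x \<le> q x" "\<And>x. r x \<le> q (x + a) - q a"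
      using sublinear_lower[OF q] by blast
    have "r = q"
    proof (rule min)
      have "r x \<le> p x" for x using r(2)[of x] qp[of x] by simp
      then show "r \<in> A" unfolding A_def using r(1) by simp
      show "P q r" unfolding P_def using r(2) by blast
    qed
    then show ?thesis using r(3)[of x] by simp
  qed
  have add: "q (x + y) = q x + q y" for x y
    using super[of x y] sublinear_add[OF q, of x y] by simp
  have "q (- x) = - q x" for x
    using add[of x "- x"] sublinear_scale[OF q, of 0 0] by simp
  then have "q (t *\<^sub>R x) = t * q x" for t x
    using sublinear_scale[OF q, of "\<bar>t\<bar>" x] by (cases "t \<ge> 0") (auto simp: abs_if)
  then have "linear q" using add by (intro linearI) auto
  then show ?thesis using qp by blast
qed

text \<open>
  The distance to \<open>M\<close> is a seminorm vanishing exactly on \<open>M\<close>. It is lowered in the direction \<open>y\<close>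
  first, so that any linear functional below it is nonzero at \<open>y\<close>.
\<close>

lemma separate_point_closed_subspace:
  fixes M :: "'a::real_normed_vector set"
  assumes M: "subspace M" "closed M" and y: "y \<notin> M"
  shows "\<exists>u::'a \<Rightarrow> real. bounded_linear u \<and> (\<forall>x\<in>M. u x = 0) \<and> u y \<noteq> 0"
proof -
  define p where "p x = infdist x M" for x
  have ne: "M \<noteq> {}" using M subspace_0 by blast
  have lt: "\<exists>m\<in>M. dist x m < p x + e" if "e > 0" for x e
  proof -
    have "(INF m\<in>M. dist x m) < p x + e"
      unfolding p_def infdist_def using ne that by simp
    then show ?thesis using ne by (subst (asm) cINF_less_iff) auto
  qed
  have pM: "p x = 0" if "x \<in> M" for x using that by (simp add: p_def)
  have p_norm: "p x \<le> norm x" for x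
    using infdist_le[of 0 M x] M subspace_0 by (auto simp: p_def)
  have add: "p (x + z) \<le> p x + p z" for x z
  proof (rule field_le_epsilon)
    fix e :: real assume "e > 0"
    then obtain m n where m: "m \<in> M" "dist x m < p x + e/2" and n: "n \<in> M" "dist z n < p z + e/2"
      using lt[of "e/2"] by (meson half_gt_zero)
    have "p (x + z) \<le> dist (x + z) (m + n)"
      unfolding p_def by (rule infdist_le) (use M m n in \<open>auto intro: subspace_add\<close>)
    also have "\<dots> \<le> dist x m + dist z n" by (rule dist_triangle_add)
    finally show "p (x + z) \<le> p x + p z + e" using m n by simp
  qed
  have scale_le: "p (t *\<^sub>R x) \<le> t * p x" if "t > 0" for t x
  proof (rule field_le_epsilon)
    fix e :: real assume "e > 0"
    then obtain m where m: "m \<in> M" "dist x m < p x + e/t"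
      using lt[OF divide_pos_pos[OF _ \<open>t > 0\<close>], of e x] by blast
    have "p (t *\<^sub>R x) \<le> dist (t *\<^sub>R x) (t *\<^sub>R m)"
      unfolding p_def by (rule infdist_le) (use M m in \<open>auto intro: subspace_scale\<close>)
    also have "\<dots> = t * dist x m"
      using that by (simp add: dist_norm flip: scaleR_diff_right)
    also have "\<dots> \<le> t * (p x + e/t)"
      using m that by (intro mult_left_mono) auto
    finally show "p (t *\<^sub>R x) \<le> t * p x + e" using that by (simp add: algebra_simps)
  qed
  have p: "sublinear p" by (rule sublinearI[OF add pM scale_le]) (use M subspace_0 in blast)
  obtain r where r: "sublinear r" "\<And>x. r x \<le> p x" "\<And>x. r x \<le> p (x + y) - p y"
    using sublinear_lower[OF p] by blast
  obtain u where u: "linear u" "\<And>x. u x \<le> r x"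
    using linear_below_sublinear[OF r(1)] by blast
  have up: "u x \<le> p x" for x using u(2) r(2) order_trans by blast
  have neg: "u (- x) = - u x" for x using linear_neg[OF u(1)] .
  show ?thesis
  proof (intro exI[of _ u] conjI ballI)
    have "\<bar>u x\<bar> \<le> norm x" for x
      using up[of x] up[of "- x"] p_norm[of x] p_norm[of "- x"] neg[of x] by simp
    then show "bounded_linear u"
      using u(1) by (intro bounded_linear_intro[where K = 1])
        (auto simp: linear_add linear_scale)
    show "u x = 0" if "x \<in> M" for x
      using up[of x] up[of "- x"] pM[of x] pM[of "- x"] neg[of x] that M subspace_neg[of M x] by auto
    have "u (- y) \<le> - p y"
      using u(2)[of "- y"] r(3)[of "- y"] pM[of 0] M subspace_0 by fastforce
    moreover have "p y > 0"
      unfolding p_def using M ne y by (simp add: infdist_pos_not_in_closed)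
    ultimately show "u y \<noteq> 0" using neg by simp
  qed
qed

section \<open>The open mapping theorem for closed subspaces\<close>

text \<open>
  By Baire's theorem the closure of the image of some ball has interior points in \<open>N\<close>;
  differences and scaling give approximate preimages with a norm bound, and summing the
  corrections gives exact ones. The map \<open>f\<close> is only required to be linear on \<open>M\<close>, since
  operators on a subspace are arbitrary functions outside it.
\<close>

lemma open_mapping_closed_subspaces:
  fixes f :: "'a::banach \<Rightarrow> 'b::banach"
  assumes M: "subspace M" "closed M" and N: "subspace N" "closed N"
    and add: "\<And>x y. x \<in> M \<Longrightarrow> y \<in> M \<Longrightarrow> f (x + y) = f x + f y"
    and scale: "\<And>t x. x \<in> M \<Longrightarrow> f (t *\<^sub>R x) = t *\<^sub>R f x"
    and bound: "\<And>x. x \<in> M \<Longrightarrow> norm (f x) \<le> norm x * K"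
    and onto: "f ` M = N"
  shows "\<exists>c>0. \<forall>y\<in>N. \<exists>x\<in>M. f x = y \<and> norm x \<le> c * norm y"
proof -
  have f0: "f 0 = 0" using add[of 0 0] M subspace_0 by fastforce
  have diff: "f (x - y) = f x - f y" if "x \<in> M" "y \<in> M" for x y
    using add[of "x - y" y] that M subspace_diff[of M x y] by auto
  define F where "F n = closure (f ` (M \<inter> cball 0 (real n)))" for n :: nat
  have FN: "F n \<subseteq> N" for n
    unfolding F_def using N onto by (intro closure_minimal) auto
  have cover: "N \<subseteq> (\<Union>n. F n)"
  proof
    fix y assume "y \<in> N"
    then obtain x where x: "x \<in> M" "y = f x" using onto by auto
    obtain n where "norm x \<le> real n" using real_arch_simple by blast
    then have "y \<in> F n" unfolding F_def using x closure_subset by fastforce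
    then show "y \<in> (\<Union>n. F n)" by blast
  qed
  have "\<exists>n. top_of_set N interior_of F n \<noteq> {}"
  proof (rule ccontr)
    assume "\<not> ?thesis"
    then have *: "top_of_set N interior_of F n = {}" for n by blast
    have "top_of_set N interior_of \<Union> (range F) = {}"
    proof (rule Baire_category_alt)
      show "completely_metrizable_space (top_of_set N) \<or>
          locally_compact_space (top_of_set N) \<and> regular_space (top_of_set N)"
        using N completely_metrizable_space_closedin completely_metrizable_space_euclidean
          closed_closedin by blast
      show "closedin (top_of_set N) T \<and> top_of_set N interior_of T = {}" if "T \<in> range F" for T
        using that * FN by (auto simp: F_def closed_subset)
    qed auto
    moreover have "\<Union> (range F) = N" using cover FN by blast
    ultimately have "N = {}"
      by (metis interior_of_topspace topspace_euclidean_subtopology)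
    then show False using N subspace_0 by blast
  qed
  then obtain n U y0 where U: "openin (top_of_set N) U" "U \<subseteq> F n" "y0 \<in> U"
    by (auto simp: interior_of_def)
  then have y0: "y0 \<in> N" using openin_imp_subset by blast
  obtain \<epsilon> where eps: "\<epsilon> > 0" "ball y0 \<epsilon> \<inter> N \<subseteq> U"
    using U(1,3) unfolding openin_contains_ball by blast
  have approx0: "\<exists>x\<in>M. norm x \<le> 2 * real n \<and> norm (y - f x) < d"
    if y: "y \<in> N" "norm y < \<epsilon>" and d: "d > 0" for y d
  proof -
    have "y0 + y \<in> ball y0 \<epsilon> \<inter> N"
      using y y0 N by (auto simp: dist_norm subspace_add)
    then have "y0 + y \<in> F n" "y0 \<in> F n"
      using eps(2) U(2,3) by blast+
    have near: "\<exists>x\<in>M. norm x \<le> n \<and> dist (f x) w < d/2" if "w \<in> F n" for w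
    proof -
      have "\<exists>v\<in>f ` (M \<inter> cball 0 (real n)). dist v w < d/2"
        using that half_gt_zero[OF d] unfolding F_def closure_approachable by blast
      then show ?thesis by auto
    qed
    obtain x1 where x1: "x1 \<in> M" "norm x1 \<le> n" "dist (f x1) (y0 + y) < d/2"
      using near[OF \<open>y0 + y \<in> F n\<close>] by blast
    obtain x2 where x2: "x2 \<in> M" "norm x2 \<le> n" "dist (f x2) y0 < d/2"
      using near[OF \<open>y0 \<in> F n\<close>] by blast
    have "norm (y - f (x1 - x2)) = norm ((y0 + y - f x1) - (y0 - f x2))"
      unfolding diff[OF x1(1) x2(1)] by (simp add: algebra_simps)
    also have "\<dots> \<le> norm (y0 + y - f x1) + norm (y0 - f x2)" by (rule norm_triangle_ineq4)
    also have "\<dots> < d" using x1 x2 by (simp add: dist_norm norm_minus_commute)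
    finally show ?thesis
      using x1 x2 M subspace_diff norm_triangle_ineq4[of x1 x2] by (intro bexI[of _ "x1 - x2"]) auto
  qed
  \<comment> \<open>rescaling to norm \<open>\<epsilon> / 2\<close> turns the radius \<open>2 n\<close> into \<open>4 n / \<epsilon>\<close>; the summand \<open>1\<close>
      keeps \<open>c\<close> positive\<close>
  define c where "c = 4 * (real n + 1) / \<epsilon>"
  have c: "c > 0" using eps by (simp add: c_def)
  have approx: "\<exists>x\<in>M. norm x \<le> c * norm y \<and> norm (y - f x) \<le> norm y / 2" if y: "y \<in> N" for y
  proof (cases "y = 0")
    case True
    then show ?thesis using M subspace_0 f0 by (intro bexI[of _ 0]) auto
  next
    case False
    define s where "s = \<epsilon> / (2 * norm y)"
    have s: "s > 0" using False eps by (simp add: s_def)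
    have "s *\<^sub>R y \<in> N" "norm (s *\<^sub>R y) < \<epsilon>" "s * norm y / 2 > 0"
      using y N subspace_scale s eps False by (auto simp: s_def)
    then obtain x where x: "x \<in> M" "norm x \<le> 2 * real n" "norm (s *\<^sub>R y - f x) < s * norm y / 2"
      using approx0 by blast
    have "y - f (inverse s *\<^sub>R x) = inverse s *\<^sub>R (s *\<^sub>R y - f x)"
      using s x scale by (simp add: algebra_simps)
    then have "norm (y - f (inverse s *\<^sub>R x)) = inverse s * norm (s *\<^sub>R y - f x)"
      using s by simp
    also have "\<dots> \<le> inverse s * (s * norm y / 2)"
      using x s by (intro mult_left_mono) auto
    also have "\<dots> = norm y / 2" using s by simp
    finally have 1: "norm (y - f (inverse s *\<^sub>R x)) \<le> norm y / 2" .
    have "norm (inverse s *\<^sub>R x) \<le> inverse s * (2 * real n + 2)"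
      using s x by (auto intro!: mult_left_mono)
    also have "\<dots> = c * norm y" using False eps by (simp add: s_def c_def field_simps)
    finally show ?thesis using 1 x M subspace_scale by blast
  qed
  then obtain g where g: "\<And>y. y \<in> N \<Longrightarrow> g y \<in> M \<and> norm (g y) \<le> c * norm y \<and> norm (y - f (g y)) \<le> norm y / 2"
    by metis
  have "\<exists>x\<in>M. f x = y \<and> norm x \<le> 2 * c * norm y" if y: "y \<in> N" for y
  proof -
    define e where "e k = ((\<lambda>z. z - f (g z)) ^^ k) y" for k
    have e0: "e 0 = y" and eS: "e (Suc k) = e k - f (g (e k))" for k by (auto simp: e_def)
    have eN: "e k \<in> N" for k
      by (induction k) (use y g onto N in \<open>auto simp: e0 eS intro!: subspace_diff\<close>)
    have en: "norm (e k) \<le> norm y * (1/2)^k" for k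
    proof (induction k)
      case (Suc k)
      then show ?case using g[OF eN[of k]] by (simp add: eS)
    qed (simp add: e0)
    define h where "h k = g (e k)" for k
    have hM: "h k \<in> M" and hn: "norm (h k) \<le> c * norm y * (1/2)^k" for k
    proof -
      show "h k \<in> M" using g eN by (simp add: h_def)
      have "norm (h k) \<le> c * norm (e k)" using g eN by (simp add: h_def)
      also have "\<dots> \<le> c * (norm y * (1/2)^k)" using en c by (intro mult_left_mono) auto
      finally show "norm (h k) \<le> c * norm y * (1/2)^k" by simp
    qed
    have geo: "summable (\<lambda>k. c * norm y * (1/2)^k)" by (intro summable_mult summable_geometric) auto
    have hs: "summable h"
      by (rule summable_comparison_test'[OF geo]) (use hn in auto)
    define x where "x = suminf h"
    have partM: "sum h {..<k} \<in> M" for k using M hM by (intro subspace_sum) auto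
    have lim: "(\<lambda>k. sum h {..<k}) \<longlonglongrightarrow> x" unfolding x_def by (rule summable_LIMSEQ[OF hs])
    have xM: "x \<in> M" using closed_sequentially[OF M(2) _ lim] partM by blast
    have fpart: "f (sum h {..<k}) = y - e k" for k
    proof (induction k)
      case (Suc k)
      then show ?case using add partM hM by (simp add: eS h_def)
    qed (simp add: f0 e0)
    have "(\<lambda>k. f (sum h {..<k})) \<longlonglongrightarrow> f x"
    proof (rule LIM_zero_cancel, rule Lim_null_comparison)
      show "\<forall>\<^sub>F k in sequentially. norm (f (sum h {..<k}) - f x) \<le> norm (sum h {..<k} - x) * K"
      proof (rule always_eventually, rule allI)
        show "norm (f (sum h {..<k}) - f x) \<le> norm (sum h {..<k} - x) * K" for k
          using bound[OF subspace_diff[OF M(1) partM xM]] diff[OF partM xM] by simp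
      qed
      show "(\<lambda>k. norm (sum h {..<k} - x) * K) \<longlonglongrightarrow> 0"
        using tendsto_mult_left_zero[OF tendsto_norm_zero[OF LIM_zero[OF lim]]] .
    qed
    moreover have "(\<lambda>k. y - e k) \<longlonglongrightarrow> y - 0"
    proof (intro tendsto_intros Lim_null_comparison[of e])
      show "\<forall>\<^sub>F k in sequentially. norm (e k) \<le> norm y * (1/2)^k" using en by simp
      show "(\<lambda>k. norm y * (1/2)^k) \<longlonglongrightarrow> 0"
        by (intro tendsto_mult_right_zero LIMSEQ_power_zero) auto
    qed
    ultimately have fx: "f x = y" using fpart LIMSEQ_unique by fastforce
    have "norm x \<le> (\<Sum>k. c * norm y * (1/2)^k)"
      unfolding x_def by (rule norm_suminf_le[OF hn geo])
    also have "\<dots> = 2 * c * norm y"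
      using suminf_mult[OF summable_geometric[of "1/2::real"], of "c * norm y"]
        suminf_geometric[of "1/2::real"] by simp
    finally show ?thesis using xM fx by blast
  qed
  then show ?thesis using c by (intro exI[of _ "2 * c"]) auto
qed

section \<open>Integrals of vector-valued functions\<close>

lemma integral_in_closed_subspace:
  fixes f :: "real \<Rightarrow> 'a::banach"
  assumes M: "subspace M" "closed M" and f: "continuous_on {a..b} f" "\<And>t. t \<in> {a..b} \<Longrightarrow> f t \<in> M"
  shows "integral {a..b} f \<in> M"
proof (rule ccontr)
  assume "integral {a..b} f \<notin> M"
  then obtain u :: "'a \<Rightarrow> real" where u: "bounded_linear u" "\<And>x. x \<in> M \<Longrightarrow> u x = 0"
    "u (integral {a..b} f) \<noteq> 0"
    using separate_point_closed_subspace[OF M] by blast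
  have "u (integral {a..b} f) = integral {a..b} (u \<circ> f)"
    by (rule integral_linear[OF integrable_continuous_interval[OF f(1)] u(1), symmetric])
  also have "\<dots> = integral {a..b} (\<lambda>t. 0)"
    by (rule Henstock_Kurzweil_Integration.integral_cong) (use u f in auto)
  finally show False using u by simp
qed

lemma csubspace_imp_subspace: "csubspace M \<Longrightarrow> subspace M"
  by (auto simp: subspace_def complex_vector.subspace_def scaleR_scaleC)

text \<open>
  A real functional \<open>u\<close> is the real part of the complex functional \<open>u x - \<i> u (\<i> x)\<close>; the latter
  vanishes on \<open>M\<close> because \<open>M\<close> is invariant under \<open>\<i>\<close>.
\<close>

lemma complex_functional_separating:
  fixes M :: "'a::complex_normed_vector set"
  assumes M: "csubspace M" "closed M" and y: "y \<notin> M"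
  shows "\<exists>\<phi>. bounded_linear \<phi> \<and> (\<forall>c x. \<phi> (c *\<^sub>C x) = c * \<phi> x) \<and> (\<forall>x\<in>M. \<phi> x = 0) \<and> \<phi> y \<noteq> 0"
proof -
  obtain u :: "'a \<Rightarrow> real" where u: "bounded_linear u" "\<And>x. x \<in> M \<Longrightarrow> u x = 0" "u y \<noteq> 0"
    using separate_point_closed_subspace[OF csubspace_imp_subspace[OF M(1)] M(2) y] by blast
  interpret u: bounded_linear u by (rule u(1))
  define \<phi> where "\<phi> x = Complex (u x) (- u (\<i> *\<^sub>C x))" for x
  have bl: "bounded_linear (\<lambda>x. u (\<i> *\<^sub>C x))"
    by (rule bounded_linear_compose[OF u(1) bounded_linear_scaleC_const])
  have i_lin: "u (\<i> *\<^sub>C (x + z)) = u (\<i> *\<^sub>C x) + u (\<i> *\<^sub>C z)" for x z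
    by (simp add: scaleC_add_right u.add)
  have re: "u (complex_of_real r *\<^sub>C x) = r * u x" for r x
    using u.scaleR[of r x] by (simp add: scaleR_scaleC)
  have im: "u ((\<i> * complex_of_real r) *\<^sub>C x) = r * u (\<i> *\<^sub>C x)" for r x
    using re[of r "\<i> *\<^sub>C x"] by (simp add: scaleC_scaleC mult.commute)
  have ii: "u (\<i> *\<^sub>C \<i> *\<^sub>C x) = - u x" for x
    using re[of "-1" x] by (simp add: scaleC_scaleC)
  have uc: "u (c *\<^sub>C x) = Re c * u x + Im c * u (\<i> *\<^sub>C x)" for c x
  proof -
    have "c *\<^sub>C x = complex_of_real (Re c) *\<^sub>C x + (\<i> * complex_of_real (Im c)) *\<^sub>C x"
      by (metis complex_eq scaleC_add_left)
    then show ?thesis by (simp only: u.add re im)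
  qed
  have uic: "u (\<i> *\<^sub>C c *\<^sub>C x) = Re c * u (\<i> *\<^sub>C x) - Im c * u x" for c x
  proof -
    have "u (\<i> *\<^sub>C c *\<^sub>C x) = u (c *\<^sub>C \<i> *\<^sub>C x)" by (simp add: scaleC_scaleC mult.commute)
    then show ?thesis using uc[of c "\<i> *\<^sub>C x"] ii[of x] by simp
  qed
  show ?thesis
  proof (intro exI[of _ \<phi>] conjI allI ballI)
    have 1: "bounded_linear (\<lambda>x. complex_of_real (u x))"
      by (rule bounded_linear_compose[OF bounded_linear_of_real u(1)])
    have 2: "bounded_linear (\<lambda>x. complex_of_real (u (\<i> *\<^sub>C x)))"
      by (rule bounded_linear_compose[OF bounded_linear_of_real bl])
    have "bounded_linear (\<lambda>x. complex_of_real (u x) - \<i> * complex_of_real (u (\<i> *\<^sub>C x)))"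
      by (rule bounded_linear_sub[OF 1 bounded_linear_compose[OF bounded_linear_mult_right 2]])
    moreover have "\<phi> = (\<lambda>x. complex_of_real (u x) - \<i> * complex_of_real (u (\<i> *\<^sub>C x)))"
      by (auto simp: \<phi>_def complex_eq_iff)
    ultimately show "bounded_linear \<phi>" by simp
    show "\<phi> (c *\<^sub>C x) = c * \<phi> x" for c x
      using uc[of c x] uic[of c x] by (simp add: \<phi>_def complex_eq_iff)
    show "\<phi> x = 0" if "x \<in> M" for x
      using u(2)[OF that] u(2)[OF complex_vector.subspace_scale[OF M(1) that]]
      by (simp add: \<phi>_def complex_eq_iff)
    show "\<phi> y \<noteq> 0" using u(3) by (simp add: \<phi>_def complex_eq_iff)
  qed
qed

lemma bounded_bilinear_scaleC:
  "bounded_bilinear (scaleC :: complex \<Rightarrow> 'a \<Rightarrow> 'a::complex_normed_vector)"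
  by (rule bounded_bilinear.intro)
    (auto simp: scaleC_add_left scaleC_add_right scaleR_scaleC scaleC_scaleC scaleC_complex_def
      norm_scaleC mult.commute intro!: exI[of _ 1])

text \<open>
  Cauchy's theorem for vector-valued functions, parametrised by \<open>t\<close> so that no vector-valued
  contour integral is needed. Composing with a functional that detects the integral reduces it
  to the scalar case.
\<close>

lemma circle_integral_zero:
  fixes h :: "complex \<Rightarrow> 'a::complex_banach"
  assumes h: "\<And>z. z \<in> ball a r \<Longrightarrow> \<exists>D. (h has_derivative (\<lambda>w. w *\<^sub>C D)) (at z)" and e: "0 < e" "e < r"
  shows "integral {0..1} (\<lambda>t. (circlepath a e t - a) *\<^sub>C h (circlepath a e t)) = 0"
proof (rule ccontr)
  let ?g = "circlepath a e"
  define F where "F t = (?g t - a) *\<^sub>C h (?g t)" for t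
  assume "integral {0..1} (\<lambda>t. (?g t - a) *\<^sub>C h (?g t)) \<noteq> 0"
  then have "integral {0..1} F \<notin> {0}" by (simp add: F_def[abs_def])
  moreover have "csubspace {0::'a}" by (rule complex_vector.subspace_single_0)
  ultimately obtain \<phi> where \<phi>: "bounded_linear \<phi>" "\<And>c x. \<phi> (c *\<^sub>C x) = c * \<phi> x"
    "\<phi> (integral {0..1} F) \<noteq> 0"
    using complex_functional_separating[of "{0}" "integral {0..1} F"] by blast
  have g_in: "?g t \<in> ball a r" for t
    using e by (simp add: circlepath dist_norm norm_mult)
  have hol: "(\<lambda>z. \<phi> (h z)) holomorphic_on ball a r"
    unfolding holomorphic_on_def
  proof
    fix z assume "z \<in> ball a r"
    then obtain D where D: "(h has_derivative (\<lambda>w. w *\<^sub>C D)) (at z)" using h by blast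
    have "((\<lambda>z. \<phi> (h z)) has_derivative (\<lambda>w. \<phi> (w *\<^sub>C D))) (at z)"
      by (rule bounded_linear.has_derivative[OF \<phi>(1) D])
    then have "((\<lambda>z. \<phi> (h z)) has_field_derivative \<phi> D) (at z)"
      unfolding has_field_derivative_def by (simp add: \<phi>(2) mult_commute_abs)
    then show "(\<lambda>z. \<phi> (h z)) field_differentiable at z within ball a r"
      using field_differentiable_at_within field_differentiable_def by blast
  qed
  have "((\<lambda>z. \<phi> (h z)) has_contour_integral 0) ?g"
    by (rule Cauchy_theorem_disc_simple[OF hol]) (use e in \<open>auto simp: sphere_def\<close>)
  then have *: "((\<lambda>t. \<phi> (h (?g t)) * vector_derivative ?g (at t)) has_integral 0) {0..1}"
    by (simp add: has_contour_integral)
  have "((\<lambda>t. \<phi> (h (?g t)) * (2 * of_real pi * \<i> * (?g t - a))) has_integral 0) {0..1}"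
  proof -
    have "vector_derivative ?g (at t) = 2 * of_real pi * \<i> * (?g t - a)" for t
      unfolding vector_derivative_circlepath by (simp add: circlepath mult_ac)
    then show ?thesis using * by (simp only:)
  qed
  then have "((\<lambda>t. inverse (2 * of_real pi * \<i>) * (\<phi> (h (?g t)) * (2 * of_real pi * \<i> * (?g t - a))))
      has_integral inverse (2 * of_real pi * \<i>) * 0) {0..1}"
    by (rule has_integral_mult_right)
  moreover have "inverse (2 * of_real pi * \<i>) * (\<phi> (h (?g t)) * (2 * of_real pi * \<i> * (?g t - a))) = \<phi> (F t)" for t
  proof -
    have "inverse c * (x * (c * y)) = y * x" if "c \<noteq> 0" for c x y :: complex
      using that by simp
    from this[of "2 * of_real pi * \<i>"] show ?thesis by (simp add: F_def \<phi>(2))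
  qed
  ultimately have 0: "((\<lambda>t. \<phi> (F t)) has_integral 0) {0..1}"
    by simp
  have "continuous_on (ball a r) h"
    by (metis h has_derivative_continuous continuous_at_imp_continuous_on)
  then have "continuous_on {0..1} (\<lambda>t. h (?g t))"
    by (rule continuous_on_compose2) (use g_in in \<open>auto intro!: continuous_intros simp: circlepath\<close>)
  then have "continuous_on {0..1} F"
    unfolding F_def[abs_def]
    by (intro bounded_bilinear.continuous_on[OF bounded_bilinear_scaleC])
      (auto intro!: continuous_intros simp: circlepath)
  then have "integral {0..1} (\<phi> \<circ> F) = \<phi> (integral {0..1} F)"
    by (intro integral_linear integrable_continuous_interval \<phi>(1))
  then show False using 0 \<phi>(3) by (simp add: comp_def integral_unique)
qed

section \<open>Bounded operators on a closed subspace\<close>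

text \<open>
  Operators on a closed complex subspace \<open>M\<close> are functions on the ambient type, used on \<open>M\<close>
  only. Facts named \<open>bo_\<dots>\<close> form the calculus of \<open>bounded_ops M\<close>, facts named \<open>csub_\<dots>\<close> that of
  closed subspaces.
\<close>

definition closed_csubspace :: "'a::complex_normed_vector set \<Rightarrow> bool" where
  "closed_csubspace M \<longleftrightarrow> csubspace M \<and> closed M"

lemma closed_csubspaceD:
  assumes "closed_csubspace M"
  shows csub_closed: "closed M"
    and csub_0: "0 \<in> M"
    and csub_add: "\<And>x y. x \<in> M \<Longrightarrow> y \<in> M \<Longrightarrow> x + y \<in> M"
    and csub_diff: "\<And>x y. x \<in> M \<Longrightarrow> y \<in> M \<Longrightarrow> x - y \<in> M"
    and csub_scale: "\<And>c x. x \<in> M \<Longrightarrow> c *\<^sub>C x \<in> M"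
  using assms complex_vector.subspace_0 complex_vector.subspace_add complex_vector.subspace_diff
    complex_vector.subspace_scale
  by (auto simp: closed_csubspace_def)

lemma csub_UNIV: "closed_csubspace UNIV"
  by (simp add: closed_csubspace_def complex_vector.subspace_UNIV)

lemma csub_subspace: "closed_csubspace M \<Longrightarrow> subspace M"
  by (simp add: closed_csubspace_def csubspace_imp_subspace)

lemmas scaleC_simps =
  complex_vector.scale_zero_left complex_vector.scale_zero_right
  complex_vector.scale_minus_left complex_vector.scale_minus_right
  complex_vector.scale_left_diff_distrib complex_vector.scale_right_diff_distrib
  scaleC_add_left scaleC_add_right scaleC_scaleC scaleC_one

lemma bo_in: "T \<in> bounded_ops M \<Longrightarrow> x \<in> M \<Longrightarrow> T x \<in> M"
  by (auto simp: bounded_ops_def)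

lemma bo_add: "T \<in> bounded_ops M \<Longrightarrow> x \<in> M \<Longrightarrow> y \<in> M \<Longrightarrow> T (x + y) = T x + T y"
  by (auto simp: bounded_ops_def)

lemma bo_scale: "T \<in> bounded_ops M \<Longrightarrow> x \<in> M \<Longrightarrow> T (c *\<^sub>C x) = c *\<^sub>C T x"
  by (auto simp: bounded_ops_def)

lemma bo_0: "closed_csubspace M \<Longrightarrow> T \<in> bounded_ops M \<Longrightarrow> T 0 = 0"
  using bo_scale[of T M 0 0] csub_0[of M] by (simp add: scaleC_simps)

lemma bo_diff:
  assumes "closed_csubspace M" "T \<in> bounded_ops M" "x \<in> M" "y \<in> M"
  shows "T (x - y) = T x - T y"
  using bo_add[OF assms(2) csub_diff[OF assms(1,3,4)] assms(4)] by simp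

lemma bo_bound:
  assumes "T \<in> bounded_ops M"
  obtains K where "K > 0" "\<And>x. x \<in> M \<Longrightarrow> norm (T x) \<le> K * norm x"
proof -
  have "\<exists>K. \<forall>x\<in>M. norm (T x) \<le> norm x * K"
    using assms by (simp add: bounded_ops_def)
  then obtain K where K: "\<And>x. x \<in> M \<Longrightarrow> norm (T x) \<le> norm x * K" by blast
  have "norm (T x) \<le> (\<bar>K\<bar> + 1) * norm x" if "x \<in> M" for x
  proof -
    have "norm x * K \<le> norm x * (\<bar>K\<bar> + 1)" by (intro mult_left_mono) auto
    then show ?thesis using K[OF that] by (simp add: mult.commute)
  qed
  then show thesis using that[of "\<bar>K\<bar> + 1"] by auto
qed

lemma bounded_opsI:
  assumes "\<And>x. x \<in> M \<Longrightarrow> T x \<in> M"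
    and "\<And>x y. x \<in> M \<Longrightarrow> y \<in> M \<Longrightarrow> T (x + y) = T x + T y"
    and "\<And>c x. x \<in> M \<Longrightarrow> T (c *\<^sub>C x) = c *\<^sub>C T x"
    and "\<And>x. x \<in> M \<Longrightarrow> norm (T x) \<le> K * norm x"
  shows "T \<in> bounded_ops M"
proof -
  have "\<forall>x\<in>M. norm (T x) \<le> norm x * K" using assms(4) by (simp add: mult.commute)
  moreover have "T ` M \<subseteq> M" using assms(1) by blast
  ultimately show ?thesis unfolding bounded_ops_def using assms(2,3) by blast
qed

lemma bo_cong:
  assumes M: "closed_csubspace M" and T: "T \<in> bounded_ops M" and eq: "\<And>x. x \<in> M \<Longrightarrow> T' x = T x"
  shows "T' \<in> bounded_ops M"
proof -
  obtain K where K: "\<And>x. x \<in> M \<Longrightarrow> norm (T x) \<le> K * norm x" using bo_bound[OF T] by blast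
  show ?thesis
  proof (rule bounded_opsI[where K = K])
    show "T' (x + y) = T' x + T' y" if "x \<in> M" "y \<in> M" for x y
      using bo_add[OF T that] eq[OF csub_add[OF M that]] eq that by simp
    show "T' (c *\<^sub>C x) = c *\<^sub>C T' x" if "x \<in> M" for c x
      using bo_scale[OF T that] eq[OF csub_scale[OF M that]] eq[OF that] by simp
  qed (simp_all add: eq bo_in[OF T] K)
qed

lemma bo_id: "(\<lambda>x. x) \<in> bounded_ops M"
  by (rule bounded_opsI[where K = 1]) auto

lemma bo_zero: "closed_csubspace M \<Longrightarrow> (\<lambda>x. 0) \<in> bounded_ops M"
  by (rule bounded_opsI[where K = 0]) (auto simp: csub_0 scaleC_simps)

lemma bo_comp:
  assumes S: "S \<in> bounded_ops M" and T: "T \<in> bounded_ops M"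
  shows "(\<lambda>x. S (T x)) \<in> bounded_ops M"
proof -
  obtain K where K: "K > 0" "\<And>x. x \<in> M \<Longrightarrow> norm (S x) \<le> K * norm x" using bo_bound[OF S] by blast
  obtain L where L: "L > 0" "\<And>x. x \<in> M \<Longrightarrow> norm (T x) \<le> L * norm x" using bo_bound[OF T] by blast
  show ?thesis
  proof (rule bounded_opsI[where K = "K * L"])
    show "norm (S (T x)) \<le> K * L * norm x" if "x \<in> M" for x
    proof -
      have "K * norm (T x) \<le> K * (L * norm x)" by (rule mult_left_mono[OF L(2)[OF that]]) (use K in simp)
      then show ?thesis using K(2)[OF bo_in[OF T that]] by (simp add: mult.assoc)
    qed
  qed (simp_all add: bo_in[OF S] bo_in[OF T] bo_add[OF S] bo_add[OF T] bo_scale[OF S] bo_scale[OF T])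
qed

lemma bo_plus:
  assumes M: "closed_csubspace M" and S: "S \<in> bounded_ops M" and T: "T \<in> bounded_ops M"
  shows "(\<lambda>x. S x + T x) \<in> bounded_ops M"
proof -
  obtain K where K: "K > 0" "\<And>x. x \<in> M \<Longrightarrow> norm (S x) \<le> K * norm x" using bo_bound[OF S] by blast
  obtain L where L: "L > 0" "\<And>x. x \<in> M \<Longrightarrow> norm (T x) \<le> L * norm x" using bo_bound[OF T] by blast
  show ?thesis
  proof (rule bounded_opsI[where K = "K + L"])
    show "norm (S x + T x) \<le> (K + L) * norm x" if "x \<in> M" for x
      using norm_triangle_ineq[of "S x" "T x"] K(2)[OF that] L(2)[OF that] by (simp add: algebra_simps)
  qed (simp_all add: bo_in[OF S] bo_in[OF T] bo_add[OF S] bo_add[OF T] bo_scale[OF S] bo_scale[OF T]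
      csub_add[OF M] scaleC_simps)
qed

lemma bo_scaleC:
  assumes M: "closed_csubspace M" and T: "T \<in> bounded_ops M"
  shows "(\<lambda>x. c *\<^sub>C T x) \<in> bounded_ops M"
proof -
  obtain L where L: "L > 0" "\<And>x. x \<in> M \<Longrightarrow> norm (T x) \<le> L * norm x" using bo_bound[OF T] by blast
  show ?thesis
  proof (rule bounded_opsI[where K = "cmod c * L"])
    show "norm (c *\<^sub>C T x) \<le> cmod c * L * norm x" if "x \<in> M" for x
      using mult_left_mono[OF L(2)[OF that], of "cmod c"] by (simp add: norm_scaleC mult.assoc)
  qed (simp_all add: bo_in[OF T] bo_add[OF T] bo_scale[OF T] csub_scale[OF M] scaleC_simps mult.commute)
qed

lemma bo_minus:
  assumes M: "closed_csubspace M" and S: "S \<in> bounded_ops M" and T: "T \<in> bounded_ops M"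
  shows "(\<lambda>x. S x - T x) \<in> bounded_ops M"
  using bo_plus[OF M S bo_scaleC[OF M T, of "-1"]] by (simp add: scaleC_simps)

lemma bo_shift: "closed_csubspace M \<Longrightarrow> T \<in> bounded_ops M \<Longrightarrow> shift T z \<in> bounded_ops M"
  unfolding shift_def by (intro bo_minus bo_scaleC bo_id)

lemma bo_funpow: "T \<in> bounded_ops M \<Longrightarrow> T ^^ n \<in> bounded_ops M"
proof (induction n)
  case 0
  then show ?case using bo_id[of M] by (simp add: id_def)
next
  case (Suc n)
  then show ?case using bo_comp[of T M "T ^^ n"] by (simp add: comp_def)
qed

lemma bo_sum:
  assumes "closed_csubspace M" "\<And>i. i \<in> I \<Longrightarrow> T i \<in> bounded_ops M"
  shows "(\<lambda>x. \<Sum>i\<in>I. T i x) \<in> bounded_ops M"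
  using assms(2)
proof (induction I rule: infinite_finite_induct)
  case (insert i I)
  then show ?case using bo_plus[OF assms(1), of "T i" "\<lambda>x. \<Sum>i\<in>I. T i x"] by simp
qed (use bo_zero[OF assms(1)] in simp_all)

lemma bo_restrict:
  assumes "T \<in> bounded_ops M" "N \<subseteq> M" "\<And>x. x \<in> N \<Longrightarrow> T x \<in> N"
  shows "T \<in> bounded_ops N"
proof -
  obtain K where "K > 0" "\<And>x. x \<in> M \<Longrightarrow> norm (T x) \<le> K * norm x" using bo_bound[OF assms(1)] by blast
  then show ?thesis
    using assms by (intro bounded_opsI[where K = K]) (auto intro: bo_add bo_scale)
qed

lemma bo_continuous:
  assumes M: "closed_csubspace M" and T: "T \<in> bounded_ops M"
  shows "continuous_on M T"
proof -
  obtain K where K: "K > 0" "\<And>x. x \<in> M \<Longrightarrow> norm (T x) \<le> K * norm x" using bo_bound[OF T] by blast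
  have "K-lipschitz_on M T"
  proof (rule lipschitz_onI)
    show "dist (T x) (T y) \<le> K * dist x y" if "x \<in> M" "y \<in> M" for x y
      using K(2)[OF csub_diff[OF M that]] bo_diff[OF M T that] by (simp add: dist_norm)
  qed (use K(1) in simp)
  then show ?thesis by (rule lipschitz_on_continuous_on)
qed

lemma bo_UNIV_bounded_linear: "T \<in> bounded_ops UNIV \<Longrightarrow> bounded_linear T"
proof -
  assume T: "T \<in> bounded_ops UNIV"
  then obtain K where "K > 0" "\<And>x. norm (T x) \<le> K * norm x" using bo_bound[OF T] by auto
  then show ?thesis
    by (intro bounded_linear_intro[where K = K])
      (use bo_add[OF T] bo_scale[OF T] in \<open>auto simp: scaleR_scaleC mult.commute\<close>)
qed

lemma image_csubspace:
  assumes M: "closed_csubspace M" and T: "T \<in> bounded_ops M"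
  shows "csubspace (T ` M)"
  unfolding complex_vector.subspace_def
proof (intro conjI ballI allI)
  show "0 \<in> T ` M" using bo_0[OF M T] csub_0[OF M] by force
  show "x + y \<in> T ` M" if "x \<in> T ` M" "y \<in> T ` M" for x y
    using that by (auto simp flip: bo_add[OF T] intro!: imageI csub_add[OF M])
  show "c *\<^sub>C x \<in> T ` M" if "x \<in> T ` M" for c x
    using that by (auto simp flip: bo_scale[OF T] intro!: imageI csub_scale[OF M])
qed

lemma closed_csubspace_eq_set:
  assumes M: "closed_csubspace M" and S: "S \<in> bounded_ops M" and T: "T \<in> bounded_ops M"
  shows "closed_csubspace {x\<in>M. S x = T x}"
proof -
  have "closed {x\<in>M. S x = T x}"
  proof -
    have "closed (M \<inter> (\<lambda>x. S x - T x) -` {0})"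
      by (intro continuous_closed_preimage continuous_on_diff bo_continuous[OF M] S T csub_closed[OF M]) auto
    moreover have "M \<inter> (\<lambda>x. S x - T x) -` {0} = {x\<in>M. S x = T x}" by auto
    ultimately show ?thesis by simp
  qed
  moreover have "csubspace {x\<in>M. S x = T x}"
    unfolding complex_vector.subspace_def
    by (auto simp: csub_0[OF M] bo_0[OF M S] bo_0[OF M T] csub_add[OF M] csub_scale[OF M]
        bo_add[OF S] bo_add[OF T] bo_scale[OF S] bo_scale[OF T])
  ultimately show ?thesis by (simp add: closed_csubspace_def)
qed

lemma funpow_in: "T \<in> bounded_ops M \<Longrightarrow> x \<in> M \<Longrightarrow> (T ^^ n) x \<in> M"
  using bo_in[OF bo_funpow] by blast

lemma funpow_commute_on:
  assumes T: "\<And>x. x \<in> M \<Longrightarrow> T x \<in> M" and ST: "\<And>x. x \<in> M \<Longrightarrow> S (T x) = T (S x)" and "x \<in> M"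
  shows "S ((T ^^ n) x) = (T ^^ n) (S x)"
proof -
  have "(T ^^ n) x \<in> M \<and> S ((T ^^ n) x) = (T ^^ n) (S x)"
    by (induction n) (use assms in auto)
  then show ?thesis by blast
qed

lemma funpow_cong_on:
  assumes T: "\<And>x. x \<in> M \<Longrightarrow> T x \<in> M" and ST: "\<And>x. x \<in> M \<Longrightarrow> S x = T x" and "x \<in> M"
  shows "(S ^^ n) x = (T ^^ n) x"
proof -
  have "(T ^^ n) x \<in> M \<and> (S ^^ n) x = (T ^^ n) x"
    by (induction n) (use assms in auto)
  then show ?thesis by blast
qed

lemma funpow_commutes_on:
  assumes S: "\<And>x. x \<in> M \<Longrightarrow> S x \<in> M" and T: "\<And>x. x \<in> M \<Longrightarrow> T x \<in> M"
    and ST: "\<And>x. x \<in> M \<Longrightarrow> S (T x) = T (S x)" and x: "x \<in> M"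
  shows "(S ^^ m) ((T ^^ n) x) = (T ^^ n) ((S ^^ m) x)"
proof -
  have "T ((S ^^ m) y) = (S ^^ m) (T y)" if "y \<in> M" for y
    by (rule funpow_commute_on[OF S _ that]) (use ST in auto)
  then show ?thesis
    by (intro funpow_commute_on[OF T _ x]) auto
qed

section \<open>Projections and complemented subspaces\<close>

definition proj_on :: "'a::complex_normed_vector set \<Rightarrow> ('a \<Rightarrow> 'a) \<Rightarrow> bool" where
  "proj_on M P \<longleftrightarrow> P \<in> bounded_ops M \<and> (\<forall>x\<in>M. P (P x) = P x)"

lemma proj_on_UNIV: "proj_on UNIV P \<longleftrightarrow> projector P"
  by (simp add: proj_on_def projector_def fun_eq_iff)

lemma proj_bo: "proj_on M P \<Longrightarrow> P \<in> bounded_ops M"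
  by (simp add: proj_on_def)

lemma proj_idem: "proj_on M P \<Longrightarrow> x \<in> M \<Longrightarrow> P (P x) = P x"
  by (simp add: proj_on_def)

lemma proj_range_eq: "proj_on M P \<Longrightarrow> P ` M = {x\<in>M. P x = x}"
  by (auto simp: proj_idem bo_in[OF proj_bo] intro: rev_image_eqI)

lemma proj_range_closed:
  assumes M: "closed_csubspace M" and P: "proj_on M P"
  shows "closed_csubspace (P ` M)"
  unfolding proj_range_eq[OF P] by (rule closed_csubspace_eq_set[OF M proj_bo[OF P] bo_id])

lemma proj_compl:
  assumes M: "closed_csubspace M" and P: "proj_on M P"
  shows "proj_on M (\<lambda>x. x - P x)"
  unfolding proj_on_def
proof (intro conjI ballI)
  show "(\<lambda>x. x - P x) \<in> bounded_ops M" by (intro bo_minus M bo_id proj_bo P)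
  show "x - P x - P (x - P x) = x - P x" if "x \<in> M" for x
    using that by (simp add: bo_diff[OF M proj_bo[OF P]] bo_in[OF proj_bo[OF P]] proj_idem[OF P])
qed

lemma proj_compl_range:
  assumes M: "closed_csubspace M" and P: "proj_on M P"
  shows "(\<lambda>x. x - P x) ` M = {x\<in>M. P x = 0}"
  unfolding proj_range_eq[OF proj_compl[OF M P]] by auto

text \<open>
  The addition \<open>U \<times> V \<rightarrow> M\<close> is a bounded bijection, hence by the open mapping theorem its
  inverse, and with it the projection to the first component, is bounded.
\<close>

lemma projection_of_direct_sum:
  fixes M :: "'a::complex_banach set"
  assumes M: "closed_csubspace M" and U: "closed_csubspace U" and V: "closed_csubspace V"
    and UV: "U \<inter> V = {0}" "U + V = M"
  shows "\<exists>P. proj_on M P \<and> P ` M = U \<and> {x\<in>M. P x = 0} = V"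
proof -
  have UM: "U \<subseteq> M" and VM: "V \<subseteq> M"
    using UV csub_0[OF U] csub_0[OF V] set_zero_plus2[of U V] set_zero_plus2[of V U] by (auto simp: add.commute)
  have sub: "subspace (U \<times> V)" "closed (U \<times> V)"
    using csub_subspace[OF U] csub_subspace[OF V] csub_closed[OF U] csub_closed[OF V]
    by (auto simp: subspace_Times closed_Times)
  have "\<exists>c>0. \<forall>y\<in>M. \<exists>x\<in>U \<times> V. (\<lambda>(u, v). u + v) x = y \<and> norm x \<le> c * norm y"
  proof (rule open_mapping_closed_subspaces[OF sub csub_subspace[OF M] csub_closed[OF M]])
    show "norm (case x of (u, v) \<Rightarrow> u + v) \<le> norm x * 2" for x :: "'a \<times> 'a"
    proof -
      have "norm (fst x + snd x) \<le> norm (fst x) + norm (snd x)" by (rule norm_triangle_ineq)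
      then show ?thesis
        using norm_fst_le[of "fst x" "snd x"] norm_snd_le[of "snd x" "fst x"] by (simp add: case_prod_beta)
    qed
    show "(\<lambda>(u, v). u + v) ` (U \<times> V) = M"
      using UV(2) by (auto simp: set_plus_def)
  qed (auto simp: scaleR_right_distrib)
  then obtain c where c: "c > 0"
    and ex: "\<And>y. y \<in> M \<Longrightarrow> \<exists>x\<in>U \<times> V. fst x + snd x = y \<and> norm x \<le> c * norm y"
    by (auto simp: case_prod_beta)
  have ex': "\<exists>u\<in>U. y - u \<in> V \<and> norm u \<le> c * norm y" if "y \<in> M" for y
  proof -
    obtain u v where "u \<in> U" "v \<in> V" "u + v = y" "norm (u, v) \<le> c * norm y"
      using ex[OF \<open>y \<in> M\<close>] by auto
    then show ?thesis using norm_fst_le[of u v] by (intro bexI[of _ u]) auto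
  qed
  then obtain P where P: "\<And>y. y \<in> M \<Longrightarrow> P y \<in> U \<and> y - P y \<in> V \<and> norm (P y) \<le> c * norm y"
    by metis
  have uniq: "P y = u" if "y \<in> M" "u \<in> U" "y - u \<in> V" for y u
  proof -
    have "P y - u \<in> U" using P[OF that(1)] that csub_diff[OF U] by blast
    moreover have "(y - u) - (y - P y) \<in> V" using P[OF that(1)] that csub_diff[OF V] by blast
    ultimately have "P y - u \<in> U \<inter> V" by simp
    then have "P y - u = 0" using UV(1) by blast
    then show ?thesis by simp
  qed
  have bo: "P \<in> bounded_ops M"
  proof (rule bounded_opsI[where K = c])
    show "P (x + y) = P x + P y" if "x \<in> M" "y \<in> M" for x y
    proof (rule uniq)
      have "(x - P x) + (y - P y) \<in> V" using P that csub_add[OF V] by blast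
      then show "x + y - (P x + P y) \<in> V" by (simp add: algebra_simps)
    qed (use P that csub_add[OF U] csub_add[OF M] in auto)
    show "P (c *\<^sub>C x) = c *\<^sub>C P x" if "x \<in> M" for c x
    proof (rule uniq)
      have "c *\<^sub>C (x - P x) \<in> V" using P that csub_scale[OF V] by blast
      then show "c *\<^sub>C x - c *\<^sub>C P x \<in> V" by (simp add: scaleC_simps)
    qed (use P that csub_scale[OF U] csub_scale[OF M] in auto)
  qed (use P UM in auto)
  have idU: "P u = u" if "u \<in> U" for u
    by (rule uniq) (use that UM csub_0[OF V] in auto)
  have kern: "P v = 0" if "v \<in> V" for v
    by (rule uniq) (use that VM csub_0[OF U] in auto)
  have "proj_on M P" using bo P idU by (simp add: proj_on_def)
  moreover have "P ` M = U" using P idU UM by force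
  moreover have "{x\<in>M. P x = 0} = V"
  proof
    show "{x\<in>M. P x = 0} \<subseteq> V"
    proof
      fix x assume "x \<in> {x\<in>M. P x = 0}"
      then show "x \<in> V" using P[of x] by simp
    qed
  qed (use kern VM in auto)
  ultimately show ?thesis by blast
qed

lemma complemented_in_iff:
  fixes M :: "'a::complex_banach set"
  assumes M: "closed_csubspace M"
  shows "complemented_in M U \<longleftrightarrow> (\<exists>P. proj_on M P \<and> P ` M = U)"
proof
  assume "complemented_in M U"
  then show "\<exists>P. proj_on M P \<and> P ` M = U"
    unfolding complemented_in_def closed_csubspace_def[symmetric]
    using projection_of_direct_sum[OF M, of U] by (metis closed_csubspace_def)
next
  assume "\<exists>P. proj_on M P \<and> P ` M = U"
  then obtain P where P: "proj_on M P" and U: "U = P ` M" by blast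
  let ?V = "(\<lambda>x. x - P x) ` M"
  have "U \<inter> ?V = {0}"
    unfolding U proj_compl_range[OF M P] proj_range_eq[OF P]
    using csub_0[OF M] bo_0[OF M proj_bo[OF P]] by auto
  moreover have "U + ?V = M"
  proof
    show "U + ?V \<subseteq> M"
      unfolding U by (auto simp: set_plus_def intro!: csub_add[OF M] csub_diff[OF M] bo_in[OF proj_bo[OF P]])
    show "M \<subseteq> U + ?V"
    proof
      fix x assume "x \<in> M"
      then have "P x + (x - P x) \<in> U + ?V" unfolding U by (intro set_plus_intro) auto
      then show "x \<in> U + ?V" by simp
    qed
  qed
  moreover have "U \<subseteq> M" "?V \<subseteq> M"
    unfolding U by (auto intro!: csub_diff[OF M] bo_in[OF proj_bo[OF P]])
  ultimately show "complemented_in M U"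
    unfolding complemented_in_def
    using proj_range_closed[OF M P] proj_range_closed[OF M proj_compl[OF M P]] U
    by (auto simp: closed_csubspace_def intro!: exI[of _ ?V])
qed

text \<open>
  Subtracting the \<open>P\<close>-part makes preimages unique, so that the section is linear; the open
  mapping theorem bounds it.
\<close>

lemma bounded_section:
  fixes T :: "'a::complex_banach \<Rightarrow> 'a"
  assumes M: "closed_csubspace M" and T: "T \<in> bounded_ops M" and R: "closed (T ` M)"
    and P: "proj_on M P" "P ` M = null_on M T"
  shows "\<exists>S c. (\<forall>y\<in>T ` M. S y \<in> M \<and> T (S y) = y \<and> norm (S y) \<le> c * norm y)
    \<and> (\<forall>x\<in>T ` M. \<forall>y\<in>T ` M. S (x + y) = S x + S y) \<and> (\<forall>a. \<forall>x\<in>T ` M. S (a *\<^sub>C x) = a *\<^sub>C S x)"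
proof -
  let ?R = "T ` M"
  have Rc: "closed_csubspace ?R" using image_csubspace[OF M T] R by (simp add: closed_csubspace_def)
  obtain K where K: "K > 0" "\<And>x. x \<in> M \<Longrightarrow> norm (T x) \<le> K * norm x" using bo_bound[OF T] by blast
  have "\<exists>c>0. \<forall>y\<in>?R. \<exists>x\<in>M. T x = y \<and> norm x \<le> c * norm y"
    by (rule open_mapping_closed_subspaces[OF csub_subspace[OF M] csub_closed[OF M] csub_subspace[OF Rc] R, of _ K])
      (use bo_add[OF T] bo_scale[OF T] K in \<open>auto simp: scaleR_scaleC mult.commute\<close>)
  then obtain c where c: "c > 0" "\<And>y. y \<in> ?R \<Longrightarrow> \<exists>x\<in>M. T x = y \<and> norm x \<le> c * norm y" by blast
  have Q: "proj_on M (\<lambda>x. x - P x)" by (rule proj_compl[OF M P(1)])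
  obtain L where L: "L > 0" "\<And>x. x \<in> M \<Longrightarrow> norm (x - P x) \<le> L * norm x" using bo_bound[OF proj_bo[OF Q]] by blast
  have "\<exists>u\<in>M. P u = 0 \<and> T u = y \<and> norm u \<le> (L * c) * norm y" if y: "y \<in> ?R" for y
  proof -
    obtain x where x: "x \<in> M" "T x = y" "norm x \<le> c * norm y" using c(2)[OF y] by blast
    have Px: "P x \<in> M" "T (P x) = 0" using P x(1) by (auto simp: null_on_def)
    have "norm (x - P x) \<le> L * (c * norm y)"
      using L(2)[OF x(1)] mult_left_mono[OF x(3), of L] L(1) by linarith
    then show ?thesis
      using x Px bo_diff[OF M T x(1) Px(1)] bo_diff[OF M proj_bo[OF P(1)] x(1) Px(1)] proj_idem[OF P(1) x(1)]
        csub_diff[OF M x(1) Px(1)]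
      by (intro bexI[of _ "x - P x"]) auto
  qed
  then obtain S where S: "\<And>y. y \<in> ?R \<Longrightarrow> S y \<in> M \<and> P (S y) = 0 \<and> T (S y) = y \<and> norm (S y) \<le> (L * c) * norm y"
    by metis
  have uniq: "S y = u" if "y \<in> ?R" "u \<in> M" "P u = 0" "T u = y" for y u
  proof -
    have d: "S y - u \<in> M" using S that csub_diff[OF M] by blast
    have "T (S y - u) = 0" using S that by (simp add: bo_diff[OF M T])
    then have "S y - u \<in> P ` M" using P(2) d by (simp add: null_on_def)
    then have "P (S y - u) = S y - u" unfolding proj_range_eq[OF P(1)] by simp
    moreover have "P (S y - u) = 0" using S that by (simp add: bo_diff[OF M proj_bo[OF P(1)]])
    ultimately show ?thesis by simp
  qed
  have "S (x + y) = S x + S y" if "x \<in> ?R" "y \<in> ?R" for x y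
    by (rule uniq) (use S that csub_add[OF Rc] csub_add[OF M] bo_add[OF T] bo_add[OF proj_bo[OF P(1)]] in auto)
  moreover have "S (a *\<^sub>C x) = a *\<^sub>C S x" if "x \<in> ?R" for a x
    by (rule uniq) (use S that csub_scale[OF Rc] csub_scale[OF M] bo_scale[OF T] bo_scale[OF proj_bo[OF P(1)]]
        in \<open>auto simp: scaleC_simps\<close>)
  ultimately show ?thesis using S by (intro exI[of _ S] exI[of _ "L * c"]) blast
qed

lemma right_invertible_of_complemented_null:
  fixes T :: "'a::complex_banach \<Rightarrow> 'a"
  assumes M: "closed_csubspace M" and T: "T \<in> bounded_ops M" and R: "T ` M = M"
    and P: "proj_on M P" "P ` M = null_on M T"
  shows "right_invertible_on M T"
proof -
  have "closed (T ` M)" using R csub_closed[OF M] by simp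
  from bounded_section[OF M T this P] R obtain S c where
    S: "\<forall>y\<in>M. S y \<in> M \<and> T (S y) = y \<and> norm (S y) \<le> c * norm y"
      "\<forall>x\<in>M. \<forall>y\<in>M. S (x + y) = S x + S y" "\<forall>a. \<forall>x\<in>M. S (a *\<^sub>C x) = a *\<^sub>C S x"
    by auto
  then have "S \<in> bounded_ops M" by (intro bounded_opsI[where K = c]) auto
  then show ?thesis unfolding right_invertible_on_def using S(1) by blast
qed

section \<open>The Neumann family\<close>

text \<open>
  The solution is the fixed point of the contraction \<open>x \<mapsto> y + z S x\<close>. The argument works inside
  every closed \<open>S\<close>-invariant subspace, and uniqueness then shows that such subspaces are
  invariant under \<open>(I - z S)\<^sup>-\<^sup>1\<close>; this is the last clause of \<open>neumann_family\<close>.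
\<close>

lemma neumann_solution:
  fixes M :: "'a::complex_banach set"
  assumes M: "closed_csubspace M" and S: "S \<in> bounded_ops M"
    and K: "\<And>x. x \<in> M \<Longrightarrow> norm (S x) \<le> K * norm x" and z: "cmod z * K \<le> 1/2" and y: "y \<in> M"
  shows "\<exists>!x\<in>M. x - z *\<^sub>C S x = y"
proof -
  have "\<exists>!x\<in>M. y + z *\<^sub>C S x = x"
  proof (rule Banach_fix[where c = "1/2"])
    show "complete M" "M \<noteq> {}" using csub_closed[OF M] complete_eq_closed y by auto
    show "(\<lambda>x. y + z *\<^sub>C S x) ` M \<subseteq> M"
      using y csub_add[OF M] csub_scale[OF M] bo_in[OF S] by blast
    fix a b assume ab: "a \<in> M" "b \<in> M"
    have "dist (y + z *\<^sub>C S a) (y + z *\<^sub>C S b) = norm (z *\<^sub>C S (a - b))"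
      using bo_diff[OF M S ab] by (simp add: dist_norm scaleC_simps)
    also have "\<dots> \<le> cmod z * (K * norm (a - b))"
      unfolding norm_scaleC by (intro mult_left_mono K csub_diff[OF M] ab) auto
    also have "\<dots> = (cmod z * K) * dist a b" by (simp add: dist_norm)
    also have "\<dots> \<le> 1/2 * dist a b" by (rule mult_right_mono[OF z]) simp
    finally show "dist (y + z *\<^sub>C S a) (y + z *\<^sub>C S b) \<le> 1/2 * dist a b" .
  qed auto
  moreover have "(y + z *\<^sub>C S x = x) = (x - z *\<^sub>C S x = y)" for x by (auto simp: algebra_simps)
  ultimately show ?thesis by simp
qed

lemma neumann_inverse:
  fixes M :: "'a::complex_banach set"
  assumes M: "closed_csubspace M" and S: "S \<in> bounded_ops M"
    and K: "\<And>x. x \<in> M \<Longrightarrow> norm (S x) \<le> K * norm x" and z: "cmod z * K \<le> 1/2"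
  shows "\<exists>V\<in>bounded_ops M. \<forall>x\<in>M. V x - z *\<^sub>C S (V x) = x \<and> V (x - z *\<^sub>C S x) = x
      \<and> norm (V x) \<le> 2 * norm x \<and> S (V x) = V (S x)"
proof -
  have ex: "\<exists>!x\<in>M. x - z *\<^sub>C S x = y" if "y \<in> M" for y
    by (rule neumann_solution[OF M S K z that])
  then obtain V where V: "\<And>y. y \<in> M \<Longrightarrow> V y \<in> M \<and> V y - z *\<^sub>C S (V y) = y" by metis
  have uniq: "V y = x" if "y \<in> M" "x \<in> M" "x - z *\<^sub>C S x = y" for x y
    using ex[OF that(1)] V[OF that(1)] that(2,3) by blast
  have bd: "norm (V x) \<le> 2 * norm x" if "x \<in> M" for x
  proof -
    have "norm (V x) \<le> norm (V x - z *\<^sub>C S (V x)) + norm (z *\<^sub>C S (V x))"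
      using norm_triangle_ineq[of "V x - z *\<^sub>C S (V x)" "z *\<^sub>C S (V x)"] by simp
    also have "norm (z *\<^sub>C S (V x)) \<le> cmod z * (K * norm (V x))"
      unfolding norm_scaleC by (intro mult_left_mono K) (use V that in auto)
    also have "\<dots> = (cmod z * K) * norm (V x)" by simp
    also have "\<dots> \<le> 1/2 * norm (V x)" by (rule mult_right_mono[OF z]) simp
    finally show ?thesis using V[OF that] by simp
  qed
  have "V \<in> bounded_ops M"
  proof (rule bounded_opsI[where K = 2])
    show "V (x + y) = V x + V y" if "x \<in> M" "y \<in> M" for x y
    proof (rule uniq)
      have "S (V x + V y) = S (V x) + S (V y)" by (rule bo_add[OF S]) (use V that in auto)
      then have "V x + V y - z *\<^sub>C S (V x + V y) = (V x - z *\<^sub>C S (V x)) + (V y - z *\<^sub>C S (V y))"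
        by (simp add: scaleC_simps)
      then show "V x + V y - z *\<^sub>C S (V x + V y) = x + y" using V that by simp
    qed (use V that csub_add[OF M] in auto)
    show "V (c *\<^sub>C x) = c *\<^sub>C V x" if "x \<in> M" for c x
    proof (rule uniq)
      have "S (c *\<^sub>C V x) = c *\<^sub>C S (V x)" by (rule bo_scale[OF S]) (use V that in auto)
      then have "c *\<^sub>C V x - z *\<^sub>C S (c *\<^sub>C V x) = c *\<^sub>C (V x - z *\<^sub>C S (V x))"
        by (simp add: scaleC_simps mult.commute)
      then show "c *\<^sub>C V x - z *\<^sub>C S (c *\<^sub>C V x) = c *\<^sub>C x" using V that by simp
    qed (use V that csub_scale[OF M] in auto)
  qed (use V bd in auto)
  moreover have "V (x - z *\<^sub>C S x) = x" if "x \<in> M" for x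
    by (rule uniq) (use that csub_diff[OF M] csub_scale[OF M] bo_in[OF S] in auto)
  moreover have "S (V x) = V (S x)" if "x \<in> M" for x
  proof (rule uniq[symmetric])
    have Vx: "V x \<in> M" "S (V x) \<in> M" using V that bo_in[OF S] by auto
    have "S (V x) - z *\<^sub>C S (S (V x)) = S (V x - z *\<^sub>C S (V x))"
      using bo_diff[OF M S Vx(1) csub_scale[OF M Vx(2)]] bo_scale[OF S Vx(2)] by simp
    then show "S (V x) - z *\<^sub>C S (S (V x)) = S x" using V that by simp
  qed (use V that bo_in[OF S] in auto)
  ultimately show ?thesis using V bd by blast
qed

lemma neumann_family:
  fixes M :: "'a::complex_banach set"
  assumes M: "closed_csubspace M" and S: "S \<in> bounded_ops M"
  obtains r V where "r > 0" "\<And>z. z \<in> ball 0 r \<Longrightarrow> V z \<in> bounded_ops M"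
    "\<And>z x. z \<in> ball 0 r \<Longrightarrow> x \<in> M \<Longrightarrow> V z x - z *\<^sub>C S (V z x) = x"
    "\<And>z x. z \<in> ball 0 r \<Longrightarrow> x \<in> M \<Longrightarrow> V z (x - z *\<^sub>C S x) = x"
    "\<And>z x. z \<in> ball 0 r \<Longrightarrow> x \<in> M \<Longrightarrow> norm (V z x) \<le> 2 * norm x"
    "\<And>z x. z \<in> ball 0 r \<Longrightarrow> x \<in> M \<Longrightarrow> S (V z x) = V z (S x)"
    "\<And>z L x. z \<in> ball 0 r \<Longrightarrow> closed_csubspace L \<Longrightarrow> L \<subseteq> M \<Longrightarrow> (\<And>x. x \<in> L \<Longrightarrow> S x \<in> L) \<Longrightarrow> x \<in> L \<Longrightarrow> V z x \<in> L"
proof -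
  obtain K where K: "K > 0" "\<And>x. x \<in> M \<Longrightarrow> norm (S x) \<le> K * norm x" using bo_bound[OF S] by blast
  define r where "r = 1 / (2 * K)"
  have r: "r > 0" using K by (simp add: r_def)
  have zK: "cmod z * K \<le> 1/2" if "z \<in> ball 0 r" for z
    using that K(1) by (simp add: r_def field_simps)
  have "\<forall>z. \<exists>V. z \<in> ball 0 r \<longrightarrow> V \<in> bounded_ops M \<and> (\<forall>x\<in>M. V x - z *\<^sub>C S (V x) = x \<and> V (x - z *\<^sub>C S x) = x
      \<and> norm (V x) \<le> 2 * norm x \<and> S (V x) = V (S x))"
    using neumann_inverse[OF M S K(2) zK] by (metis (no_types, lifting))
  then obtain V where V: "\<And>z. z \<in> ball 0 r \<Longrightarrow> V z \<in> bounded_ops M \<and> (\<forall>x\<in>M. V z x - z *\<^sub>C S (V z x) = x \<and> V z (x - z *\<^sub>C S x) = x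
      \<and> norm (V z x) \<le> 2 * norm x \<and> S (V z x) = V z (S x))"
    by metis
  show thesis
  proof (rule that[of r V])
    fix z :: complex and L x
    assume z: "z \<in> ball 0 r" and L: "closed_csubspace L" "L \<subseteq> M" and SL: "\<And>x. x \<in> L \<Longrightarrow> S x \<in> L" and x: "x \<in> L"
    have "S \<in> bounded_ops L" by (rule bo_restrict[OF S L(2) SL])
    have "\<exists>!u\<in>L. u - z *\<^sub>C S u = x"
      by (rule neumann_solution[OF L(1) \<open>S \<in> bounded_ops L\<close> _ zK x]) (use K(2) L(2) z in auto)
    then obtain u where u: "u \<in> L" "u - z *\<^sub>C S u = x" by blast
    then have "V z x = u" using V[OF z] L(2) by blast
    then show "V z x \<in> L" using u by simp
  qed (use r V in blast)+
qed

lemma neumann_resolvent_identity: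
  assumes M: "closed_csubspace M" and S: "S \<in> bounded_ops M" and Vw: "Vw \<in> bounded_ops M" and Vz: "Vz \<in> bounded_ops M"
    and w: "\<And>x. x \<in> M \<Longrightarrow> Vw (x - w *\<^sub>C S x) = x"
    and z: "\<And>x. x \<in> M \<Longrightarrow> Vz x - z *\<^sub>C S (Vz x) = x" and x: "x \<in> M"
  shows "Vw x - Vz x = (w - z) *\<^sub>C Vw (S (Vz x))"
proof -
  define u where "u = Vz x"
  have u: "u \<in> M" "S u \<in> M" "x = u - z *\<^sub>C S u"
    using bo_in[OF Vz x] bo_in[OF S] z[OF x] by (auto simp: u_def)
  have "x = (u - w *\<^sub>C S u) + (w - z) *\<^sub>C S u" using u by (simp add: scaleC_simps)
  then have "Vw x = Vw (u - w *\<^sub>C S u) + Vw ((w - z) *\<^sub>C S u)"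
    using bo_add[OF Vw csub_diff[OF M u(1) csub_scale[OF M u(2)]] csub_scale[OF M u(2)]] by metis
  then show ?thesis using w[OF u(1)] bo_scale[OF Vw u(2)] by (simp add: u_def)
qed

section \<open>Analyticity in operator norm\<close>

lemma onorm_on_upper:
  assumes T: "T \<in> bounded_ops M" and M: "closed_csubspace M" and x: "x \<in> M"
  shows "norm (T x) \<le> onorm_on M T * norm x"
proof (cases "x = 0")
  case True
  then show ?thesis using bo_0[OF M T] by simp
next
  case False
  obtain K where K: "K > 0" "\<And>x. x \<in> M \<Longrightarrow> norm (T x) \<le> K * norm x" using bo_bound[OF T] by blast
  have "bdd_above ((\<lambda>x. norm (T x) / norm x) ` M)"
  proof (rule bdd_aboveI2)
    show "norm (T y) / norm y \<le> K" if "y \<in> M" for y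
      using K(2)[OF that] K(1) by (cases "y = 0") (auto simp: field_simps)
  qed
  then have "norm (T x) / norm x \<le> onorm_on M T"
    unfolding onorm_on_def by (rule cSUP_upper[OF x])
  then show ?thesis using False by (simp add: field_simps)
qed

lemma onorm_on_le:
  assumes M: "closed_csubspace M" and C: "C \<ge> 0" and b: "\<And>x. x \<in> M \<Longrightarrow> norm (T x) \<le> C * norm x"
  shows "onorm_on M T \<le> C"
  unfolding onorm_on_def
proof (rule cSUP_least)
  show "norm (T x) / norm x \<le> C" if "x \<in> M" for x
    using b[OF that] C by (cases "x = 0") (auto simp: field_simps)
qed (use csub_0[OF M] in auto)

lemma onorm_on_nonneg:
  assumes M: "closed_csubspace M" and T: "T \<in> bounded_ops M"
  shows "0 \<le> onorm_on M T"
proof (cases "M = {0}")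
  case True
  then show ?thesis by (simp add: onorm_on_def)
next
  case False
  then obtain x where x: "x \<in> M" "x \<noteq> 0" using csub_0[OF M] by blast
  have "0 \<le> onorm_on M T * norm x" using onorm_on_upper[OF T M x(1)] norm_ge_zero order_trans by blast
  then show ?thesis using x by (simp add: zero_le_mult_iff)
qed

text \<open>
  Complex differentiability of an operator-valued function with a quadratic remainder, stated
  pointwise with a bound that is uniform in \<open>x\<close>. All functions occurring below satisfy it, and
  unlike a limit of operator norms it is stable under products by direct estimates.
\<close>

definition lip_diff_at :: "'a::complex_normed_vector set \<Rightarrow> (complex \<Rightarrow> 'a \<Rightarrow> 'a) \<Rightarrow> complex \<Rightarrow> bool" where
  "lip_diff_at M G z \<longleftrightarrow> (\<exists>D\<in>bounded_ops M. \<exists>C\<ge>0. \<exists>\<delta>>0. \<forall>w\<in>ball z \<delta>. \<forall>x\<in>M.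
     norm (G w x - G z x - (w - z) *\<^sub>C D x) \<le> C * (cmod (w - z))\<^sup>2 * norm x)"

lemma lip_diff_atI:
  assumes "D \<in> bounded_ops M" "C \<ge> 0" "\<delta> > 0"
    and "\<And>w x. w \<in> ball z \<delta> \<Longrightarrow> x \<in> M \<Longrightarrow>
      norm (G w x - G z x - (w - z) *\<^sub>C D x) \<le> C * (cmod (w - z))\<^sup>2 * norm x"
  shows "lip_diff_at M G z"
  using assms unfolding lip_diff_at_def by blast

lemma scaleC_inverse_diff:
  "c \<noteq> 0 \<Longrightarrow> inverse c *\<^sub>C (x - y - c *\<^sub>C d) = inverse c *\<^sub>C (x - y) - d"
  by (simp add: complex_vector.scale_right_diff_distrib scaleC_scaleC scaleC_one)

lemma op_analytic_onI:
  assumes M: "closed_csubspace M" and G: "\<And>z. z \<in> U \<Longrightarrow> G z \<in> bounded_ops M" and U: "open U"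
    and d: "\<And>z. z \<in> U \<Longrightarrow> lip_diff_at M G z"
  shows "op_analytic_on M G U"
  unfolding op_analytic_on_def
proof (intro conjI ballI)
  fix z assume z: "z \<in> U"
  then obtain D C \<delta> where D: "D \<in> bounded_ops M" and C: "C \<ge> 0" and \<delta>: "\<delta> > 0"
    and est: "\<And>w x. w \<in> ball z \<delta> \<Longrightarrow> x \<in> M \<Longrightarrow> norm (G w x - G z x - (w - z) *\<^sub>C D x) \<le> C * (cmod (w - z))\<^sup>2 * norm x"
    using d unfolding lip_diff_at_def by metis
  let ?f = "\<lambda>w x. inverse (w - z) *\<^sub>C (G w x - G z x) - D x"
  have "((\<lambda>w. onorm_on M (?f w)) \<longlongrightarrow> 0) (at z)"
  proof (rule Lim_null_comparison)
    have "\<forall>\<^sub>F w in at z. w \<in> U" using U z by (simp add: eventually_at_topological) blast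
    moreover have "\<forall>\<^sub>F w in at z. w \<in> ball z \<delta>" using \<delta> eventually_at_ball[of \<delta> z UNIV]
      by (auto elim: eventually_mono)
    moreover have "\<forall>\<^sub>F w in at z. w \<noteq> z" by (simp add: eventually_at_filter)
    ultimately show "\<forall>\<^sub>F w in at z. norm (onorm_on M (?f w)) \<le> C * cmod (w - z)"
    proof eventually_elim
      case (elim w)
      have bo: "?f w \<in> bounded_ops M"
        by (intro bo_minus bo_scaleC M D) (use G elim z in auto)
      have "norm (?f w x) \<le> C * cmod (w - z) * norm x" if "x \<in> M" for x
      proof -
        have "?f w x = inverse (w - z) *\<^sub>C (G w x - G z x - (w - z) *\<^sub>C D x)"
          using elim by (intro scaleC_inverse_diff[symmetric]) simp
        then have "norm (?f w x) = norm (G w x - G z x - (w - z) *\<^sub>C D x) / cmod (w - z)"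
          by (simp add: norm_scaleC norm_inverse divide_inverse mult.commute)
        also have "\<dots> \<le> (C * (cmod (w - z))\<^sup>2 * norm x) / cmod (w - z)"
          using est[OF _ that, of w] elim by (intro divide_right_mono) auto
        also have "\<dots> = C * cmod (w - z) * norm x" using elim by (simp add: power2_eq_square)
        finally show ?thesis .
      qed
      then have "onorm_on M (?f w) \<le> C * cmod (w - z)"
        by (intro onorm_on_le M) (use C in auto)
      then show ?case using onorm_on_nonneg[OF M bo] by simp
    qed
    have "((\<lambda>w. C * cmod (w - z)) \<longlongrightarrow> C * cmod (z - z)) (at z)" by (intro tendsto_intros)
    then show "((\<lambda>w. C * cmod (w - z)) \<longlongrightarrow> 0) (at z)" by simp
  qed
  then show "\<exists>D\<in>bounded_ops M. ((\<lambda>w. onorm_on M (\<lambda>x. inverse (w - z) *\<^sub>C (G w x - G z x) - D x)) \<longlongrightarrow> 0) (at z)"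
    using D by blast
qed (use G in auto)

lemma op_analytic_on_has_derivative:
  assumes M: "closed_csubspace M" and G: "op_analytic_on M G U" and U: "open U" and z: "z \<in> U" and x: "x \<in> M"
  shows "\<exists>d. ((\<lambda>w. G w x) has_derivative (\<lambda>h. h *\<^sub>C d)) (at z)"
proof -
  obtain D where D: "D \<in> bounded_ops M" and
    lim: "((\<lambda>w. onorm_on M (\<lambda>x. inverse (w - z) *\<^sub>C (G w x - G z x) - D x)) \<longlongrightarrow> 0) (at z)"
    using G z unfolding op_analytic_on_def by blast
  have Gb: "\<And>w. w \<in> U \<Longrightarrow> G w \<in> bounded_ops M" using G by (auto simp: op_analytic_on_def)
  let ?f = "\<lambda>w x. inverse (w - z) *\<^sub>C (G w x - G z x) - D x"
  have "((\<lambda>w. G w x) has_derivative (\<lambda>h. h *\<^sub>C D x)) (at z)"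
    unfolding has_derivative_iff_norm
  proof (intro conjI)
    show "bounded_linear (\<lambda>h. h *\<^sub>C D x)"
      by (rule bounded_bilinear.bounded_linear_left[OF bounded_bilinear_scaleC])
    show "((\<lambda>w. norm (G w x - G z x - (w - z) *\<^sub>C D x) / norm (w - z)) \<longlongrightarrow> 0) (at z)"
    proof (rule Lim_null_comparison)
      have "\<forall>\<^sub>F w in at z. w \<in> U" using U z by (simp add: eventually_at_topological) blast
      moreover have "\<forall>\<^sub>F w in at z. w \<noteq> z" by (simp add: eventually_at_filter)
      ultimately show "\<forall>\<^sub>F w in at z. norm (norm (G w x - G z x - (w - z) *\<^sub>C D x) / norm (w - z))
          \<le> onorm_on M (?f w) * norm x"
      proof eventually_elim
        case (elim w)
        have bo: "?f w \<in> bounded_ops M"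
          by (intro bo_minus bo_scaleC M D) (use Gb elim z in auto)
        have "?f w x = inverse (w - z) *\<^sub>C (G w x - G z x - (w - z) *\<^sub>C D x)"
          using elim by (intro scaleC_inverse_diff[symmetric]) simp
        then have "norm (?f w x) = norm (G w x - G z x - (w - z) *\<^sub>C D x) / cmod (w - z)"
          by (simp add: norm_scaleC norm_inverse divide_inverse mult.commute)
        then show ?case using onorm_on_upper[OF bo M x] by simp
      qed
      show "((\<lambda>w. onorm_on M (?f w) * norm x) \<longlongrightarrow> 0) (at z)"
        by (rule tendsto_mult_left_zero[OF lim])
    qed
  qed
  then show ?thesis by blast
qed

lemma op_analytic_on_locally_bounded:
  assumes M: "closed_csubspace M" and G: "op_analytic_on M G U" and U: "open U" and z: "z \<in> U"
  shows "\<exists>\<delta>>0. \<exists>C. \<forall>w\<in>ball z \<delta>. \<forall>x\<in>M. norm (G w x) \<le> C * norm x"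
proof -
  obtain D where D: "D \<in> bounded_ops M" and
    lim: "((\<lambda>w. onorm_on M (\<lambda>x. inverse (w - z) *\<^sub>C (G w x - G z x) - D x)) \<longlongrightarrow> 0) (at z)"
    using G z unfolding op_analytic_on_def by blast
  have Gb: "\<And>w. w \<in> U \<Longrightarrow> G w \<in> bounded_ops M" using G by (auto simp: op_analytic_on_def)
  let ?f = "\<lambda>w x. inverse (w - z) *\<^sub>C (G w x - G z x) - D x"
  obtain K where K: "K > 0" "\<And>x. x \<in> M \<Longrightarrow> norm (G z x) \<le> K * norm x" using bo_bound[OF Gb[OF z]] by blast
  obtain L where L: "L > 0" "\<And>x. x \<in> M \<Longrightarrow> norm (D x) \<le> L * norm x" using bo_bound[OF D] by blast
  have "\<forall>\<^sub>F w in at z. w \<in> U" using U z by (simp add: eventually_at_topological) blast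
  moreover have "\<forall>\<^sub>F w in at z. onorm_on M (?f w) < 1" by (rule order_tendstoD[OF lim]) simp
  ultimately have "\<forall>\<^sub>F w in at z. w \<in> U \<and> onorm_on M (?f w) < 1" by eventually_elim simp
  then obtain d where d: "d > 0" "\<And>w. w \<noteq> z \<Longrightarrow> dist w z < d \<Longrightarrow> w \<in> U \<and> onorm_on M (?f w) < 1"
    by (auto simp: eventually_at)
  have "norm (G w x) \<le> (K + d * (1 + L)) * norm x" if w: "w \<in> ball z d" and x: "x \<in> M" for w x
  proof (cases "w = z")
    case True
    have "K * norm x \<le> (K + d * (1 + L)) * norm x" using d(1) L(1) by (intro mult_right_mono) auto
    then show ?thesis using True K(2)[OF x] by simp
  next
    case False
    then have wU: "w \<in> U" and small: "onorm_on M (?f w) < 1" using d(2)[of w] w by (auto simp: dist_commute)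
    have bo: "?f w \<in> bounded_ops M"
      by (intro bo_minus bo_scaleC M D) (use Gb wU z in auto)
    have "norm (?f w x) \<le> onorm_on M (?f w) * norm x" by (rule onorm_on_upper[OF bo M x])
    also have "\<dots> \<le> 1 * norm x" by (rule mult_right_mono) (use small in auto)
    finally have fx: "norm (?f w x) \<le> norm x" by simp
    have eq: "G w x = G z x + (w - z) *\<^sub>C (?f w x + D x)"
      using False by (simp add: scaleC_scaleC scaleC_one)
    have "norm (?f w x + D x) \<le> (1 + L) * norm x"
      using norm_triangle_ineq[of "?f w x" "D x"] fx L(2)[OF x] by (simp add: algebra_simps)
    then have "cmod (w - z) * norm (?f w x + D x) \<le> d * ((1 + L) * norm x)"
      using w d(1) by (intro mult_mono) (auto simp: dist_norm norm_minus_commute)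
    then have "norm ((w - z) *\<^sub>C (?f w x + D x)) \<le> d * ((1 + L) * norm x)"
      unfolding norm_scaleC .
    then have "norm (G z x + (w - z) *\<^sub>C (?f w x + D x)) \<le> K * norm x + d * ((1 + L) * norm x)"
      using K(2)[OF x] norm_triangle_ineq[of "G z x" "(w - z) *\<^sub>C (?f w x + D x)"] by linarith
    then show ?thesis unfolding eq[symmetric] by (simp add: algebra_simps)
  qed
  then show ?thesis using d(1) by blast
qed

lemma op_analytic_on_bounded_compact:
  assumes M: "closed_csubspace M" and G: "op_analytic_on M G U" and U: "open U" and k: "compact k" "k \<subseteq> U"
  shows "\<exists>C\<ge>0. \<forall>w\<in>k. \<forall>x\<in>M. norm (G w x) \<le> C * norm x"
proof -
  have "\<forall>z\<in>k. \<exists>\<delta>>0. \<exists>C. \<forall>w\<in>ball z \<delta>. \<forall>x\<in>M. norm (G w x) \<le> C * norm x"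
    using op_analytic_on_locally_bounded[OF M G U] k by blast
  then obtain d C where dC: "\<And>z. z \<in> k \<Longrightarrow> d z > 0"
    "\<And>z w x. z \<in> k \<Longrightarrow> w \<in> ball z (d z) \<Longrightarrow> x \<in> M \<Longrightarrow> norm (G w x) \<le> C z * norm x"
    by metis
  obtain F where F: "F \<subseteq> k" "finite F" "k \<subseteq> (\<Union>z\<in>F. ball z (d z))"
    by (rule compactE_image[OF k(1), of k "\<lambda>z. ball z (d z)"]) (use dC(1) in \<open>auto intro: centre_in_ball[THEN iffD2]\<close>)
  have "norm (G w x) \<le> (\<Sum>z\<in>F. \<bar>C z\<bar>) * norm x" if w: "w \<in> k" and x: "x \<in> M" for w x
  proof -
    obtain z where z: "z \<in> F" "w \<in> ball z (d z)" using F(3) w by blast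
    have "C z \<le> (\<Sum>z\<in>F. \<bar>C z\<bar>)"
      using member_le_sum[OF z(1), of "\<lambda>z. \<bar>C z\<bar>"] F(2) by auto
    then show ?thesis
      using dC(2)[of z w x] z F(1) x by (meson in_mono mult_right_mono norm_ge_zero order_trans)
  qed
  then show ?thesis by (intro exI[of _ "\<Sum>z\<in>F. \<bar>C z\<bar>"]) (auto intro: sum_nonneg)
qed

lemma lip_diff_at_minus_const:
  assumes "lip_diff_at M G z"
  shows "lip_diff_at M (\<lambda>w x. G w x - T x) z"
  using assms unfolding lip_diff_at_def by simp

lemma lip_diff_at_comp_left:
  assumes M: "closed_csubspace M" and T: "T \<in> bounded_ops M" and G: "\<And>w. w \<in> U \<Longrightarrow> G w \<in> bounded_ops M"
    and U: "open U" "z \<in> U" and d: "lip_diff_at M G z"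
  shows "lip_diff_at M (\<lambda>w x. T (G w x)) z"
proof -
  obtain D C \<delta> where D: "D \<in> bounded_ops M" and C: "C \<ge> 0" and \<delta>: "\<delta> > 0"
    and est: "\<And>w x. w \<in> ball z \<delta> \<Longrightarrow> x \<in> M \<Longrightarrow> norm (G w x - G z x - (w - z) *\<^sub>C D x) \<le> C * (cmod (w - z))\<^sup>2 * norm x"
    using d unfolding lip_diff_at_def by metis
  obtain K where K: "K > 0" "\<And>x. x \<in> M \<Longrightarrow> norm (T x) \<le> K * norm x" using bo_bound[OF T] by blast
  obtain e where e: "e > 0" "ball z e \<subseteq> U" using U openE by blast
  show ?thesis
  proof (rule lip_diff_atI[where D = "\<lambda>x. T (D x)" and C = "K * C" and \<delta> = "min \<delta> e"])
    fix w x assume w: "w \<in> ball z (min \<delta> e)" and x: "x \<in> M"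
    have in': "G w x \<in> M" "G z x \<in> M" "D x \<in> M"
      using bo_in[OF G x, of w] bo_in[OF G x, of z] bo_in[OF D x] w e U by auto
    have "T (G w x) - T (G z x) - (w - z) *\<^sub>C T (D x) = T (G w x - G z x - (w - z) *\<^sub>C D x)"
      using in' csub_diff[OF M] csub_scale[OF M] by (simp add: bo_diff[OF M T] bo_scale[OF T])
    then have "norm (T (G w x) - T (G z x) - (w - z) *\<^sub>C T (D x)) \<le> K * norm (G w x - G z x - (w - z) *\<^sub>C D x)"
      using K(2) in' csub_diff[OF M] csub_scale[OF M] by simp
    also have "\<dots> \<le> K * (C * (cmod (w - z))\<^sup>2 * norm x)"
      using est[OF _ x, of w] w K(1) by (intro mult_left_mono) auto
    finally show "norm (T (G w x) - T (G z x) - (w - z) *\<^sub>C T (D x)) \<le> K * C * (cmod (w - z))\<^sup>2 * norm x"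
      by (simp add: mult.assoc)
  qed (use K C \<delta> e bo_comp[OF T D] in auto)
qed

lemma lip_diff_at_times:
  assumes M: "closed_csubspace M" and Gz: "G z \<in> bounded_ops M" and d: "lip_diff_at M G z"
  shows "lip_diff_at M (\<lambda>w x. (w - a) *\<^sub>C G w x) z"
proof -
  obtain D C \<delta> where D: "D \<in> bounded_ops M" and C: "C \<ge> 0" and \<delta>: "\<delta> > 0"
    and est: "\<And>w x. w \<in> ball z \<delta> \<Longrightarrow> x \<in> M \<Longrightarrow> norm (G w x - G z x - (w - z) *\<^sub>C D x) \<le> C * (cmod (w - z))\<^sup>2 * norm x"
    using d unfolding lip_diff_at_def by metis
  obtain K where K: "K > 0" "\<And>x. x \<in> M \<Longrightarrow> norm (D x) \<le> K * norm x" using bo_bound[OF D] by blast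
  let ?B = "cmod (z - a) + \<delta>"
  show ?thesis
  proof (rule lip_diff_atI[where D = "\<lambda>x. G z x + (z - a) *\<^sub>C D x" and C = "?B * C + K" and \<delta> = "\<delta>"])
    fix w x assume w: "w \<in> ball z \<delta>" and x: "x \<in> M"
    let ?E = "G w x - G z x - (w - z) *\<^sub>C D x"
    have eq: "(w - a) *\<^sub>C G w x - (z - a) *\<^sub>C G z x - (w - z) *\<^sub>C (G z x + (z - a) *\<^sub>C D x)
        = (w - a) *\<^sub>C ?E + (w - z)\<^sup>2 *\<^sub>C D x"
    proof -
      have "(s + t) *\<^sub>C g - t *\<^sub>C h - s *\<^sub>C (h + t *\<^sub>C y) = (s + t) *\<^sub>C (g - h - s *\<^sub>C y) + (s * s) *\<^sub>C y"
        for s t :: complex and g h y :: 'a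
        by (simp add: scaleC_simps algebra_simps)
      from this[of "w - z" "z - a" "G w x" "G z x" "D x"] show ?thesis by (simp add: power2_eq_square)
    qed
    have wa: "cmod (w - a) \<le> ?B"
      using w norm_triangle_ineq[of "w - z" "z - a"] by (simp add: dist_norm norm_minus_commute)
    have "norm ((w - a) *\<^sub>C ?E) \<le> ?B * (C * (cmod (w - z))\<^sup>2 * norm x)"
      unfolding norm_scaleC by (rule mult_mono[OF wa est[OF w x]]) (use \<delta> in auto)
    moreover have "norm ((w - z)\<^sup>2 *\<^sub>C D x) \<le> (cmod (w - z))\<^sup>2 * (K * norm x)"
      unfolding norm_scaleC norm_power by (rule mult_left_mono[OF K(2)[OF x]]) simp
    ultimately show "norm ((w - a) *\<^sub>C G w x - (z - a) *\<^sub>C G z x - (w - z) *\<^sub>C (G z x + (z - a) *\<^sub>C D x))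
        \<le> (?B * C + K) * (cmod (w - z))\<^sup>2 * norm x"
      unfolding eq
      using norm_triangle_ineq[of "(w - a) *\<^sub>C ?E" "(w - z)\<^sup>2 *\<^sub>C D x"] by (simp add: algebra_simps)
  next
    show "0 \<le> ?B * C + K" using C K \<delta> by (intro add_nonneg_nonneg mult_nonneg_nonneg) auto
  qed (use \<delta> bo_plus[OF M Gz bo_scaleC[OF M D]] in auto)
qed

text \<open>
  Applying the resolvent identity twice gives the remainder \<open>(w - z)\<^sup>2 V\<^sub>w S V\<^sub>z S V\<^sub>z\<close>.
\<close>

lemma lip_diff_at_neumann:
  assumes M: "closed_csubspace M" and S: "S \<in> bounded_ops M" and U: "open U" "z \<in> U"
    and V: "\<And>w. w \<in> U \<Longrightarrow> V w \<in> bounded_ops M"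
    and bd: "\<And>w x. w \<in> U \<Longrightarrow> x \<in> M \<Longrightarrow> norm (V w x) \<le> 2 * norm x"
    and l: "\<And>w x. w \<in> U \<Longrightarrow> x \<in> M \<Longrightarrow> V w (x - w *\<^sub>C S x) = x"
    and r: "\<And>w x. w \<in> U \<Longrightarrow> x \<in> M \<Longrightarrow> V w x - w *\<^sub>C S (V w x) = x"
  shows "lip_diff_at M V z"
proof -
  obtain K where K: "K > 0" "\<And>x. x \<in> M \<Longrightarrow> norm (S x) \<le> K * norm x" using bo_bound[OF S] by blast
  obtain e where e: "e > 0" "ball z e \<subseteq> U" using U openE by blast
  show ?thesis
  proof (rule lip_diff_atI[where D = "\<lambda>x. V z (S (V z x))" and C = "8 * K * K" and \<delta> = "e"])
    fix w x assume w: "w \<in> ball z e" and x: "x \<in> M"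
    have wU: "w \<in> U" using w e by blast
    let ?y = "S (V z x)"
    have y: "?y \<in> M" using bo_in[OF S bo_in[OF V[OF U(2)] x]] .
    let ?u = "S (V z ?y)"
    have u: "?u \<in> M" using bo_in[OF S bo_in[OF V[OF U(2)] y]] .
    have id: "V w x - V z x = (w - z) *\<^sub>C V w (S (V z x))" if "x \<in> M" for x
      by (rule neumann_resolvent_identity[OF M S V[OF wU] V[OF U(2)] l[OF wU] r[OF U(2)] that])
    have "V w x - V z x - (w - z) *\<^sub>C V z ?y = (w - z) *\<^sub>C (V w ?y - V z ?y)"
      using id[OF x] by (simp add: scaleC_simps)
    also have "\<dots> = (w - z)\<^sup>2 *\<^sub>C V w ?u" unfolding id[OF y] by (simp add: scaleC_scaleC power2_eq_square)
    finally have eq: "norm (V w x - V z x - (w - z) *\<^sub>C V z ?y) = (cmod (w - z))\<^sup>2 * norm (V w ?u)"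
      by (simp add: norm_scaleC norm_power)
    have step: "norm (S (V z v)) \<le> 2 * K * norm v" if "v \<in> M" for v
    proof -
      have "norm (S (V z v)) \<le> K * norm (V z v)" by (rule K(2)[OF bo_in[OF V[OF U(2)] that]])
      also have "\<dots> \<le> K * (2 * norm v)" by (rule mult_left_mono[OF bd[OF U(2) that]]) (use K in simp)
      finally show ?thesis by simp
    qed
    have "norm (V w ?u) \<le> 2 * norm ?u" by (rule bd[OF wU u])
    also have "\<dots> \<le> 2 * (2 * K * norm ?y)" by (rule mult_left_mono[OF step[OF y]]) simp
    also have "\<dots> \<le> 2 * (2 * K * (2 * K * norm x))"
      by (rule mult_left_mono, rule mult_left_mono[OF step[OF x]]) (use K in auto)
    finally have "norm (V w ?u) \<le> 8 * K * K * norm x" by simp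
    then show "norm (V w x - V z x - (w - z) *\<^sub>C V z ?y) \<le> 8 * K * K * (cmod (w - z))\<^sup>2 * norm x"
      unfolding eq using mult_left_mono[of "norm (V w ?u)" "8 * K * K * norm x" "(cmod (w - z))\<^sup>2"]
      by (simp add: mult_ac)
  qed (use e K bo_comp[OF V[OF U(2)] bo_comp[OF S V[OF U(2)]]] in auto)
qed

section \<open>Drazin invertibility\<close>

text \<open>
  Equivalently, \<open>B\<close> is the direct sum of an invertible and a nilpotent operator, and \<open>p = 0\<close>
  means that \<open>B\<close> is invertible. The Drazin inverse itself satisfies in addition \<open>S B S = S\<close>, and
  every \<open>S\<close> of this kind can be corrected to do so; in the form chosen here restrictions and
  direct sums are immediate.
\<close>

definition Drazin_on :: "'a::complex_normed_vector set \<Rightarrow> ('a \<Rightarrow> 'a) \<Rightarrow> bool" where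
  "Drazin_on M B \<longleftrightarrow> (\<exists>S\<in>bounded_ops M. \<exists>p. \<forall>x\<in>M. B (S x) = S (B x) \<and> (B ^^ Suc p) (S x) = (B ^^ p) x)"

lemma Drazin_on_invertible:
  assumes "invertible_on M B"
  shows "Drazin_on M B"
proof -
  obtain S where "S \<in> bounded_ops M" "\<And>x. x \<in> M \<Longrightarrow> B (S x) = x \<and> S (B x) = x"
    using assms unfolding invertible_on_def by blast
  then show ?thesis unfolding Drazin_on_def by (intro bexI[of _ S] exI[of _ 0]) auto
qed

lemma Drazin_on_cong:
  assumes M: "closed_csubspace M" and B: "B \<in> bounded_ops M" and eq: "\<And>x. x \<in> M \<Longrightarrow> B' x = B x"
  shows "Drazin_on M B' \<longleftrightarrow> Drazin_on M B"
proof -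
  have "(B' (S x) = S (B' x) \<and> (B' ^^ Suc p) (S x) = (B' ^^ p) x) \<longleftrightarrow>
      (B (S x) = S (B x) \<and> (B ^^ Suc p) (S x) = (B ^^ p) x)" if "S \<in> bounded_ops M" "x \<in> M" for S p x
  proof -
    have "(B' ^^ n) y = (B ^^ n) y" if "y \<in> M" for n y
      by (rule funpow_cong_on[OF bo_in[OF B] eq that])
    then show ?thesis using that bo_in[OF that] eq by (simp del: funpow.simps)
  qed
  then show ?thesis unfolding Drazin_on_def by blast
qed

lemma bo_proj_comp:
  assumes M: "closed_csubspace M" and P: "proj_on M P" and S: "S \<in> bounded_ops (P ` M)"
  shows "(\<lambda>x. S (P x)) \<in> bounded_ops M"
proof -
  obtain K where K: "K > 0" "\<And>x. x \<in> P ` M \<Longrightarrow> norm (S x) \<le> K * norm x" using bo_bound[OF S] by blast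
  obtain L where L: "L > 0" "\<And>x. x \<in> M \<Longrightarrow> norm (P x) \<le> L * norm x" using bo_bound[OF proj_bo[OF P]] by blast
  note Pb = proj_bo[OF P]
  show ?thesis
  proof (rule bounded_opsI[where K = "K * L"])
    show "norm (S (P x)) \<le> K * L * norm x" if "x \<in> M" for x
    proof -
      have "K * norm (P x) \<le> K * (L * norm x)" by (rule mult_left_mono[OF L(2)[OF that]]) (use K in simp)
      then show ?thesis using K(2)[of "P x"] that by (simp add: mult.assoc)
    qed
    show "S (P x) \<in> M" if "x \<in> M" for x
    proof -
      have "S (P x) \<in> P ` M" by (rule bo_in[OF S imageI[OF that]])
      also have "\<dots> \<subseteq> M" using bo_in[OF Pb] by blast
      finally show ?thesis .
    qed
  qed (simp_all add: bo_add[OF Pb] bo_scale[OF Pb] bo_add[OF S] bo_scale[OF S])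
qed

lemma proj_range_invariant:
  assumes P: "proj_on M P" and B: "B \<in> bounded_ops M" and c: "\<And>x. x \<in> M \<Longrightarrow> P (B x) = B (P x)"
  shows "B \<in> bounded_ops (P ` M)"
proof (rule bo_restrict[OF B])
  show "P ` M \<subseteq> M" using bo_in[OF proj_bo[OF P]] by auto
  show "B x \<in> P ` M" if "x \<in> P ` M" for x
    using that c bo_in[OF B] unfolding proj_range_eq[OF P] by auto
qed

lemma Drazin_on_restrict:
  assumes M: "closed_csubspace M" and P: "proj_on M P" and B: "B \<in> bounded_ops M"
    and c: "\<And>x. x \<in> M \<Longrightarrow> P (B x) = B (P x)" and D: "Drazin_on M B"
  shows "Drazin_on (P ` M) B"
proof -
  obtain S p where S: "S \<in> bounded_ops M" and SB: "\<And>x. x \<in> M \<Longrightarrow> B (S x) = S (B x)"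
    and p: "\<And>x. x \<in> M \<Longrightarrow> (B ^^ Suc p) (S x) = (B ^^ p) x"
    using D unfolding Drazin_on_def by blast
  note Pb = proj_bo[OF P]
  have sub: "x \<in> M" "P x = x" if "x \<in> P ` M" for x using that unfolding proj_range_eq[OF P] by auto
  have cn: "P ((B ^^ n) x) = (B ^^ n) (P x)" if "x \<in> M" for x n
    by (rule funpow_commute_on[where M = M and T = B and S = P, OF bo_in[OF B] c that])
  show ?thesis
    unfolding Drazin_on_def
  proof (intro bexI[of _ "\<lambda>x. P (S x)"] exI[of _ p] ballI conjI)
    show "(\<lambda>x. P (S x)) \<in> bounded_ops (P ` M)"
    proof (rule bo_restrict[OF bo_comp[OF Pb S]])
      show "P ` M \<subseteq> M" using sub(1) by blast
      show "P (S x) \<in> P ` M" if "x \<in> P ` M" for x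
        by (rule imageI[OF bo_in[OF S sub(1)[OF that]]])
    qed
  next
    fix x assume "x \<in> P ` M"
    note x = sub[OF this]
    show "B (P (S x)) = P (S (B x))"
      using c[OF bo_in[OF S x(1)]] SB[OF x(1)] by simp
    show "(B ^^ Suc p) (P (S x)) = (B ^^ p) x"
      using cn[OF bo_in[OF S x(1)], of "Suc p"] p[OF x(1)] cn[OF x(1), of p] x(2) by (simp del: funpow.simps)
  qed
qed

lemma Drazin_on_direct_sum:
  assumes M: "closed_csubspace M" and P: "proj_on M P" and B: "B \<in> bounded_ops M"
    and c: "\<And>x. x \<in> M \<Longrightarrow> P (B x) = B (P x)"
    and D1: "Drazin_on (P ` M) B" and D2: "Drazin_on ((\<lambda>x. x - P x) ` M) B"
  shows "Drazin_on M B"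
proof -
  let ?Q = "\<lambda>x. x - P x"
  have Q: "proj_on M ?Q" by (rule proj_compl[OF M P])
  note Pb = proj_bo[OF P] and Qb = proj_bo[OF Q]
  obtain S1 p1 where S1: "S1 \<in> bounded_ops (P ` M)" and SB1: "\<And>x. x \<in> P ` M \<Longrightarrow> B (S1 x) = S1 (B x)"
    and p1: "\<And>x. x \<in> P ` M \<Longrightarrow> (B ^^ Suc p1) (S1 x) = (B ^^ p1) x"
    using D1 unfolding Drazin_on_def by blast
  obtain S2 p2 where S2: "S2 \<in> bounded_ops (?Q ` M)" and SB2: "\<And>x. x \<in> ?Q ` M \<Longrightarrow> B (S2 x) = S2 (B x)"
    and p2: "\<And>x. x \<in> ?Q ` M \<Longrightarrow> (B ^^ Suc p2) (S2 x) = (B ^^ p2) x"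
    using D2 unfolding Drazin_on_def by blast
  have cQ: "?Q (B x) = B (?Q x)" if "x \<in> M" for x
    using c[OF that] bo_diff[OF M B that bo_in[OF Pb that]] by simp
  let ?S1 = "\<lambda>x. S1 (P x)" and ?S2 = "\<lambda>x. S2 (?Q x)"
  have bo1: "?S1 \<in> bounded_ops M" by (rule bo_proj_comp[OF M P S1])
  have bo2: "?S2 \<in> bounded_ops M" by (rule bo_proj_comp[OF M Q S2])
  have up: "(B ^^ Suc (m + p)) u = (B ^^ (m + p)) y" if "(B ^^ Suc p) u = (B ^^ p) y" for m p u y
    using that by (metis add_Suc_right comp_apply funpow_add)
  let ?p = "p1 + p2"
  show ?thesis
    unfolding Drazin_on_def
  proof (intro bexI[of _ "\<lambda>x. ?S1 x + ?S2 x"] exI[of _ ?p] ballI conjI)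
    show "(\<lambda>x. ?S1 x + ?S2 x) \<in> bounded_ops M" by (rule bo_plus[OF M bo1 bo2])
    fix x assume x: "x \<in> M"
    have Px: "P x \<in> P ` M" and Qx: "?Q x \<in> ?Q ` M" using x by auto
    note s = bo_in[OF bo1 x] bo_in[OF bo2 x]
    show "B (?S1 x + ?S2 x) = ?S1 (B x) + ?S2 (B x)"
      using bo_add[OF B s] SB1[OF Px] SB2[OF Qx] c[OF x] cQ[OF x] by metis
    have "(B ^^ Suc ?p) (?S1 x) = (B ^^ ?p) (P x)"
      using up[OF p1[OF Px], of p2] by (simp only: add.commute)
    moreover have "(B ^^ Suc ?p) (?S2 x) = (B ^^ ?p) (?Q x)"
      using up[OF p2[OF Qx], of p1] by simp
    moreover have "(B ^^ Suc ?p) (?S1 x + ?S2 x) = (B ^^ Suc ?p) (?S1 x) + (B ^^ Suc ?p) (?S2 x)"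
      by (rule bo_add[OF bo_funpow[OF B] s])
    moreover have "(B ^^ ?p) (P x) + (B ^^ ?p) (?Q x) = (B ^^ ?p) x"
      using bo_add[OF bo_funpow[OF B] bo_in[OF Pb x] bo_in[OF Qb x], of ?p] by simp
    ultimately show "(B ^^ Suc ?p) (?S1 x + ?S2 x) = (B ^^ ?p) x" by (simp only:)
  qed
qed

text \<open>
  The inverse is the finite geometric sum of \<open>- T\<^sup>k / z\<^sup>k\<^sup>+\<^sup>1\<close>; the products telescope.
\<close>

lemma nilpotent_shift_invertible:
  assumes M: "closed_csubspace M" and T: "T \<in> bounded_ops M" and nil: "\<And>x. x \<in> M \<Longrightarrow> (T ^^ d) x = 0"
    and z: "z \<noteq> 0"
  shows "invertible_on M (shift T z)"
proof -
  define S where "S x = (\<Sum>k<d. (- (inverse z ^ Suc k)) *\<^sub>C (T ^^ k) x)" for x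
  have S: "S \<in> bounded_ops M"
    unfolding S_def[abs_def] by (intro bo_sum M bo_scaleC bo_funpow T)
  have tele: "(\<Sum>k<d. (- (inverse z ^ Suc k)) *\<^sub>C ((T ^^ Suc k) x - z *\<^sub>C (T ^^ k) x)) = x" if "x \<in> M" for x
  proof -
    have "(- (inverse z ^ Suc k)) *\<^sub>C ((T ^^ Suc k) x - z *\<^sub>C (T ^^ k) x)
        = (inverse z ^ k) *\<^sub>C (T ^^ k) x - (inverse z ^ Suc k) *\<^sub>C (T ^^ Suc k) x" for k
      using z by (simp add: scaleC_simps)
    then have "(\<Sum>k<d. (- (inverse z ^ Suc k)) *\<^sub>C ((T ^^ Suc k) x - z *\<^sub>C (T ^^ k) x))
        = (\<Sum>k<d. (inverse z ^ k) *\<^sub>C (T ^^ k) x - (inverse z ^ Suc k) *\<^sub>C (T ^^ Suc k) x)"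
      by (simp only:)
    also have "\<dots> = (inverse z ^ 0) *\<^sub>C (T ^^ 0) x - (inverse z ^ d) *\<^sub>C (T ^^ d) x"
      by (rule sum_lessThan_telescope')
    finally show ?thesis using nil[OF that] by (simp add: scaleC_simps)
  qed
  have comm: "shift T z (S x) = (\<Sum>k<d. (- (inverse z ^ Suc k)) *\<^sub>C ((T ^^ Suc k) x - z *\<^sub>C (T ^^ k) x))"
    if x: "x \<in> M" for x
  proof -
    have Tsum: "T (\<Sum>k<n. (- (inverse z ^ Suc k)) *\<^sub>C (T ^^ k) x) = (\<Sum>k<n. (- (inverse z ^ Suc k)) *\<^sub>C (T ^^ Suc k) x)" for n
    proof (induction n)
      case (Suc n)
      have 1: "(\<Sum>k<n. (- (inverse z ^ Suc k)) *\<^sub>C (T ^^ k) x) \<in> M"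
        using bo_in[OF bo_sum[OF M bo_scaleC[OF M bo_funpow[OF T]]] x, of "\<lambda>k. - (inverse z ^ Suc k)" "\<lambda>k. k" "{..<n}"] .
      have 2: "(T ^^ n) x \<in> M" by (rule funpow_in[OF T x])
      show ?case
        using Suc.IH bo_add[OF T 1 csub_scale[OF M 2, of "- (inverse z ^ Suc n)"]] bo_scale[OF T 2, of "- (inverse z ^ Suc n)"]
        by simp
    qed (simp add: bo_0[OF M T])
    have "z *\<^sub>C S x = (\<Sum>k<d. z *\<^sub>C ((- (inverse z ^ Suc k)) *\<^sub>C (T ^^ k) x))"
      unfolding S_def by (rule complex_vector.scale_sum_right)
    moreover have "T (S x) = (\<Sum>k<d. (- (inverse z ^ Suc k)) *\<^sub>C (T ^^ Suc k) x)"
      unfolding S_def by (rule Tsum)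
    ultimately show ?thesis
      by (simp add: shift_def scaleC_simps mult.commute sum_subtractf sum_negf del: funpow.simps power_Suc)
  qed
  have comm2: "S (shift T z x) = (\<Sum>k<d. (- (inverse z ^ Suc k)) *\<^sub>C ((T ^^ Suc k) x - z *\<^sub>C (T ^^ k) x))"
    if x: "x \<in> M" for x
  proof -
    have "(T ^^ k) (T x - z *\<^sub>C x) = (T ^^ Suc k) x - z *\<^sub>C (T ^^ k) x" for k
      using bo_diff[OF M bo_funpow[OF T, of k] bo_in[OF T x] csub_scale[OF M x]]
        bo_scale[OF bo_funpow[OF T, of k] x, of z] by (simp add: funpow_swap1)
    then show ?thesis unfolding S_def shift_def by (simp del: funpow.simps)
  qed
  show ?thesis
    unfolding invertible_on_def using S comm comm2 tele by (intro bexI[of _ S]) auto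
qed

section \<open>Poles of the resolvent and Drazin invertibility\<close>

text \<open>
  \<open>T\<close> need not extend to a bounded operator on the whole space, so the usual interchange of a
  bounded operator and an integral is not applicable. Instead, the graph of \<open>T\<close> is a closed
  subspace and contains the integral of \<open>t \<mapsto> (f t, T (f t))\<close>.
\<close>

lemma bounded_op_integral:
  fixes f :: "real \<Rightarrow> 'a::complex_banach"
  assumes M: "closed_csubspace M" and T: "T \<in> bounded_ops M"
    and f: "continuous_on {a..b} f" "\<And>t. t \<in> {a..b} \<Longrightarrow> f t \<in> M"
  shows "integral {a..b} f \<in> M" "T (integral {a..b} f) = integral {a..b} (\<lambda>t. T (f t))"
proof -
  define \<Gamma> where "\<Gamma> = {p. fst p \<in> M \<and> T (fst p) = snd p}"
  have sub: "subspace \<Gamma>"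
    unfolding subspace_def \<Gamma>_def
    using csub_0[OF M] csub_add[OF M] csub_scale[OF M] bo_0[OF M T] bo_add[OF T] bo_scale[OF T]
    by (auto simp: scaleR_scaleC)
  have "closed ((M \<times> UNIV) \<inter> (\<lambda>p. T (fst p) - snd p) -` {0})"
    by (intro continuous_closed_preimage continuous_on_diff continuous_on_compose2[OF bo_continuous[OF M T]]
        closed_Times csub_closed[OF M] continuous_intros) auto
  moreover have "(M \<times> UNIV) \<inter> (\<lambda>p. T (fst p) - snd p) -` {0} = \<Gamma>"
    by (auto simp: \<Gamma>_def)
  ultimately have cl: "closed \<Gamma>" by simp
  let ?F = "\<lambda>t. (f t, T (f t))"
  have cT: "continuous_on {a..b} (\<lambda>t. T (f t))"
    by (rule continuous_on_compose2[OF bo_continuous[OF M T] f(1)]) (use f(2) in auto)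
  have cF: "continuous_on {a..b} ?F" by (intro continuous_on_Pair f(1) cT)
  have in': "integral {a..b} ?F \<in> \<Gamma>"
    by (rule integral_in_closed_subspace[OF sub cl cF]) (use f(2) in \<open>auto simp: \<Gamma>_def\<close>)
  have 1: "fst (integral {a..b} ?F) = integral {a..b} f"
    using integral_linear[OF integrable_continuous_interval[OF cF] bounded_linear_fst] by (simp add: comp_def)
  have 2: "snd (integral {a..b} ?F) = integral {a..b} (\<lambda>t. T (f t))"
    using integral_linear[OF integrable_continuous_interval[OF cF] bounded_linear_snd] by (simp add: comp_def)
  show "integral {a..b} f \<in> M" "T (integral {a..b} f) = integral {a..b} (\<lambda>t. T (f t))"
    using in' 1 2 by (auto simp: \<Gamma>_def)
qed

lemma inv_into_invertible:
  assumes "invertible_on M B" and x: "x \<in> M"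
  shows "inv_into M B x \<in> M" "B (inv_into M B x) = x" "inv_into M B (B x) = x"
proof -
  obtain S where S: "S \<in> bounded_ops M" "\<And>x. x \<in> M \<Longrightarrow> B (S x) = x \<and> S (B x) = x"
    using assms(1) unfolding invertible_on_def by blast
  have inj: "inj_on B M" by (rule inj_on_inverseI[where g = S]) (use S in auto)
  have xB: "x \<in> B ` M" using S(2)[OF x] bo_in[OF S(1) x] by (metis imageI)
  show "inv_into M B x \<in> M" by (rule inv_into_into[OF xB])
  show "B (inv_into M B x) = x" by (rule f_inv_into_f[OF xB])
  show "inv_into M B (B x) = x" by (rule inv_into_f_f[OF inj x])
qed

text \<open>
  Let \<open>R (a + \<zeta>) = \<zeta>\<^sup>-\<^sup>p G (a + \<zeta>)\<close> be the resolvent near the pole, \<open>B = T - a\<close>, and let \<open>I\<^sub>k\<close>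
  be the mean of \<open>\<zeta>\<^sup>k R (a + \<zeta>)\<close> over a circle \<open>\<bar>\<zeta>\<bar> = e\<close>. From \<open>B R = 1 + \<zeta> R\<close> follow
  \<open>B I\<^sub>0 = 1 + I\<^sub>1\<close> and \<open>B I\<^sub>k = I\<^sub>k\<^sub>+\<^sub>1\<close> for \<open>k \<ge> 1\<close>, hence \<open>B\<^sup>p\<^sup>+\<^sup>1 I\<^sub>0 = B\<^sup>p + I\<^sub>p\<^sub>+\<^sub>1\<close>. The
  last term is the mean of \<open>\<zeta> G (a + \<zeta>)\<close> and vanishes by Cauchy's theorem, so \<open>I\<^sub>0\<close> is a Drazin
  inverse.
\<close>

lemma pole_imp_Drazin:
  fixes M :: "'a::complex_banach set"
  assumes M: "closed_csubspace M" and T: "T \<in> bounded_ops M" and pole: "pole_of_resolvent M T a"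
  shows "Drazin_on M (shift T a)"
proof -
  obtain p r G where p: "p \<ge> (1::nat)" and r: "r > 0" and G: "op_analytic_on M G (ball a r)"
    and res: "\<And>z. z \<in> ball a r - {a} \<Longrightarrow> z \<notin> spectrum_on M T"
      "\<And>z x. z \<in> ball a r - {a} \<Longrightarrow> x \<in> M \<Longrightarrow> resolvent_on M T z x = inverse ((z - a) ^ p) *\<^sub>C G z x"
    using pole unfolding pole_of_resolvent_def by blast
  \<comment> \<open>the radius \<open>r / 2\<close> keeps the circle inside the disc and off its centre\<close>
  define e where "e = r / 2"
  have e: "0 < e" "e < r" using r by (auto simp: e_def)
  let ?B = "shift T a" and ?g = "circlepath a e"
  have B: "?B \<in> bounded_ops M" by (rule bo_shift[OF M T])
  define \<zeta> where "\<zeta> t = ?g t - a" for t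
  define R where "R t x = inverse (\<zeta> t ^ p) *\<^sub>C G (?g t) x" for t x
  have norm_\<zeta>: "cmod (\<zeta> t) = e" for t
    using e by (simp add: \<zeta>_def circlepath norm_mult)
  then have \<zeta>0: "\<zeta> t \<noteq> 0" for t using e by (metis norm_zero order_less_irrefl)
  have g_in: "?g t \<in> ball a r" "?g t \<in> ball a r - {a}" "?g t \<in> cball a e" for t
    using norm_\<zeta>[of t] \<zeta>0[of t] e by (auto simp: \<zeta>_def dist_norm norm_minus_commute)
  have R: "R t x \<in> M" "?B (R t x) = x + \<zeta> t *\<^sub>C R t x" "R t (?B x) = ?B (R t x)" if x: "x \<in> M" for t x
  proof -
    have inv: "invertible_on M (shift T (?g t))" using res(1)[OF g_in(2)] by (simp add: spectrum_on_def)
    have Req: "R t y = inv_into M (shift T (?g t)) y" if "y \<in> M" for y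
      using res(2)[OF g_in(2) that, of t] by (simp add: R_def \<zeta>_def resolvent_on_def)
    note i = inv_into_invertible[OF inv x]
    show RM: "R t x \<in> M" using i(1) Req[OF x] by simp
    have "T (R t x) - ?g t *\<^sub>C R t x = x" using i(2) Req[OF x] by (simp add: shift_def)
    then show BR: "?B (R t x) = x + \<zeta> t *\<^sub>C R t x"
      by (simp add: shift_def \<zeta>_def scaleC_simps algebra_simps)
    have Bx: "?B x \<in> M" by (rule bo_in[OF B x])
    have Rb: "inv_into M (shift T (?g t)) \<in> bounded_ops M"
    proof (rule bo_cong[OF M])
      show "(\<lambda>x. inverse (\<zeta> t ^ p) *\<^sub>C G (?g t) x) \<in> bounded_ops M"
        by (rule bo_scaleC[OF M]) (use G g_in(1) in \<open>auto simp: op_analytic_on_def\<close>)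
      show "inv_into M (shift T (?g t)) x = inverse (\<zeta> t ^ p) *\<^sub>C G (?g t) x" if "x \<in> M" for x
        using Req[OF that] by (simp add: R_def)
    qed
    have sx: "shift T (?g t) x = ?B x - \<zeta> t *\<^sub>C x"
      by (simp add: shift_def \<zeta>_def scaleC_simps algebra_simps)
    have "x = inv_into M (shift T (?g t)) (?B x - \<zeta> t *\<^sub>C x)" using i(3) sx by simp
    also have "\<dots> = R t (?B x) - \<zeta> t *\<^sub>C R t x"
      using bo_diff[OF M Rb Bx csub_scale[OF M x]] bo_scale[OF Rb x] Req[OF x] Req[OF Bx] by simp
    finally show "R t (?B x) = ?B (R t x)" using BR by (simp add: algebra_simps)
  qed
  have cont_g: "continuous_on {0..1} ?g" by (auto intro!: continuous_intros simp: circlepath)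
  have cont_\<zeta>: "continuous_on {0..1} \<zeta>" unfolding \<zeta>_def by (intro continuous_intros cont_g)
  have cont_R: "continuous_on {0..1} (\<lambda>t. R t x)" if x: "x \<in> M" for x
  proof -
    have "continuous_on (ball a r) (\<lambda>z. G z x)"
    proof (rule continuous_at_imp_continuous_on, rule ballI)
      fix z assume "z \<in> ball a r"
      then show "isCont (\<lambda>z. G z x) z"
        using op_analytic_on_has_derivative[OF M G open_ball _ x] has_derivative_continuous by blast
    qed
    then have "continuous_on {0..1} (\<lambda>t. G (?g t) x)"
      by (rule continuous_on_compose2[OF _ cont_g]) (use g_in in auto)
    then show ?thesis
      unfolding R_def using \<zeta>0
      by (intro bounded_bilinear.continuous_on[OF bounded_bilinear_scaleC] continuous_on_inverse
          continuous_on_power cont_\<zeta>) auto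
  qed
  define I where "I k x = integral {0..1} (\<lambda>t. \<zeta> t ^ k *\<^sub>C R t x)" for k x
  have cont_F: "continuous_on {0..1} (\<lambda>t. \<zeta> t ^ k *\<^sub>C R t x)" if "x \<in> M" for k x
    by (intro bounded_bilinear.continuous_on[OF bounded_bilinear_scaleC] continuous_on_power cont_\<zeta> cont_R that)
  have I_in: "I k x \<in> M" if x: "x \<in> M" for k x
    unfolding I_def
    by (rule bounded_op_integral(1)[OF M T cont_F[OF x]]) (use csub_scale[OF M] R(1)[OF x] in auto)
  \<comment> \<open>positive powers have mean zero: Cauchy for polynomials\<close>
  have zero: "integral {0..1} (\<lambda>t. \<zeta> t ^ Suc k *\<^sub>C x) = 0" for k and x :: 'a
  proof -
    have "integral {0..1} (\<lambda>t. (?g t - a) *\<^sub>C (\<lambda>z. (z - a) ^ k *\<^sub>C x) (?g t)) = 0"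
    proof (rule circle_integral_zero[OF _ e])
      fix z
      have "((\<lambda>z. (z - a) ^ k) has_field_derivative (of_nat k * (z - a) ^ (k - 1))) (at z)"
        by (auto intro!: derivative_eq_intros)
      then have "((\<lambda>z. (z - a) ^ k) has_derivative (*) (of_nat k * (z - a) ^ (k - 1))) (at z)"
        by (simp add: has_field_derivative_def)
      from bounded_linear.has_derivative[OF bounded_bilinear.bounded_linear_left[OF bounded_bilinear_scaleC] this, of x]
      show "\<exists>D. ((\<lambda>z. (z - a) ^ k *\<^sub>C x) has_derivative (\<lambda>w. w *\<^sub>C D)) (at z)"
        by (intro exI[of _ "(of_nat k * (z - a) ^ (k - 1)) *\<^sub>C x"]) (simp add: scaleC_scaleC mult_ac)
    qed
    then show ?thesis by (simp add: \<zeta>_def scaleC_scaleC)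
  qed
  have BI: "?B (I k x) = integral {0..1} (\<lambda>t. \<zeta> t ^ k *\<^sub>C x) + I (Suc k) x" if x: "x \<in> M" for k x
  proof -
    have "?B (I k x) = integral {0..1} (\<lambda>t. ?B (\<zeta> t ^ k *\<^sub>C R t x))"
      unfolding I_def by (rule bounded_op_integral(2)[OF M B cont_F[OF x]]) (use csub_scale[OF M] R(1)[OF x] in auto)
    also have "\<dots> = integral {0..1} (\<lambda>t. \<zeta> t ^ k *\<^sub>C x + \<zeta> t ^ Suc k *\<^sub>C R t x)"
      using R(1,2)[OF x] bo_scale[OF B] by (simp add: scaleC_simps mult.commute)
    also have "\<dots> = integral {0..1} (\<lambda>t. \<zeta> t ^ k *\<^sub>C x) + I (Suc k) x"
      unfolding I_def
      by (intro Henstock_Kurzweil_Integration.integral_add integrable_continuous_interval cont_F[OF x]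
          bounded_bilinear.continuous_on[OF bounded_bilinear_scaleC] continuous_intros cont_\<zeta>)
    finally show ?thesis .
  qed
  have pow: "(?B ^^ Suc n) (I 0 x) = (?B ^^ n) x + I (Suc n) x" if x: "x \<in> M" for n x
  proof (induction n)
    case 0
    then show ?case using BI[OF x, of 0] by (simp add: scaleC_simps)
  next
    case (Suc n)
    have "(?B ^^ Suc (Suc n)) (I 0 x) = ?B ((?B ^^ n) x + I (Suc n) x)" using Suc.IH by simp
    also have "\<dots> = ?B ((?B ^^ n) x) + ?B (I (Suc n) x)"
      by (rule bo_add[OF B funpow_in[OF B x] I_in[OF x]])
    finally show ?case using BI[OF x, of "Suc n"] zero by simp
  qed
  have last: "I (Suc p) x = 0" if x: "x \<in> M" for x
  proof -
    have "integral {0..1} (\<lambda>t. (?g t - a) *\<^sub>C (\<lambda>z. G z x) (?g t)) = 0"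
      by (rule circle_integral_zero[OF _ e]) (rule op_analytic_on_has_derivative[OF M G open_ball _ x])
    moreover have "\<zeta> t ^ Suc p *\<^sub>C R t x = (?g t - a) *\<^sub>C G (?g t) x" for t
      using \<zeta>0[of t] by (simp add: R_def \<zeta>_def scaleC_scaleC)
    ultimately show ?thesis by (simp add: I_def del: power_Suc)
  qed
  \<comment> \<open>a bound for \<open>I\<^sub>0\<close> needs \<open>G\<close> to be bounded in norm on the whole circle, hence
      compactness\<close>
  obtain C where C: "C \<ge> 0" "\<And>w x. w \<in> cball a e \<Longrightarrow> x \<in> M \<Longrightarrow> norm (G w x) \<le> C * norm x"
  proof -
    have "cball a e \<subseteq> ball a r" using e by (auto simp: cball_def)
    from op_analytic_on_bounded_compact[OF M G open_ball compact_cball this] show thesis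
      using that by blast
  qed
  have S: "I 0 \<in> bounded_ops M"
  proof (rule bounded_opsI[where K = "inverse e ^ p * C"])
    have Rb: "R t \<in> bounded_ops M" for t
      unfolding R_def by (rule bo_scaleC[OF M]) (use G g_in(1) in \<open>auto simp: op_analytic_on_def\<close>)
    note ic = integrable_continuous_interval[OF cont_R]
    show "I 0 (x + y) = I 0 x + I 0 y" if "x \<in> M" "y \<in> M" for x y
      using Henstock_Kurzweil_Integration.integral_add[OF ic[OF that(1)] ic[OF that(2)]] bo_add[OF Rb that]
      by (simp add: I_def scaleC_simps)
    show "I 0 (c *\<^sub>C x) = c *\<^sub>C I 0 x" if "x \<in> M" for c x
      using integral_linear[OF ic[OF that] bounded_linear_scaleC_const[of c]] bo_scale[OF Rb that]
      by (simp add: I_def scaleC_simps comp_def)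
    show "norm (I 0 x) \<le> inverse e ^ p * C * norm x" if x: "x \<in> M" for x
    proof -
      have "norm (integral {0..1} (\<lambda>t. R t x)) \<le> (inverse e ^ p * C * norm x) * (1 - 0)"
      proof (rule integral_bound[OF _ cont_R[OF x]])
        fix t
        have "norm (R t x) = inverse e ^ p * norm (G (?g t) x)"
          by (simp add: R_def norm_scaleC norm_inverse norm_power norm_\<zeta> power_inverse)
        also have "\<dots> \<le> inverse e ^ p * (C * norm x)"
          by (rule mult_left_mono[OF C(2)[OF g_in(3) x]]) (use e in auto)
        finally show "norm (R t x) \<le> inverse e ^ p * C * norm x" by simp
      qed auto
      then show ?thesis by (simp add: I_def scaleC_simps)
    qed
  qed (use I_in in auto)
  have comm: "?B (I 0 x) = I 0 (?B x)" if x: "x \<in> M" for x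
  proof -
    have "?B (I 0 x) = integral {0..1} (\<lambda>t. ?B (R t x))"
      using bounded_op_integral(2)[OF M B cont_R[OF x] R(1)[OF x]] by (simp add: I_def scaleC_simps)
    then show ?thesis using R(3)[OF x] by (simp add: I_def scaleC_simps)
  qed
  show ?thesis
    unfolding Drazin_on_def using S comm pow last
    by (intro bexI[of _ "I 0"] exI[of _ p]) (auto simp del: funpow.simps)
qed

text \<open>
  With \<open>E = B\<^sup>p S\<^sup>p\<close> the projection onto the part where \<open>B\<close> is invertible with inverse
  \<open>S' = S E\<close>, and \<open>E' = I - E\<close> the one onto the nilpotent part, the resolvent of \<open>B\<close> at \<open>z\<close>
  should be \<open>z\<^sup>-\<^sup>p G\<^sub>p\<close> where \<open>G\<^sub>p = z\<^sup>p S' (I - z S')\<^sup>-\<^sup>1 - \<Sum>k<p. z\<^sup>p\<^sup>-\<^sup>1\<^sup>-\<^sup>k B\<^sup>k E'\<close>. The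
  Horner recursion \<open>G\<^sub>n\<^sub>+\<^sub>1 = z G\<^sub>n - B\<^sup>n E'\<close> makes analyticity and \<open>(B - z) G\<^sub>n = z\<^sup>n - B\<^sup>n E'\<close>
  simple inductions. Taking \<open>p\<close> least ensures that \<open>G\<^sub>p = - B\<^sup>p\<^sup>-\<^sup>1 E'\<close> is not zero at \<open>z = 0\<close>.
\<close>

lemma Drazin_imp_pole:
  fixes M :: "'a::complex_banach set"
  assumes M: "closed_csubspace M" and T: "T \<in> bounded_ops M"
    and D: "Drazin_on M (shift T a)" and spec: "a \<in> spectrum_on M T"
  shows "pole_of_resolvent M T a"
proof -
  define B where "B = shift T a"
  have B: "B \<in> bounded_ops M" unfolding B_def by (rule bo_shift[OF M T])
  define W where "W p S \<longleftrightarrow> S \<in> bounded_ops M \<and> (\<forall>x\<in>M. B (S x) = S (B x) \<and> (B ^^ Suc p) (S x) = (B ^^ p) x)"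
    for p S
  \<comment> \<open>the least exponent will be the order of the pole\<close>
  define p where "p = (LEAST p. \<exists>S. W p S)"
  have exW: "\<exists>p S. W p S" using D unfolding Drazin_on_def W_def B_def by blast
  then have "\<exists>S. W p S" unfolding p_def by (rule LeastI_ex)
  then obtain S where W: "W p S" by blast
  have least: "\<not> W q S'" if "q < p" for q S'
    using not_less_Least[of q "\<lambda>p. \<exists>S. W p S"] that by (auto simp: p_def)
  have S: "S \<in> bounded_ops M" and SB: "\<And>x. x \<in> M \<Longrightarrow> B (S x) = S (B x)"
    and BpS: "\<And>x. x \<in> M \<Longrightarrow> (B ^^ Suc p) (S x) = (B ^^ p) x" using W unfolding W_def by auto
  note Bn = bo_funpow[OF B] and Sn = bo_funpow[OF S]
  have comm: "(B ^^ m) ((S ^^ n) x) = (S ^^ n) ((B ^^ m) x)" if "x \<in> M" for m n x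
    by (rule funpow_commutes_on[where S = B and T = S and M = M, OF bo_in[OF B] bo_in[OF S] SB that])
  have p0: "p \<noteq> 0"
  proof
    assume "p = 0"
    then have "\<And>x. x \<in> M \<Longrightarrow> B (S x) = x \<and> S (B x) = x" using BpS SB by simp
    then have "invertible_on M (shift T a)" unfolding invertible_on_def using S B_def by blast
    then show False using spec by (simp add: spectrum_on_def)
  qed
  have absorb: "(B ^^ (p + m)) ((S ^^ m) x) = (B ^^ p) x" if "x \<in> M" for m x
    using that
  proof (induction m arbitrary: x)
    case (Suc m)
    have Sx: "(S ^^ m) x \<in> M" by (rule funpow_in[OF S Suc.prems])
    have "(B ^^ (p + Suc m)) ((S ^^ Suc m) x) = (B ^^ m) ((B ^^ Suc p) (S ((S ^^ m) x)))"
      by (simp add: add.commute[of p] funpow_add funpow_swap1)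
    also have "\<dots> = (B ^^ (p + m)) ((S ^^ m) x)"
      using BpS[OF Sx] by (metis add.commute comp_apply funpow_add)
    finally show ?case using Suc by simp
  qed simp
  define E where "E x = (B ^^ p) ((S ^^ p) x)" for x
  have E: "E \<in> bounded_ops M" unfolding E_def by (rule bo_comp[OF Bn Sn])
  have BE: "B (E x) = E (B x)" if "x \<in> M" for x
    unfolding E_def using comm[OF that, of 1 p] by (simp add: funpow_swap1)
  have SE: "S (E x) = E (S x)" if "x \<in> M" for x
  proof -
    have "S ((B ^^ p) ((S ^^ p) x)) = (B ^^ p) (S ((S ^^ p) x))"
      using comm[OF funpow_in[OF S that], of p 1 p] by simp
    then show ?thesis unfolding E_def by (simp add: funpow_swap1)
  qed
  have BpE: "(B ^^ p) (E x) = (B ^^ p) x" if "x \<in> M" for x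
    unfolding E_def using absorb[OF that, of p] by (simp add: funpow_add)
  have EE: "E (E x) = E x" if x: "x \<in> M" for x
  proof -
    have "E (E x) = (S ^^ p) ((B ^^ p) (E x))" unfolding E_def[of "E x"] by (rule comm[OF bo_in[OF E x]])
    then show ?thesis using BpE[OF x] comm[OF x, of p p] by (simp add: E_def)
  qed
  have BSE: "B (S (E x)) = E x" if x: "x \<in> M" for x
  proof -
    have "B (S (E x)) = B (E (S x))" using SE[OF x] by simp
    also have "\<dots> = (B ^^ Suc p) (S ((S ^^ p) x))" by (simp add: E_def funpow_swap1)
    also have "\<dots> = E x" unfolding E_def by (rule BpS[OF funpow_in[OF S x]])
    finally show ?thesis .
  qed
  define S' where "S' x = S (E x)" for x
  have S': "S' \<in> bounded_ops M" unfolding S'_def by (rule bo_comp[OF S E])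
  have ES': "E (S' x) = S' x" if "x \<in> M" for x
    unfolding S'_def using SE[OF bo_in[OF E that]] EE[OF that] by simp
  have S'B: "S' (B x) = B (S' x)" if "x \<in> M" for x
    unfolding S'_def using BE[OF that] SB[OF bo_in[OF E that]] by simp
  define E' where "E' x = x - E x" for x
  have E': "E' \<in> bounded_ops M" unfolding E'_def by (rule bo_minus[OF M bo_id E])
  obtain r V where r: "r > 0" and V: "\<And>z. z \<in> ball 0 r \<Longrightarrow> V z \<in> bounded_ops M"
    and Vr: "\<And>z x. z \<in> ball 0 r \<Longrightarrow> x \<in> M \<Longrightarrow> V z x - z *\<^sub>C S' (V z x) = x"
    and Vl: "\<And>z x. z \<in> ball 0 r \<Longrightarrow> x \<in> M \<Longrightarrow> V z (x - z *\<^sub>C S' x) = x"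
    and Vb: "\<And>z x. z \<in> ball 0 r \<Longrightarrow> x \<in> M \<Longrightarrow> norm (V z x) \<le> 2 * norm x"
    by (rule neumann_family[OF M S']) blast
  define G where "G = rec_nat (\<lambda>z x. S' (V z x)) (\<lambda>n H z x. z *\<^sub>C H z x - (B ^^ n) (E' x))"
  have G0: "G 0 = (\<lambda>z x. S' (V z x))" and GS: "G (Suc n) = (\<lambda>z x. z *\<^sub>C G n z x - (B ^^ n) (E' x))" for n
    by (simp_all add: G_def)
  have Gb: "G n z \<in> bounded_ops M" if "z \<in> ball 0 r" for n z
    by (induction n) (simp_all add: G0 GS bo_comp[OF S' V[OF that]] bo_minus[OF M] bo_scaleC[OF M] bo_comp[OF Bn E'])
  have Gd: "lip_diff_at M (G n) z" if z: "z \<in> ball 0 r" for n z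
  proof (induction n)
    case 0
    have "lip_diff_at M V z" by (rule lip_diff_at_neumann[OF M S' open_ball z V Vb Vl Vr])
    then show ?case
      unfolding G0 by (intro lip_diff_at_comp_left[where G = V and U = "ball 0 r", OF M S' V open_ball z])
  next
    case (Suc n)
    have "lip_diff_at M (\<lambda>w x. (w - 0) *\<^sub>C G n w x) z" by (rule lip_diff_at_times[OF M Gb[OF z] Suc])
    then show ?case unfolding GS by (intro lip_diff_at_minus_const) simp
  qed
  have BGn: "B (G n z x) - z *\<^sub>C G n z x = z ^ n *\<^sub>C x - (B ^^ n) (E' x)" if z: "z \<in> ball 0 r" and x: "x \<in> M" for n z x
  proof (induction n)
    case 0
    have v: "V z x \<in> M" by (rule bo_in[OF V[OF z] x])
    have "B (S' (V z x)) = E (V z x)" unfolding S'_def by (rule BSE[OF v])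
    moreover have "E (V z x) - z *\<^sub>C S' (V z x) = E (V z x - z *\<^sub>C S' (V z x))"
      using bo_diff[OF M E v csub_scale[OF M bo_in[OF S' v]]] bo_scale[OF E bo_in[OF S' v]] ES'[OF v] by simp
    ultimately show ?case using Vr[OF z x] by (simp add: G0 E'_def scaleC_simps)
  next
    case (Suc n)
    have g: "G n z x \<in> M" by (rule bo_in[OF Gb[OF z] x])
    have e: "(B ^^ n) (E' x) \<in> M" by (rule bo_in[OF Bn bo_in[OF E' x]])
    have "B (G (Suc n) z x) - z *\<^sub>C G (Suc n) z x
        = z *\<^sub>C (B (G n z x) - z *\<^sub>C G n z x) - B ((B ^^ n) (E' x)) + z *\<^sub>C (B ^^ n) (E' x)"
      using bo_diff[OF M B csub_scale[OF M g] e] bo_scale[OF B g] by (simp add: GS scaleC_simps)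
    also have "\<dots> = z ^ Suc n *\<^sub>C x - (B ^^ Suc n) (E' x)"
      unfolding Suc by (simp add: scaleC_simps)
    finally show ?case .
  qed
  have VB: "V z (B x) = B (V z x)" if z: "z \<in> ball 0 r" and x: "x \<in> M" for z x
  proof -
    have v: "V z x \<in> M" by (rule bo_in[OF V[OF z] x])
    have "B (V z x) - z *\<^sub>C S' (B (V z x)) = B (V z x - z *\<^sub>C S' (V z x))"
      using bo_diff[OF M B v csub_scale[OF M bo_in[OF S' v]]] bo_scale[OF B bo_in[OF S' v]] S'B[OF v] by simp
    then have "B (V z x) - z *\<^sub>C S' (B (V z x)) = B x" using Vr[OF z x] by simp
    then show ?thesis using Vl[OF z bo_in[OF B v]] by simp
  qed
  have BG: "G n z (B x) = B (G n z x)" if z: "z \<in> ball 0 r" and x: "x \<in> M" for n z x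
  proof (induction n)
    case 0
    then show ?case using S'B[OF bo_in[OF V[OF z] x]] VB[OF z x] by (simp add: G0)
  next
    case (Suc n)
    have g: "G n z x \<in> M" by (rule bo_in[OF Gb[OF z] x])
    have e: "(B ^^ n) (E' x) \<in> M" by (rule bo_in[OF Bn bo_in[OF E' x]])
    have "E' (B x) = B (E' x)"
      unfolding E'_def using BE[OF x] bo_diff[OF M B x bo_in[OF E x]] by simp
    then show ?case
      using bo_diff[OF M B csub_scale[OF M g] e] bo_scale[OF B g] Suc by (simp add: GS funpow_swap1)
  qed
  have BpE': "(B ^^ p) (E' x) = 0" if "x \<in> M" for x
    unfolding E'_def using bo_diff[OF M Bn that bo_in[OF E that]] BpE[OF that] by simp
  have inv: "shift B z (inverse (z ^ p) *\<^sub>C G p z x) = x" "inverse (z ^ p) *\<^sub>C G p z (shift B z x) = x"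
    if z: "z \<in> ball 0 r" "z \<noteq> 0" and x: "x \<in> M" for z x
  proof -
    have g: "G p z x \<in> M" by (rule bo_in[OF Gb[OF z(1)] x])
    have eq: "B (G p z x) - z *\<^sub>C G p z x = z ^ p *\<^sub>C x" using BGn[OF z(1) x, of p] BpE'[OF x] by simp
    have "shift B z (inverse (z ^ p) *\<^sub>C G p z x) = inverse (z ^ p) *\<^sub>C (B (G p z x) - z *\<^sub>C G p z x)"
      using bo_scale[OF B g] by (simp add: shift_def scaleC_simps mult.commute)
    then show "shift B z (inverse (z ^ p) *\<^sub>C G p z x) = x" using eq z by (simp add: scaleC_simps)
    have "G p z (shift B z x) = B (G p z x) - z *\<^sub>C G p z x"
      unfolding shift_def
      using bo_diff[OF M Gb[OF z(1)] bo_in[OF B x] csub_scale[OF M x]] bo_scale[OF Gb[OF z(1)] x] BG[OF z(1) x] by simp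
    then show "inverse (z ^ p) *\<^sub>C G p z (shift B z x) = x" using eq z by (simp add: scaleC_simps)
  qed
  have shift_eq: "shift B (z - a) = shift T z" for z
    by (simp add: B_def shift_def fun_eq_iff scaleC_simps)
  have inball: "z - a \<in> ball 0 r \<longleftrightarrow> z \<in> ball a r" for z by (simp add: dist_norm norm_minus_commute)
  show ?thesis
    unfolding pole_of_resolvent_def
  proof (intro exI[of _ p] exI[of _ r] exI[of _ "\<lambda>z. G p (z - a)"] conjI ballI)
    show "op_analytic_on M (\<lambda>z. G p (z - a)) (ball a r)"
    proof (rule op_analytic_onI[OF M _ open_ball])
      fix z assume "z \<in> ball a r"
      then have z: "z - a \<in> ball 0 r" using inball by blast
      show "G p (z - a) \<in> bounded_ops M" by (rule Gb[OF z])
      obtain D C \<delta> where D: "D \<in> bounded_ops M" "C \<ge> 0" "\<delta> > 0"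
        and est: "\<And>w x. w \<in> ball (z - a) \<delta> \<Longrightarrow> x \<in> M \<Longrightarrow>
          norm (G p w x - G p (z - a) x - (w - (z - a)) *\<^sub>C D x) \<le> C * (cmod (w - (z - a)))\<^sup>2 * norm x"
        using Gd[OF z, of p] unfolding lip_diff_at_def by metis
      show "lip_diff_at M (\<lambda>z. G p (z - a)) z"
      proof (rule lip_diff_atI[OF D])
        show "norm (G p (w - a) x - G p (z - a) x - (w - z) *\<^sub>C D x) \<le> C * (cmod (w - z))\<^sup>2 * norm x"
          if "w \<in> ball z \<delta>" "x \<in> M" for w x
          using est[of "w - a" x] that by (simp add: dist_norm)
      qed
    qed
    have "\<exists>x\<in>M. G p 0 x \<noteq> 0"
    proof (rule ccontr)
      assume "\<not> ?thesis"
      then have G0: "G p 0 x = 0" if "x \<in> M" for x using that by blast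
      obtain q where q: "p = Suc q" using p0 by (cases p) auto
      have "(B ^^ q) x = (B ^^ q) (E x)" if x: "x \<in> M" for x
      proof -
        have "(B ^^ q) (E' x) = 0" using G0[OF x] by (simp add: q GS scaleC_simps)
        then show ?thesis unfolding E'_def using bo_diff[OF M Bn x bo_in[OF E x], of q] by simp
      qed
      then have eq: "(B ^^ q) x = (B ^^ p) ((B ^^ q) ((S ^^ p) x))" if "x \<in> M" for x
        using that unfolding E_def by (metis add.commute comp_apply funpow_add)
      \<comment> \<open>if \<open>B\<^sup>p\<^sup>-\<^sup>1 E'\<close> were zero, the exponent \<open>p - 1\<close> would do\<close>
      have "W q (\<lambda>x. (B ^^ q) ((S ^^ p) x))"
        unfolding W_def
      proof (intro conjI ballI)
        show "(\<lambda>x. (B ^^ q) ((S ^^ p) x)) \<in> bounded_ops M" by (rule bo_comp[OF Bn Sn])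
        show "B ((B ^^ q) ((S ^^ p) x)) = (B ^^ q) ((S ^^ p) (B x))" if "x \<in> M" for x
          using comm[OF that, of 1 p] by (simp add: funpow_swap1)
        show "(B ^^ Suc q) ((B ^^ q) ((S ^^ p) x)) = (B ^^ q) x" if "x \<in> M" for x
          using eq[OF that] q by simp
      qed
      then show False using least[of q] q by blast
    qed
    then show "\<exists>x\<in>M. G p (a - a) x \<noteq> 0" by simp
    show "p \<ge> 1" using p0 by simp
    show "r > 0" by (rule r)
    fix z assume z: "z \<in> ball a r - {a}"
    then have z': "z - a \<in> ball 0 r" "z - a \<noteq> 0" using inball by auto
    have bo: "(\<lambda>x. inverse ((z - a) ^ p) *\<^sub>C G p (z - a) x) \<in> bounded_ops M"
      by (rule bo_scaleC[OF M Gb[OF z'(1)]])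
    have i: "invertible_on M (shift T z)"
      unfolding invertible_on_def
    proof (intro bexI[OF _ bo] ballI conjI)
      fix x assume "x \<in> M"
      from inv[OF z' this]
      show "shift T z (inverse ((z - a) ^ p) *\<^sub>C G p (z - a) x) = x"
        "inverse ((z - a) ^ p) *\<^sub>C G p (z - a) (shift T z x) = x"
        unfolding shift_eq .
    qed
    then show "z \<notin> spectrum_on M T" by (simp add: spectrum_on_def)
    show "resolvent_on M T z x = inverse ((z - a) ^ p) *\<^sub>C G p (z - a) x" if x: "x \<in> M" for x
    proof -
      have "resolvent_on M T z x = inv_into M (shift T z) (shift T z (inverse ((z - a) ^ p) *\<^sub>C G p (z - a) x))"
        using inv(1)[OF z' x] by (simp add: resolvent_on_def shift_eq)
      also have "\<dots> = inverse ((z - a) ^ p) *\<^sub>C G p (z - a) x"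
        by (rule inv_into_invertible(3)[OF i bo_in[OF bo x]])
      finally show ?thesis .
    qed
  qed
qed

theorem meromorphic_on_iff_Drazin:
  fixes M :: "'a::complex_banach set"
  assumes M: "closed_csubspace M"
  shows "meromorphic_on M T \<longleftrightarrow> T \<in> bounded_ops M \<and> (\<forall>z. z \<noteq> 0 \<longrightarrow> Drazin_on M (shift T z))"
proof
  assume m: "meromorphic_on M T"
  then have T: "T \<in> bounded_ops M" by (simp add: meromorphic_on_def)
  have "Drazin_on M (shift T z)" if "z \<noteq> 0" for z
  proof (cases "z \<in> spectrum_on M T")
    case True
    then show ?thesis using m that pole_imp_Drazin[OF M T] by (auto simp: meromorphic_on_def)
  next
    case False
    then show ?thesis by (auto simp: spectrum_on_def intro: Drazin_on_invertible)
  qed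
  then show "T \<in> bounded_ops M \<and> (\<forall>z. z \<noteq> 0 \<longrightarrow> Drazin_on M (shift T z))" using T by blast
next
  assume "T \<in> bounded_ops M \<and> (\<forall>z. z \<noteq> 0 \<longrightarrow> Drazin_on M (shift T z))"
  then show "meromorphic_on M T" unfolding meromorphic_on_def using Drazin_imp_pole[OF M] by blast
qed

text \<open>
  Away from \<open>0\<close> the spectrum consists of poles, which are isolated points of it; a centre at \<open>0\<close>
  is first moved off \<open>0\<close>.
\<close>

lemma meromorphic_invertible_dense:
  assumes m: "meromorphic_on M T" and e: "e > 0"
  shows "\<exists>w\<in>ball z e. invertible_on M (shift T w)"
proof -
  \<comment> \<open>\<open>0\<close> may be any kind of spectral point, so it is replaced by a nearby nonzero one\<close>
  define u where "u = (if z = 0 then complex_of_real (e / 2) else z)"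
  have u: "u \<noteq> 0" "dist z u < e" using e by (auto simp: u_def)
  show ?thesis
  proof (cases "u \<in> spectrum_on M T")
    case True
    then have "pole_of_resolvent M T u" using m u by (auto simp: meromorphic_on_def)
    then obtain r where r: "r > 0" "\<And>w. w \<in> ball u r - {u} \<Longrightarrow> w \<notin> spectrum_on M T"
      unfolding pole_of_resolvent_def by blast
    define s where "s = min r (e - dist z u) / 2"
    have s: "s > 0" "s < r" "s < e - dist z u" using r u by (auto simp: s_def min_def)
    have "dist u (u + complex_of_real s) = s" using s by (simp add: dist_norm)
    then have "u + complex_of_real s \<in> ball u r - {u}" "dist z (u + complex_of_real s) < e"
      using s dist_triangle[of z "u + complex_of_real s" u] by auto
    then show ?thesis
      using r(2)[of "u + complex_of_real s"] by (intro bexI[of _ "u + complex_of_real s"]) (auto simp: spectrum_on_def)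
  next
    case False
    then show ?thesis using u by (auto simp: spectrum_on_def)
  qed
qed

lemma meromorphic_on_cong:
  fixes M :: "'a::complex_banach set"
  assumes M: "closed_csubspace M" and T: "T \<in> bounded_ops M" and eq: "\<And>x. x \<in> M \<Longrightarrow> T' x = T x"
  shows "meromorphic_on M T' \<longleftrightarrow> meromorphic_on M T"
proof -
  have "Drazin_on M (shift T' z) \<longleftrightarrow> Drazin_on M (shift T z)" for z
    by (rule Drazin_on_cong[OF M bo_shift[OF M T]]) (simp add: shift_def eq)
  then show ?thesis
    using T bo_cong[OF M T eq] by (simp add: meromorphic_on_iff_Drazin[OF M])
qed

lemma shift_commute_proj:
  assumes M: "closed_csubspace M" and P: "proj_on M P" and T: "T \<in> bounded_ops M"
    and c: "\<And>x. x \<in> M \<Longrightarrow> P (T x) = T (P x)" and x: "x \<in> M"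
  shows "P (shift T z x) = shift T z (P x)"
  using bo_diff[OF M proj_bo[OF P] bo_in[OF T x] csub_scale[OF M x, of z]] bo_scale[OF proj_bo[OF P] x] c[OF x]
  by (simp add: shift_def)

lemma meromorphic_on_restrict:
  fixes M :: "'a::complex_banach set"
  assumes M: "closed_csubspace M" and P: "proj_on M P" and c: "\<And>x. x \<in> M \<Longrightarrow> P (T x) = T (P x)"
    and m: "meromorphic_on M T"
  shows "meromorphic_on (P ` M) T"
proof -
  have T: "T \<in> bounded_ops M" using m by (simp add: meromorphic_on_def)
  have "Drazin_on (P ` M) (shift T z)" if "z \<noteq> 0" for z
  proof (rule Drazin_on_restrict[OF M P bo_shift[OF M T]])
    show "P (shift T z x) = shift T z (P x)" if "x \<in> M" for x
      by (rule shift_commute_proj[OF M P T _ that]) (rule c)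
    show "Drazin_on M (shift T z)" using m that by (simp add: meromorphic_on_iff_Drazin[OF M])
  qed
  moreover have "T \<in> bounded_ops (P ` M)" by (rule proj_range_invariant[OF P T c])
  ultimately show ?thesis
    by (simp add: meromorphic_on_iff_Drazin[OF proj_range_closed[OF M P]])
qed

lemma meromorphic_on_direct_sum:
  fixes M :: "'a::complex_banach set"
  assumes M: "closed_csubspace M" and P: "proj_on M P" and T: "T \<in> bounded_ops M"
    and c: "\<And>x. x \<in> M \<Longrightarrow> P (T x) = T (P x)"
    and m: "meromorphic_on (P ` M) T" "meromorphic_on ((\<lambda>x. x - P x) ` M) T"
  shows "meromorphic_on M T"
proof -
  have "Drazin_on M (shift T z)" if "z \<noteq> 0" for z
  proof (rule Drazin_on_direct_sum[OF M P bo_shift[OF M T]])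
    show "P (shift T z x) = shift T z (P x)" if "x \<in> M" for x
      by (rule shift_commute_proj[OF M P T _ that]) (rule c)
    show "Drazin_on (P ` M) (shift T z)"
      using m(1) that by (simp add: meromorphic_on_iff_Drazin[OF proj_range_closed[OF M P]])
    show "Drazin_on ((\<lambda>x. x - P x) ` M) (shift T z)"
      using m(2) that by (simp add: meromorphic_on_iff_Drazin[OF proj_range_closed[OF M proj_compl[OF M P]]])
  qed
  then show ?thesis using T by (simp add: meromorphic_on_iff_Drazin[OF M])
qed

lemma nilpotent_meromorphic:
  fixes M :: "'a::complex_banach set"
  assumes M: "closed_csubspace M" and T: "T \<in> bounded_ops M" and nil: "\<And>x. x \<in> M \<Longrightarrow> (T ^^ d) x = 0"
  shows "meromorphic_on M T"
  unfolding meromorphic_on_iff_Drazin[OF M]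
  using T Drazin_on_invertible nilpotent_shift_invertible[OF M T nil] by blast

section \<open>Right Drazin invertible operators\<close>

text \<open>
  Both sides compare \<open>T\<^sup>n (M)\<close> with its image under \<open>T\<close>: \<open>T\<^sup>n x = T\<^sup>n\<^sup>+\<^sup>1 y\<close> means
  \<open>x - T y \<in> N(T\<^sup>n)\<close>.
\<close>

lemma descent_step_iff:
  assumes M: "closed_csubspace M" and T: "T \<in> bounded_ops M"
  shows "T ` M + null_on M (T ^^ n) = M \<longleftrightarrow> (T ^^ n) ` M = (T ^^ Suc n) ` M"
proof
  note Tn = bo_funpow[OF T]
  have image_sub: "(T ^^ Suc n) ` M \<subseteq> (T ^^ n) ` M"
    using bo_in[OF T] by (auto simp: funpow_swap1)
  {
    assume eq: "T ` M + null_on M (T ^^ n) = M"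
    have "(T ^^ n) x \<in> (T ^^ Suc n) ` M" if "x \<in> M" for x
    proof -
      obtain y k where y: "y \<in> M" "k \<in> M" "(T ^^ n) k = 0" "x = T y + k"
      proof -
        have "x \<in> T ` M + null_on M (T ^^ n)" using \<open>x \<in> M\<close> eq by simp
        then obtain u k where "u \<in> T ` M" "k \<in> null_on M (T ^^ n)" "x = u + k" by (rule set_plus_elim)
        then show thesis using that[of _ k] by (auto simp: null_on_def)
      qed
      then have "(T ^^ n) x = (T ^^ Suc n) y"
        using bo_add[OF Tn bo_in[OF T y(1)] y(2), of n] by (simp add: funpow_swap1)
      then show ?thesis using y(1) by blast
    qed
    then show "(T ^^ n) ` M = (T ^^ Suc n) ` M" using image_sub by blast
  }
  assume eq: "(T ^^ n) ` M = (T ^^ Suc n) ` M"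
  show "T ` M + null_on M (T ^^ n) = M"
  proof
    show "T ` M + null_on M (T ^^ n) \<subseteq> M"
      by (auto simp: null_on_def set_plus_def intro!: csub_add[OF M] bo_in[OF T])
    show "M \<subseteq> T ` M + null_on M (T ^^ n)"
    proof
      fix x assume x: "x \<in> M"
      then obtain y where y: "y \<in> M" "(T ^^ n) x = (T ^^ Suc n) y" using eq by blast
      have "(T ^^ n) (x - T y) = 0"
        using bo_diff[OF M Tn x bo_in[OF T y(1)], of n] y(2) by (simp add: funpow_swap1)
      then have "x - T y \<in> null_on M (T ^^ n)"
        using csub_diff[OF M x bo_in[OF T y(1)]] by (simp add: null_on_def)
      then have "T y + (x - T y) \<in> T ` M + null_on M (T ^^ n)"
        using y(1) by (intro set_plus_intro) auto
      then show "x \<in> T ` M + null_on M (T ^^ n)" by simp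
    qed
  qed
qed

lemma descent_attained:
  assumes M: "closed_csubspace M" and T: "T \<in> bounded_ops M"
  shows "descent_on M T < \<infinity> \<longleftrightarrow> (\<exists>n. (T ^^ n) ` M = (T ^^ Suc n) ` M)"
    and "descent_on M T < \<infinity> \<Longrightarrow>
      (T ^^ the_enat (descent_on M T)) ` M = (T ^^ Suc (the_enat (descent_on M T))) ` M"
proof -
  let ?D = "{enat n | n. (T ^^ n) ` M = (T ^^ Suc n) ` M}"
  have eq: "descent_on M T = Inf ?D"
    unfolding descent_on_def descent_step_iff[OF M T] ..
  have mem: "Inf ?D \<in> ?D" if "?D \<noteq> {}"
  proof -
    have "\<exists>k. k \<in> ?D" using that by blast
    then obtain k where "k \<in> ?D" ..
    then have "(LEAST x. x \<in> ?D) \<in> ?D" by (rule LeastI)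
    moreover have "Inf ?D = (LEAST x. x \<in> ?D)" unfolding Inf_enat_def using that by (rule if_not_P)
    ultimately show ?thesis by presburger
  qed
  have fin: "?D \<noteq> {}" if "Inf ?D < \<infinity>"
    using that by (auto simp: Inf_enat_def simp del: funpow.simps split: if_splits)
  show 1: "descent_on M T < \<infinity> \<longleftrightarrow> (\<exists>n. (T ^^ n) ` M = (T ^^ Suc n) ` M)"
  proof
    assume "descent_on M T < \<infinity>"
    then show "\<exists>n. (T ^^ n) ` M = (T ^^ Suc n) ` M" using fin unfolding eq by blast
  next
    assume "\<exists>n. (T ^^ n) ` M = (T ^^ Suc n) ` M"
    then have "?D \<noteq> {}" by blast
    then have "\<exists>n. Inf ?D = enat n" using mem by blast
    then show "descent_on M T < \<infinity>" unfolding eq by (elim exE) simp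
  qed
  show "(T ^^ the_enat (descent_on M T)) ` M = (T ^^ Suc (the_enat (descent_on M T))) ` M"
    if "descent_on M T < \<infinity>"
  proof -
    obtain n where "Inf ?D = enat n" "(T ^^ n) ` M = (T ^^ Suc n) ` M"
      using mem[OF fin] \<open>descent_on M T < \<infinity>\<close> unfolding eq by blast
    then show ?thesis unfolding eq by (simp only: the_enat.simps)
  qed
qed

lemma funpow_image_stable:
  fixes T :: "'a \<Rightarrow> 'a"
  assumes "(T ^^ n) ` M = (T ^^ Suc n) ` M"
  shows "(T ^^ (n + k)) ` M = (T ^^ n) ` M"
proof (induction k)
  case (Suc k)
  have "(T ^^ (n + Suc k)) ` M = T ` (T ^^ (n + k)) ` M" by (simp add: image_comp comp_def)
  also have "\<dots> = (T ^^ Suc n) ` M" unfolding Suc by (simp add: image_comp comp_def)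
  finally show ?case using assms by simp
qed simp

text \<open>
  The ranges of the powers are constant from the descent on, so that the descent may be replaced
  by any exponent at which they have stabilised.
\<close>

lemma right_Drazin_on_iff:
  assumes M: "closed_csubspace M" and T: "T \<in> bounded_ops M"
  shows "right_Drazin_on M T \<longleftrightarrow>
    (\<exists>n. (T ^^ n) ` M = (T ^^ Suc n) ` M \<and> complemented_in M (null_on M T \<inter> (T ^^ n) ` M))"
    (is "_ \<longleftrightarrow> ?R")
proof
  assume "right_Drazin_on M T"
  then show ?R unfolding right_Drazin_on_def using descent_attained[OF M T] by blast
next
  assume ?R
  then obtain n where n: "(T ^^ n) ` M = (T ^^ Suc n) ` M" "complemented_in M (null_on M T \<inter> (T ^^ n) ` M)"
    by blast
  then have fin: "descent_on M T < \<infinity>" using descent_attained(1)[OF M T] by blast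
  let ?d = "the_enat (descent_on M T)"
  have "(T ^^ ?d) ` M = (T ^^ (?d + n)) ` M"
    using funpow_image_stable[OF descent_attained(2)[OF M T fin]] by simp
  also have "\<dots> = (T ^^ n) ` M"
    using funpow_image_stable[OF n(1), of ?d] by (simp add: add.commute)
  finally show "right_Drazin_on M T" unfolding right_Drazin_on_def using fin n by simp
qed

text \<open>
  Let \<open>W = T\<^sup>d (M)\<close> be the stable range, so that \<open>T W = W\<close>, and let \<open>J\<close> be a projection of \<open>M\<close>
  onto \<open>K = N(T) \<inter> W\<close>. On \<open>W\<close> there is a unique right inverse \<open>S\<close> of \<open>T\<close> with \<open>J S = 0\<close>, and it
  satisfies \<open>S T = I - J\<close>. Then \<open>Q = S\<^sup>d T\<^sup>d + \<Sum>k<d. S\<^sup>k J T\<^sup>k\<close> is a projection onto \<open>W\<close>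
  commuting with \<open>T\<close>, and \<open>T\<^sup>d\<close> vanishes on its kernel because \<open>T\<^sup>d (I - Q) = (I - Q) T\<^sup>d\<close>.

  The space \<open>W\<close> is not known to be closed in advance and \<open>S\<close> is not known to be bounded. What
  the open mapping theorem does provide are norm-controlled lifts along \<open>T\<^sup>d\<close>: if \<open>L x\<close> is \<open>T\<^sup>d\<close>
  of a vector of norm at most \<open>C \<parallel>x\<parallel>\<close>, then so is \<open>S (L x)\<close>, with another constant. Since the
  summands of \<open>Q\<close> arise in this way from \<open>T\<^sup>d\<close> and from \<open>J T\<^sup>k\<close>, the projection \<open>Q\<close> is bounded,
  and closedness of its range \<open>W\<close> is a consequence.
\<close>

lemma right_Drazin_decomposition:
  fixes M :: "'a::complex_banach set"
  assumes M: "closed_csubspace M" and T: "T \<in> bounded_ops M" and rD: "right_Drazin_on M T"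
  shows "\<exists>Q d. proj_on M Q \<and> (\<forall>x\<in>M. Q (T x) = T (Q x)) \<and> right_invertible_on (Q ` M) T
    \<and> (\<forall>x\<in>M. (T ^^ d) (x - Q x) = 0)"
proof -
  obtain d where d: "(T ^^ d) ` M = (T ^^ Suc d) ` M" and comp: "complemented_in M (null_on M T \<inter> (T ^^ d) ` M)"
    using rD unfolding right_Drazin_on_iff[OF M T] by blast
  define W where "W = (T ^^ d) ` M"
  define K where "K = null_on M T \<inter> W"
  obtain J where J: "proj_on M J" "J ` M = K"
    using comp unfolding complemented_in_iff[OF M] K_def W_def by blast
  note Jb = proj_bo[OF J(1)]
  note Td = bo_funpow[OF T, of d] and TSd = bo_funpow[OF T, of "Suc d"]
  have Kc: "closed_csubspace K" using proj_range_closed[OF M J(1)] J(2) by simp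
  have Wsub: "csubspace W" unfolding W_def by (rule image_csubspace[OF M Td])
  have WM: "W \<subseteq> M" unfolding W_def using bo_in[OF Td] by blast
  have KW: "K \<subseteq> W" and KM: "K \<subseteq> M" and KT: "\<And>k. k \<in> K \<Longrightarrow> T k = 0" using WM by (auto simp: K_def null_on_def)
  have JK: "J x \<in> K" if "x \<in> M" for x using J(2) that by blast
  have Jid: "J k = k" if "k \<in> K" for k
    using that unfolding J(2)[symmetric] proj_range_eq[OF J(1)] by simp
  have TW: "T w \<in> W" if "w \<in> W" for w
  proof -
    obtain x where "x \<in> M" "w = (T ^^ d) x" using \<open>w \<in> W\<close> by (auto simp: W_def)
    then have "T w = (T ^^ d) (T x)" "T x \<in> M" using bo_in[OF T] by (simp_all add: funpow_swap1)
    then show ?thesis by (simp add: W_def)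
  qed
  have W_add: "x + y \<in> W" and W_diff: "x - y \<in> W" and W_scale: "c *\<^sub>C x \<in> W" if "x \<in> W" "y \<in> W" for x y c
    using that Wsub complex_vector.subspace_add complex_vector.subspace_diff complex_vector.subspace_scale
    by blast+
  have W_scale: "c *\<^sub>C x \<in> W" if "x \<in> W" for c x using W_scale[OF that that] .

  have ex: "\<exists>u\<in>W. T u = w \<and> J u = 0" if w: "w \<in> W" for w
  proof -
    obtain z where z: "z \<in> M" "w = (T ^^ Suc d) z" using w d unfolding W_def by blast
    define v where "v = (T ^^ d) z"
    have v: "v \<in> W" "v \<in> M" "T v = w" using z bo_in[OF Td] by (auto simp: v_def W_def)
    have k: "J v \<in> K" using JK v by blast
    show ?thesis
    proof (intro bexI[of _ "v - J v"] conjI)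
      show "v - J v \<in> W" using W_diff v k KW by blast
      show "T (v - J v) = w" using bo_diff[OF M T v(2)] k KM KT v(3) by auto
      show "J (v - J v) = 0" using bo_diff[OF M Jb v(2)] k KM Jid by auto
    qed
  qed
  then obtain S where S: "\<And>w. w \<in> W \<Longrightarrow> S w \<in> W \<and> T (S w) = w \<and> J (S w) = 0" by metis
  have uniq: "S w = u" if "w \<in> W" "u \<in> W" "T u = w" "J u = 0" for w u
  proof -
    have Sw: "S w \<in> M" "u \<in> M" using S that WM by auto
    have "S w - u \<in> K"
      unfolding K_def null_on_def
      using csub_diff[OF M Sw] bo_diff[OF M T Sw] S[OF that(1)] that W_diff by auto
    then have "J (S w - u) = S w - u" by (rule Jid)
    then show ?thesis using bo_diff[OF M Jb Sw] S[OF that(1)] that by simp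
  qed
  have S_add: "S (x + y) = S x + S y" if "x \<in> W" "y \<in> W" for x y
  proof (rule uniq)
    have s: "S x \<in> M" "S y \<in> M" using S that WM by auto
    show "T (S x + S y) = x + y" "J (S x + S y) = 0"
      using bo_add[OF T s] bo_add[OF Jb s] S that by simp_all
  qed (use S that W_add in auto)
  have S_scale: "S (c *\<^sub>C x) = c *\<^sub>C S x" if "x \<in> W" for c x
  proof (rule uniq)
    have s: "S x \<in> M" using S that WM by auto
    show "T (c *\<^sub>C S x) = c *\<^sub>C x" "J (c *\<^sub>C S x) = 0"
      using bo_scale[OF T s] bo_scale[OF Jb s] S that by (simp_all add: scaleC_simps)
  qed (use S that W_scale in auto)
  \<comment> \<open>by uniqueness, as \<open>w - J w\<close> solves the defining equations of \<open>S (T w)\<close>\<close>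
  have ST: "S (T w) + J w = w" if w: "w \<in> W" for w
  proof -
    have wM: "w \<in> M" and k: "J w \<in> K" using w WM JK by auto
    have kM: "J w \<in> M" using k KM by blast
    have "S (T w) = w - J w"
    proof (rule uniq)
      show "T w \<in> W" using w by (rule TW)
      show "w - J w \<in> W" using w k KW W_diff by blast
      show "T (w - J w) = T w" using bo_diff[OF M T wM kM] KT[OF k] by simp
      show "J (w - J w) = 0" using bo_diff[OF M Jb wM kM] Jid[OF k] by simp
    qed
    then show ?thesis by simp
  qed

  \<comment> \<open>\<open>T\<^sup>d x = T\<^sup>d\<^sup>+\<^sup>1 z\<close> is solvable for every \<open>x\<close>; open mapping for the first
      projection of the solution space bounds \<open>z\<close>\<close>
  obtain c1 where c1: "c1 > 0" "\<And>x. x \<in> M \<Longrightarrow> \<exists>z\<in>M. (T ^^ d) x = (T ^^ Suc d) z \<and> norm z \<le> c1 * norm x"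
  proof -
    define \<Gamma> where "\<Gamma> = {p \<in> M \<times> M. (T ^^ d) (fst p) = (T ^^ Suc d) (snd p)}"
    have sub: "subspace \<Gamma>"
      unfolding subspace_def \<Gamma>_def
      using csub_0[OF M] csub_add[OF M] csub_scale[OF M] bo_0[OF M Td] bo_add[OF Td] bo_scale[OF Td]
        bo_0[OF M TSd] bo_add[OF TSd] bo_scale[OF TSd]
      by (auto simp: scaleR_scaleC zero_prod_def simp del: funpow.simps)
    have "closed ((M \<times> M) \<inter> (\<lambda>p. (T ^^ d) (fst p) - (T ^^ Suc d) (snd p)) -` {0})"
      by (intro continuous_closed_preimage continuous_on_diff continuous_on_compose2[OF bo_continuous[OF M Td]]
          continuous_on_compose2[OF bo_continuous[OF M TSd]] closed_Times csub_closed[OF M] continuous_intros) auto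
    moreover have "(M \<times> M) \<inter> (\<lambda>p. (T ^^ d) (fst p) - (T ^^ Suc d) (snd p)) -` {0} = \<Gamma>"
      by (auto simp: \<Gamma>_def)
    ultimately have cl: "closed \<Gamma>" by simp
    have onto: "fst ` \<Gamma> = M"
    proof
      show "M \<subseteq> fst ` \<Gamma>"
      proof
        fix x assume x: "x \<in> M"
        then have "(T ^^ d) x \<in> (T ^^ Suc d) ` M" using d by blast
        then obtain z where "z \<in> M" "(T ^^ d) x = (T ^^ Suc d) z" by blast
        then have "(x, z) \<in> \<Gamma>" using x by (simp add: \<Gamma>_def)
        then show "x \<in> fst ` \<Gamma>" by (rule rev_image_eqI) simp
      qed
    qed (auto simp: \<Gamma>_def)
    have "\<exists>c>0. \<forall>y\<in>M. \<exists>p\<in>\<Gamma>. fst p = y \<and> norm p \<le> c * norm y"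
      by (rule open_mapping_closed_subspaces[OF sub cl csub_subspace[OF M] csub_closed[OF M], where K = 1])
        (auto simp: onto norm_fst_le)
    then obtain c where c: "c > 0" "\<And>y. y \<in> M \<Longrightarrow> \<exists>p\<in>\<Gamma>. fst p = y \<and> norm p \<le> c * norm y" by blast
    show thesis
    proof (rule that[OF c(1)])
      fix x assume "x \<in> M"
      from c(2)[OF this] obtain p where p: "p \<in> \<Gamma>" "fst p = x" "norm p \<le> c * norm x" by blast
      have "norm (snd p) \<le> norm p" using norm_snd_le[of "snd p" "fst p"] by simp
      then have "norm (snd p) \<le> c * norm x" using p(3) by linarith
      then show "\<exists>z\<in>M. (T ^^ d) x = (T ^^ Suc d) z \<and> norm z \<le> c * norm x"
        using p by (intro bexI[of _ "snd p"]) (auto simp: \<Gamma>_def)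
    qed
  qed
  obtain cd where cd: "cd > 0" "\<And>x. x \<in> M \<Longrightarrow> norm ((T ^^ d) x) \<le> cd * norm x" using bo_bound[OF Td] by blast
  obtain cp where cp: "cp > 0" "\<And>x. x \<in> M \<Longrightarrow> norm (J x) \<le> cp * norm x" using bo_bound[OF Jb] by blast
  \<comment> \<open>elements of the closed space \<open>K\<close> have bounded lifts along \<open>T\<^sup>d\<close>\<close>
  obtain c2 where c2: "c2 > 0" "\<And>k. k \<in> K \<Longrightarrow> \<exists>x\<in>M. (T ^^ d) x = k \<and> norm x \<le> c2 * norm k"
  proof -
    let ?N = "{x\<in>M. (T ^^ d) x \<in> K}"
    have sub: "subspace ?N"
      unfolding subspace_def
      using csub_0[OF M] csub_add[OF M] csub_scale[OF M] bo_0[OF M Td] bo_add[OF Td] bo_scale[OF Td]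
        csub_0[OF Kc] csub_add[OF Kc] csub_scale[OF Kc]
      by (auto simp: scaleR_scaleC)
    have "closed (M \<inter> (T ^^ d) -` K)"
      by (intro continuous_closed_preimage bo_continuous[OF M Td] csub_closed[OF M] csub_closed[OF Kc])
    moreover have "M \<inter> (T ^^ d) -` K = ?N" by auto
    ultimately have cl: "closed ?N" by simp
    have onto: "(T ^^ d) ` ?N = K" using KW unfolding W_def by auto
    have "\<exists>c>0. \<forall>y\<in>K. \<exists>x\<in>?N. (T ^^ d) x = y \<and> norm x \<le> c * norm y"
      by (rule open_mapping_closed_subspaces[OF sub cl csub_subspace[OF Kc] csub_closed[OF Kc] _ _ _ onto, where K = cd])
        (use bo_add[OF Td] bo_scale[OF Td] cd in \<open>auto simp: scaleR_scaleC mult.commute\<close>)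
    then obtain c where "c > 0" "\<And>y. y \<in> K \<Longrightarrow> \<exists>x\<in>?N. (T ^^ d) x = y \<and> norm x \<le> c * norm y" by blast
    then show thesis by (intro that[of c]) auto
  qed
  \<comment> \<open>linear maps with norm-controlled lifts along \<open>T\<^sup>d\<close>; they are bounded and closed
      under addition and \<open>S\<close>\<close>
  define liftable where "liftable L \<longleftrightarrow> (\<forall>x\<in>M. \<forall>y\<in>M. L (x + y) = L x + L y) \<and> (\<forall>c. \<forall>x\<in>M. L (c *\<^sub>C x) = c *\<^sub>C L x)
    \<and> (\<exists>C\<ge>0. \<forall>x\<in>M. \<exists>y\<in>M. L x = (T ^^ d) y \<and> norm y \<le> C * norm x)" for L
  have liftable_W: "L x \<in> W" if "liftable L" "x \<in> M" for L x using that unfolding liftable_def W_def by blast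
  have liftable_bo: "L \<in> bounded_ops M" if g: "liftable L" for L
  proof -
    obtain C where C: "C \<ge> 0" "\<And>x. x \<in> M \<Longrightarrow> \<exists>y\<in>M. L x = (T ^^ d) y \<and> norm y \<le> C * norm x"
      using g unfolding liftable_def by blast
    have "norm (L x) \<le> cd * C * norm x" if "x \<in> M" for x
    proof -
      obtain y where y: "y \<in> M" "L x = (T ^^ d) y" "norm y \<le> C * norm x" using C(2)[OF \<open>x \<in> M\<close>] by blast
      have "cd * norm y \<le> cd * (C * norm x)" by (rule mult_left_mono[OF y(3)]) (use cd in simp)
      then show ?thesis using cd(2)[OF y(1)] y(2) by simp
    qed
    then show ?thesis
      using g liftable_W[OF g] WM by (intro bounded_opsI[where K = "cd * C"]) (auto simp: liftable_def)
  qed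
  have liftable_Td: "liftable (T ^^ d)"
    unfolding liftable_def using bo_add[OF Td] bo_scale[OF Td] by (auto intro!: exI[of _ 1])
  have liftable_add: "liftable (\<lambda>x. L x + L' x)" if g: "liftable L" and g': "liftable L'" for L L'
  proof -
    obtain C where C: "C \<ge> 0" "\<And>x. x \<in> M \<Longrightarrow> \<exists>y\<in>M. L x = (T ^^ d) y \<and> norm y \<le> C * norm x"
      using g unfolding liftable_def by blast
    obtain C' where C': "C' \<ge> 0" "\<And>x. x \<in> M \<Longrightarrow> \<exists>y\<in>M. L' x = (T ^^ d) y \<and> norm y \<le> C' * norm x"
      using g' unfolding liftable_def by blast
    have "\<exists>y\<in>M. L x + L' x = (T ^^ d) y \<and> norm y \<le> (C + C') * norm x" if "x \<in> M" for x
    proof -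
      obtain y where y: "y \<in> M" "L x = (T ^^ d) y" "norm y \<le> C * norm x" using C(2)[OF \<open>x \<in> M\<close>] by blast
      obtain y' where y': "y' \<in> M" "L' x = (T ^^ d) y'" "norm y' \<le> C' * norm x" using C'(2)[OF \<open>x \<in> M\<close>] by blast
      have "norm (y + y') \<le> (C + C') * norm x"
        using norm_triangle_ineq[of y y'] y(3) y'(3) by (simp add: distrib_right)
      then show ?thesis
        using y y' bo_add[OF Td y(1) y'(1)] csub_add[OF M y(1) y'(1)] by (intro bexI[of _ "y + y'"]) auto
    qed
    then show ?thesis
      using g g' C(1) C'(1) unfolding liftable_def by (auto simp: scaleC_simps intro!: exI[of _ "C + C'"])
  qed
  have liftable_J: "liftable (\<lambda>x. J (X x))" if X: "X \<in> bounded_ops M" for X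
  proof -
    obtain cx where cx: "cx > 0" "\<And>x. x \<in> M \<Longrightarrow> norm (X x) \<le> cx * norm x" using bo_bound[OF X] by blast
    have "\<exists>y\<in>M. J (X x) = (T ^^ d) y \<and> norm y \<le> (c2 * (cp * cx)) * norm x" if x: "x \<in> M" for x
    proof -
      have XM: "X x \<in> M" by (rule bo_in[OF X x])
      obtain y where y: "y \<in> M" "(T ^^ d) y = J (X x)" "norm y \<le> c2 * norm (J (X x))"
        using c2(2)[OF JK[OF XM]] by blast
      have "norm (J (X x)) \<le> cp * (cx * norm x)"
        using cp(2)[OF XM] mult_left_mono[OF cx(2)[OF x], of cp] cp(1) by linarith
      then have "c2 * norm (J (X x)) \<le> c2 * (cp * (cx * norm x))"
        by (rule mult_left_mono) (use c2 in simp)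
      then show ?thesis using y by (intro bexI[of _ y]) auto
    qed
    then show ?thesis
      unfolding liftable_def
      using bo_add[OF bo_comp[OF Jb X]] bo_scale[OF bo_comp[OF Jb X]] c2(1) cp(1) cx(1)
      by (auto intro!: exI[of _ "c2 * (cp * cx)"])
  qed
  have liftable_S: "liftable (\<lambda>x. S (L x))" if g: "liftable L" for L
  proof -
    obtain C where C: "C \<ge> 0" "\<And>x. x \<in> M \<Longrightarrow> \<exists>y\<in>M. L x = (T ^^ d) y \<and> norm y \<le> C * norm x"
      using g unfolding liftable_def by blast
    have "\<exists>y\<in>M. S (L x) = (T ^^ d) y \<and> norm y \<le> ((1 + c2 * (cp * cd)) * (c1 * C)) * norm x" if x: "x \<in> M" for x
    proof -
      obtain y where y: "y \<in> M" "L x = (T ^^ d) y" "norm y \<le> C * norm x" using C(2)[OF x] by blast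
      obtain z where z: "z \<in> M" "(T ^^ d) y = (T ^^ Suc d) z" "norm z \<le> c1 * norm y" using c1(2)[OF y(1)] by blast
      define v where "v = (T ^^ d) z"
      have v: "v \<in> W" "v \<in> M" using z bo_in[OF Td] by (auto simp: v_def W_def)
      obtain x' where x': "x' \<in> M" "(T ^^ d) x' = J v" "norm x' \<le> c2 * norm (J v)"
        using c2(2)[OF JK[OF v(2)]] by blast
      have "T v = L x" using y z by (simp add: v_def)
      then have "S (L x) = v - J v" using ST[OF v(1)] by (simp add: eq_diff_eq)
      also have "\<dots> = (T ^^ d) (z - x')" using bo_diff[OF M Td z(1) x'(1)] x'(2) by (simp add: v_def)
      finally have eq: "S (L x) = (T ^^ d) (z - x')" .
      have "norm (J v) \<le> cp * (cd * norm z)"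
        using cp(2)[OF v(2)] mult_left_mono[OF cd(2)[OF z(1)], of cp] cp(1) unfolding v_def by linarith
      then have "c2 * norm (J v) \<le> c2 * (cp * (cd * norm z))" by (rule mult_left_mono) (use c2 in simp)
      then have "norm (z - x') \<le> (1 + c2 * (cp * cd)) * norm z"
        using norm_triangle_ineq4[of z x'] x'(3) by (simp add: distrib_right)
      also have "\<dots> \<le> (1 + c2 * (cp * cd)) * (c1 * C * norm x)"
      proof (rule mult_left_mono)
        have "c1 * norm y \<le> c1 * (C * norm x)" by (rule mult_left_mono[OF y(3)]) (use c1 in simp)
        then show "norm z \<le> c1 * C * norm x" using z(3) by simp
      qed (use c2 cp cd in simp)
      finally show ?thesis using eq csub_diff[OF M z(1) x'(1)] by (intro bexI[of _ "z - x'"]) auto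
    qed
    moreover have "(1 + c2 * (cp * cd)) * (c1 * C) \<ge> 0" using c1 c2 cp cd C by simp
    moreover have "S (L (x + y)) = S (L x) + S (L y)" if "x \<in> M" "y \<in> M" for x y
      using g that S_add liftable_W[OF g] by (simp add: liftable_def)
    moreover have "S (L (c *\<^sub>C x)) = c *\<^sub>C S (L x)" if "x \<in> M" for c x
      using g that S_scale liftable_W[OF g] by (simp add: liftable_def)
    ultimately show ?thesis unfolding liftable_def by blast
  qed

  \<comment> \<open>\<open>H j\<close> is the formula for \<open>Q\<close> with \<open>j\<close> in place of \<open>d\<close>, written recursively; on
      vectors that \<open>T\<^sup>j\<close> maps into \<open>W\<close> it does not change when \<open>j\<close> grows, and this is
      what makes \<open>Q\<close> commute with \<open>T\<close>\<close>
  define H where "H = rec_nat (\<lambda>x. x) (\<lambda>_ h x. S (h (T x)) + J x)"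
  have H0: "H 0 x = x" and HS: "H (Suc j) x = S (H j (T x)) + J x" for j x by (simp_all add: H_def)
  have H_W: "H j x \<in> W" if "x \<in> M" "(T ^^ j) x \<in> W" for j x
    using that
  proof (induction j arbitrary: x)
    case (Suc j)
    have "H j (T x) \<in> W" using Suc.IH[of "T x"] Suc.prems bo_in[OF T] by (simp add: funpow_swap1)
    then show ?case unfolding HS using S JK[OF Suc.prems(1)] KW W_add by blast
  qed (simp add: H0)
  have H_Suc: "H (Suc j) x = H j x" if "x \<in> M" "(T ^^ j) x \<in> W" for j x
    using that
  proof (induction j arbitrary: x)
    case 0
    then show ?case using ST by (simp add: HS H0)
  next
    case (Suc j)
    have "H (Suc j) (T x) = H j (T x)" using Suc.IH[of "T x"] Suc.prems bo_in[OF T] by (simp add: funpow_swap1)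
    then show ?case by (simp add: HS)
  qed
  have TH: "T (H (Suc j) x) = H j (T x)" if "x \<in> M" "(T ^^ Suc j) x \<in> W" for j x
  proof -
    have h: "H j (T x) \<in> W" using H_W[of "T x" j] that bo_in[OF T] by (simp add: funpow_swap1)
    have k: "J x \<in> K" by (rule JK[OF that(1)])
    have "S (H j (T x)) \<in> M" "J x \<in> M" using S[OF h] WM k KM by auto
    from bo_add[OF T this] show ?thesis unfolding HS using S[OF h] KT[OF k] by simp
  qed
  have H_fix: "H j w = w" if "w \<in> W" for j w
  proof (induction j)
    case (Suc j)
    have "(T ^^ j) w \<in> W" by (induction j) (use that TW in auto)
    then show ?case using H_Suc[of w j] that WM Suc by auto
  qed (simp add: H0)
  have H_liftable: "liftable (\<lambda>x. H j ((T ^^ i) x))" if "i + j = d" for i j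
    using that
  proof (induction j arbitrary: i)
    case 0
    then show ?case using liftable_Td by (simp add: H0)
  next
    case (Suc j)
    have "liftable (\<lambda>x. S (H j ((T ^^ Suc i) x)) + J ((T ^^ i) x))"
      by (intro liftable_add liftable_S liftable_J Suc.IH bo_funpow[OF T]) (use Suc.prems in simp)
    then show ?case by (simp add: HS)
  qed
  define Q where "Q = H d"
  have Q_liftable: "liftable Q" using H_liftable[of 0 d] by (simp add: Q_def)
  have QW: "Q x \<in> W" if "x \<in> M" for x by (rule liftable_W[OF Q_liftable that])
  have Qid: "Q w = w" if "w \<in> W" for w unfolding Q_def by (rule H_fix[OF that])
  have Q: "proj_on M Q" unfolding proj_on_def using liftable_bo[OF Q_liftable] QW Qid by blast
  have Qrange: "Q ` M = W" using QW Qid WM by force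
  have QT: "Q (T x) = T (Q x)" if x: "x \<in> M" for x
  proof -
    have "(T ^^ d) x \<in> W" using x by (simp add: W_def)
    moreover from this have "(T ^^ Suc d) x \<in> W" using TW by simp
    ultimately show ?thesis unfolding Q_def using TH[OF x, of d] H_Suc[OF x, of d] by metis
  qed
  have nil: "(T ^^ d) (x - Q x) = 0" if x: "x \<in> M" for x
  proof -
    have "(T ^^ d) (Q x) = Q ((T ^^ d) x)"
      by (rule funpow_commute_on[where M = M and T = T and S = Q, OF bo_in[OF T] QT x, symmetric])
    also have "\<dots> = (T ^^ d) x" by (rule Qid) (use x in \<open>simp add: W_def\<close>)
    finally show ?thesis using bo_diff[OF M Td x bo_in[OF proj_bo[OF Q] x]] by simp
  qed
  have Wc: "closed_csubspace W" using proj_range_closed[OF M Q] Qrange by simp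
  have "right_invertible_on W T"
  proof (rule right_invertible_of_complemented_null[OF Wc])
    show "T \<in> bounded_ops W" by (rule bo_restrict[OF T WM TW])
    show "T ` W = W" using S TW by force
    have "J \<in> bounded_ops W" by (rule bo_restrict[OF Jb WM]) (use JK KW WM in blast)
    then show "proj_on W J" unfolding proj_on_def using proj_idem[OF J(1)] WM by blast
    show "J ` W = null_on W T"
    proof
      show "J ` W \<subseteq> null_on W T" using JK WM KW KT by (auto simp: null_on_def)
      show "null_on W T \<subseteq> J ` W"
      proof
        fix k assume k: "k \<in> null_on W T"
        then have "k \<in> K" using WM by (auto simp: K_def null_on_def)
        then show "k \<in> J ` W" using Jid[of k] k by (metis (no_types, lifting) KW imageI subsetD)
      qed
    qed
  qed
  then show ?thesis using Q QT Qrange nil by (intro exI[of _ Q] exI[of _ d]) auto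
qed

text \<open>
  If \<open>J\<close> projects onto \<open>N(T) \<inter> R(T\<^sup>n)\<close>, then its compression \<open>P J\<close> projects onto the
  corresponding subspace of the summand, as \<open>P\<close> commutes with \<open>T\<close> and so preserves both kernel
  and range.
\<close>

lemma right_Drazin_restrict:
  fixes M :: "'a::complex_banach set"
  assumes M: "closed_csubspace M" and P: "proj_on M P" and T: "T \<in> bounded_ops M"
    and c: "\<And>x. x \<in> M \<Longrightarrow> P (T x) = T (P x)" and rD: "right_Drazin_on M T"
  shows "right_Drazin_on (P ` M) T"
proof -
  note Pb = proj_bo[OF P]
  have R: "closed_csubspace (P ` M)" by (rule proj_range_closed[OF M P])
  have RT: "T \<in> bounded_ops (P ` M)" by (rule proj_range_invariant[OF P T c])
  obtain n where n: "(T ^^ n) ` M = (T ^^ Suc n) ` M" and comp: "complemented_in M (null_on M T \<inter> (T ^^ n) ` M)"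
    using rD unfolding right_Drazin_on_iff[OF M T] by blast
  obtain J where J: "proj_on M J" "J ` M = null_on M T \<inter> (T ^^ n) ` M"
    using comp unfolding complemented_in_iff[OF M] by blast
  have cn: "P ((T ^^ n) x) = (T ^^ n) (P x)" if "x \<in> M" for x n
    by (rule funpow_commute_on[where M = M and T = T and S = P, OF bo_in[OF T] c that])
  have imP: "(T ^^ n) ` P ` M = P ` (T ^^ n) ` M" for n
    using cn by (simp add: image_comp comp_def)
  have "(T ^^ n) ` P ` M = (T ^^ Suc n) ` P ` M"
    unfolding imP n ..
  moreover have "complemented_in (P ` M) (null_on (P ` M) T \<inter> (T ^^ n) ` P ` M)"
    unfolding complemented_in_iff[OF R]
  proof (intro exI[of _ "\<lambda>x. P (J x)"] conjI)
    have sub: "x \<in> M" "P x = x" if "x \<in> P ` M" for x using that unfolding proj_range_eq[OF P] by auto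
    have in': "P (J x) \<in> null_on (P ` M) T \<inter> (T ^^ n) ` P ` M" if x: "x \<in> M" for x
    proof -
      have "J x \<in> null_on M T \<inter> (T ^^ n) ` M" using J(2) x by blast
      then have k: "J x \<in> M" "T (J x) = 0" "J x \<in> (T ^^ n) ` M" by (auto simp: null_on_def)
      have "T (P (J x)) = 0" using c[OF k(1)] k(2) bo_0[OF M Pb] by simp
      moreover have "P (J x) \<in> P ` M" by (rule imageI[OF k(1)])
      moreover have "P (J x) \<in> P ` (T ^^ n) ` M" by (rule imageI[OF k(3)])
      ultimately show ?thesis unfolding imP null_on_def by simp
    qed
    have fixed: "P (J x) = x" if "x \<in> null_on (P ` M) T \<inter> (T ^^ n) ` P ` M" for x
    proof -
      have "x \<in> P ` M" "T x = 0" using that by (simp_all add: null_on_def)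
      note x = sub[OF this(1)] this(2)
      have "(T ^^ n) ` P ` M \<subseteq> (T ^^ n) ` M" by (rule image_mono) (use sub(1) in blast)
      then have "x \<in> (T ^^ n) ` M" using that by blast
      then have "x \<in> J ` M" unfolding J(2) null_on_def using x by blast
      then have "J x = x" unfolding proj_range_eq[OF J(1)] by simp
      then show ?thesis using x by simp
    qed
    show "proj_on (P ` M) (\<lambda>x. P (J x))"
      unfolding proj_on_def
    proof (intro conjI ballI)
      show "(\<lambda>x. P (J x)) \<in> bounded_ops (P ` M)"
      proof (rule bo_restrict[OF bo_comp[OF Pb proj_bo[OF J(1)]]])
        show "P ` M \<subseteq> M" using sub(1) by blast
        show "P (J x) \<in> P ` M" if "x \<in> P ` M" for x
          by (rule imageI[OF bo_in[OF proj_bo[OF J(1)] sub(1)[OF that]]])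
      qed
      show "P (J (P (J x))) = P (J x)" if "x \<in> P ` M" for x
        by (rule fixed[OF in'[OF sub(1)[OF that]]])
    qed
    show "(\<lambda>x. P (J x)) ` P ` M = null_on (P ` M) T \<inter> (T ^^ n) ` P ` M"
    proof
      show "(\<lambda>x. P (J x)) ` P ` M \<subseteq> null_on (P ` M) T \<inter> (T ^^ n) ` P ` M"
        using in' sub(1) by blast
      show "null_on (P ` M) T \<inter> (T ^^ n) ` P ` M \<subseteq> (\<lambda>x. P (J x)) ` P ` M"
      proof
        fix x assume x: "x \<in> null_on (P ` M) T \<inter> (T ^^ n) ` P ` M"
        then have "x \<in> P ` M" by (simp add: null_on_def)
        then show "x \<in> (\<lambda>x. P (J x)) ` P ` M" using fixed[OF x] by (rule rev_image_eqI[OF _ sym])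
      qed
    qed
  qed
  ultimately show ?thesis unfolding right_Drazin_on_iff[OF R RT] by blast
qed

lemma right_inverse_null_projection:
  assumes M: "closed_csubspace M" and T: "T \<in> bounded_ops M" and S: "S \<in> bounded_ops M"
    and TS: "\<And>x. x \<in> M \<Longrightarrow> T (S x) = x"
  shows "proj_on M (\<lambda>x. x - S (T x))" "(\<lambda>x. x - S (T x)) ` M = null_on M T"
proof -
  have b: "(\<lambda>x. x - S (T x)) \<in> bounded_ops M" by (rule bo_minus[OF M bo_id bo_comp[OF S T]])
  have null: "T (x - S (T x)) = 0" if "x \<in> M" for x
    using bo_diff[OF M T that bo_in[OF S bo_in[OF T that]]] TS[OF bo_in[OF T that]] by simp
  show "proj_on M (\<lambda>x. x - S (T x))" unfolding proj_on_def using b null bo_0[OF M S] by simp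
  have "null_on M T \<subseteq> (\<lambda>x. x - S (T x)) ` M"
  proof
    fix x assume "x \<in> null_on M T"
    then have "x \<in> M" "x = x - S (T x)" using bo_0[OF M S] by (simp_all add: null_on_def)
    then show "x \<in> (\<lambda>x. x - S (T x)) ` M" by (rule rev_image_eqI)
  qed
  moreover have "(\<lambda>x. x - S (T x)) ` M \<subseteq> null_on M T"
    using null bo_in[OF b] unfolding null_on_def by blast
  ultimately show "(\<lambda>x. x - S (T x)) ` M = null_on M T" by blast
qed

text \<open>
  On the Drazin invertible summand \<open>N(T) \<inter> R(T\<^sup>p) = 0\<close>, so that only the kernel of the right
  invertible summand has to be complemented.
\<close>

lemma right_Drazin_direct_sum:
  fixes M :: "'a::complex_banach set"
  assumes M: "closed_csubspace M" and P: "proj_on M P" and T: "T \<in> bounded_ops M"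
    and c: "\<And>x. x \<in> M \<Longrightarrow> P (T x) = T (P x)"
    and ri: "right_invertible_on (P ` M) T" and D: "Drazin_on ((\<lambda>x. x - P x) ` M) T"
  shows "right_Drazin_on M T"
proof -
  let ?Q = "\<lambda>x. x - P x"
  have Q: "proj_on M ?Q" by (rule proj_compl[OF M P])
  note Pb = proj_bo[OF P] and Qb = proj_bo[OF Q]
  have R: "closed_csubspace (P ` M)" by (rule proj_range_closed[OF M P])
  have RT: "T \<in> bounded_ops (P ` M)" by (rule proj_range_invariant[OF P T c])
  obtain S1 where S1: "S1 \<in> bounded_ops (P ` M)" "\<And>x. x \<in> P ` M \<Longrightarrow> T (S1 x) = x"
    using ri unfolding right_invertible_on_def by blast
  obtain S2 p where S2: "S2 \<in> bounded_ops (?Q ` M)" and ST2: "\<And>x. x \<in> ?Q ` M \<Longrightarrow> T (S2 x) = S2 (T x)"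
    and p: "\<And>x. x \<in> ?Q ` M \<Longrightarrow> (T ^^ Suc p) (S2 x) = (T ^^ p) x"
    using D unfolding Drazin_on_def by blast
  have cQ: "?Q (T x) = T (?Q x)" if "x \<in> M" for x
    using c[OF that] bo_diff[OF M T that bo_in[OF Pb that]] by simp
  have QT: "T \<in> bounded_ops (?Q ` M)" using proj_range_invariant[of M ?Q T] Q T cQ by blast
  have Psub: "x \<in> M" "P x = x" if "x \<in> P ` M" for x using that unfolding proj_range_eq[OF P] by auto
  have Qsub: "x \<in> M" "P x = 0" if "x \<in> ?Q ` M" for x using that unfolding proj_compl_range[OF M P] by auto
  have Tn_onto: "\<exists>y\<in>P ` M. (T ^^ n) y = x" if "x \<in> P ` M" for n x
    using that
  proof (induction n arbitrary: x)
    case (Suc n)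
    obtain y where "y \<in> P ` M" "(T ^^ n) y = S1 x" using Suc.IH[OF bo_in[OF S1(1) Suc.prems]] by blast
    then show ?case using S1(2)[OF Suc.prems] by (intro bexI[of _ y]) auto
  qed auto
  have cn: "P ((T ^^ n) x) = (T ^^ n) (P x)" if "x \<in> M" for x n
    by (rule funpow_commute_on[where M = M and T = T and S = P, OF bo_in[OF T] c that])
  have split: "(T ^^ n) x = (T ^^ n) (P x) + (T ^^ n) (?Q x)" if "x \<in> M" for n x
    using bo_add[OF bo_funpow[OF T] bo_in[OF Pb that] bo_in[OF Qb that], of n] by simp
  have "(T ^^ p) ` M = (T ^^ Suc p) ` M"
  proof
    show "(T ^^ Suc p) ` M \<subseteq> (T ^^ p) ` M" using bo_in[OF T] by (auto simp: funpow_swap1)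
    show "(T ^^ p) ` M \<subseteq> (T ^^ Suc p) ` M"
    proof
      fix y assume "y \<in> (T ^^ p) ` M"
      then obtain x where x: "x \<in> M" "y = (T ^^ p) x" by blast
      have "(T ^^ p) (P x) \<in> P ` M" using funpow_in[OF RT] x(1) by blast
      then obtain u where u: "u \<in> P ` M" "(T ^^ Suc p) u = (T ^^ p) (P x)" using Tn_onto by blast
      have q: "?Q x \<in> ?Q ` M" using x(1) by blast
      have v: "S2 (?Q x) \<in> M" using bo_in[OF S2 q] Qsub(1) by blast
      have "(T ^^ Suc p) (u + S2 (?Q x)) = y"
        using bo_add[OF bo_funpow[OF T, of "Suc p"] Psub(1)[OF u(1)] v] u(2) p[OF q] split[OF x(1), of p] x(2)
        by (simp only:)
      then show "y \<in> (T ^^ Suc p) ` M" using csub_add[OF M Psub(1)[OF u(1)] v] by blast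
    qed
  qed
  moreover have "complemented_in M (null_on M T \<inter> (T ^^ p) ` M)"
    unfolding complemented_in_iff[OF M]
  proof (intro exI[of _ "\<lambda>x. P x - S1 (T (P x))"] conjI)
    let ?F = "\<lambda>x. x - S1 (T x)"
    have F: "proj_on (P ` M) ?F" "?F ` P ` M = null_on (P ` M) T"
      by (rule right_inverse_null_projection[OF R RT S1(1)], rule S1(2), assumption)+
    have FP: "?F (P x) \<in> null_on (P ` M) T" if "x \<in> M" for x
      using imageI[OF imageI[OF that, of P], of ?F] unfolding F(2) .
    have nP: "null_on (P ` M) T \<subseteq> P ` M" by (auto simp: null_on_def)
    have Fid: "?F x = x" if "x \<in> null_on (P ` M) T" for x
      using that bo_0[OF R S1(1)] by (simp add: null_on_def)
    have Pid: "P x = x" if "x \<in> null_on (P ` M) T" for x using that nP Psub(2) by blast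
    have bo: "(\<lambda>x. ?F (P x)) \<in> bounded_ops M" by (rule bo_proj_comp[OF M P proj_bo[OF F(1)]])
    show "proj_on M (\<lambda>x. P x - S1 (T (P x)))"
      unfolding proj_on_def
    proof (intro conjI ballI bo)
      show "P (?F (P x)) - S1 (T (P (?F (P x)))) = ?F (P x)" if "x \<in> M" for x
        using Pid[OF FP[OF that]] Fid[OF FP[OF that]] by simp
    qed
    have "null_on M T \<inter> (T ^^ p) ` M = null_on (P ` M) T"
    proof
      show "null_on (P ` M) T \<subseteq> null_on M T \<inter> (T ^^ p) ` M"
      proof
        fix x assume x: "x \<in> null_on (P ` M) T"
        then have xP: "x \<in> P ` M" "T x = 0" by (simp_all add: null_on_def)
        obtain y where "y \<in> P ` M" "(T ^^ p) y = x" using Tn_onto[OF xP(1)] by blast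
        then have "x \<in> (T ^^ p) ` M" using Psub(1) by blast
        then show "x \<in> null_on M T \<inter> (T ^^ p) ` M" using xP Psub(1) by (simp add: null_on_def)
      qed
      show "null_on M T \<inter> (T ^^ p) ` M \<subseteq> null_on (P ` M) T"
      proof
        fix x assume "x \<in> null_on M T \<inter> (T ^^ p) ` M"
        then obtain u where u: "u \<in> M" "x = (T ^^ p) u" and x: "x \<in> M" "T x = 0" by (auto simp: null_on_def)
        have q: "?Q u \<in> ?Q ` M" using u(1) by blast
        have qx: "?Q x \<in> ?Q ` M" using x(1) by blast
        have Qx: "?Q x = (T ^^ p) (?Q u)" using cn[OF u(1), of p] split[OF u(1), of p] u(2) by simp
        have Q0: "T (?Q x) = 0" using cQ[OF x(1)] x(2) bo_0[OF M Pb] by simp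
        have "?Q x = (T ^^ Suc p) (S2 (?Q u))" using Qx p[OF q] by simp
        also have "\<dots> = S2 ((T ^^ Suc p) (?Q u))"
          by (rule funpow_commute_on[where M = "?Q ` M" and T = T and S = S2, OF bo_in[OF QT] ST2[symmetric] q, symmetric])
        also have "\<dots> = S2 0" using Qx Q0 by simp
        also have "\<dots> = 0" by (rule bo_0[OF proj_range_closed[OF M Q] S2])
        finally have "P x = x" by simp
        then show "x \<in> null_on (P ` M) T" using x unfolding null_on_def proj_range_eq[OF P] by simp
      qed
    qed
    moreover have "(\<lambda>x. ?F (P x)) ` M = null_on (P ` M) T"
      unfolding F(2)[symmetric] by (simp only: image_image)
    ultimately show "(\<lambda>x. P x - S1 (T (P x))) ` M = null_on M T \<inter> (T ^^ p) ` M" by simp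
  qed
  ultimately show ?thesis unfolding right_Drazin_on_iff[OF M T] by blast
qed

text \<open>
  If \<open>T S = I\<close> then \<open>(T - z) S = I - z S\<close>, which is invertible for small \<open>z\<close>.
\<close>

lemma right_invertible_shift:
  fixes M :: "'a::complex_banach set"
  assumes M: "closed_csubspace M" and ri: "right_invertible_on M T"
  shows "\<exists>r>0. \<forall>z\<in>ball 0 r. right_invertible_on M (shift T z)"
proof -
  obtain S where S: "S \<in> bounded_ops M" "\<And>x. x \<in> M \<Longrightarrow> T (S x) = x"
    using ri unfolding right_invertible_on_def by blast
  obtain r V where r: "r > 0" and V: "\<And>z. z \<in> ball 0 r \<Longrightarrow> V z \<in> bounded_ops M"
    and Vr: "\<And>z x. z \<in> ball 0 r \<Longrightarrow> x \<in> M \<Longrightarrow> V z x - z *\<^sub>C S (V z x) = x"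
    by (rule neumann_family[OF M S(1)]) blast
  have "right_invertible_on M (shift T z)" if z: "z \<in> ball 0 r" for z
    unfolding right_invertible_on_def
  proof (intro bexI[of _ "\<lambda>x. S (V z x)"] ballI)
    show "(\<lambda>x. S (V z x)) \<in> bounded_ops M" by (rule bo_comp[OF S(1) V[OF z]])
    show "shift T z (S (V z x)) = x" if "x \<in> M" for x
      using S(2)[OF bo_in[OF V[OF z] that]] Vr[OF z that] by (simp add: shift_def)
  qed
  then show ?thesis using r by blast
qed

lemma right_invertible_direct_sum:
  assumes M: "closed_csubspace M" and P: "proj_on M P" and T: "T \<in> bounded_ops M"
    and r1: "right_invertible_on (P ` M) T" and r2: "right_invertible_on ((\<lambda>x. x - P x) ` M) T"
  shows "right_invertible_on M T"
proof -
  let ?Q = "\<lambda>x. x - P x"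
  have Q: "proj_on M ?Q" by (rule proj_compl[OF M P])
  obtain S1 where S1: "S1 \<in> bounded_ops (P ` M)" "\<And>x. x \<in> P ` M \<Longrightarrow> T (S1 x) = x"
    using r1 unfolding right_invertible_on_def by blast
  obtain S2 where S2: "S2 \<in> bounded_ops (?Q ` M)" "\<And>x. x \<in> ?Q ` M \<Longrightarrow> T (S2 x) = x"
    using r2 unfolding right_invertible_on_def by blast
  have b1: "(\<lambda>x. S1 (P x)) \<in> bounded_ops M" by (rule bo_proj_comp[OF M P S1(1)])
  have b2: "(\<lambda>x. S2 (?Q x)) \<in> bounded_ops M" by (rule bo_proj_comp[OF M Q S2(1)])
  show ?thesis
    unfolding right_invertible_on_def
  proof (intro bexI[OF _ bo_plus[OF M b1 b2]] ballI)
    fix x assume x: "x \<in> M"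
    then show "T (S1 (P x) + S2 (?Q x)) = x"
      using bo_add[OF T bo_in[OF b1 x] bo_in[OF b2 x]] S1(2)[of "P x"] S2(2)[of "?Q x"] by simp
  qed
qed

lemma right_invertible_imp_right_Drazin:
  fixes M :: "'a::complex_banach set"
  assumes M: "closed_csubspace M" and T: "T \<in> bounded_ops M" and ri: "right_invertible_on M T"
  shows "right_Drazin_on M T"
proof -
  obtain S where S: "S \<in> bounded_ops M" "\<And>x. x \<in> M \<Longrightarrow> T (S x) = x"
    using ri unfolding right_invertible_on_def by blast
  have "T ` M = M" using S bo_in[OF T] bo_in[OF S(1)] by force
  moreover have "null_on M T \<inter> M = null_on M T" by (auto simp: null_on_def)
  ultimately show ?thesis
    unfolding right_Drazin_on_iff[OF M T] complemented_in_iff[OF M]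
    using right_inverse_null_projection[OF M T S] by (intro exI[of _ 0]) auto
qed

section \<open>Perturbation of Saphar operators\<close>

lemma closure_csubspace:
  assumes "csubspace L"
  shows "closed_csubspace (closure L)"
proof -
  have "0 \<in> L" and add: "\<And>x y. x \<in> L \<Longrightarrow> y \<in> L \<Longrightarrow> x + y \<in> L" and scale: "\<And>c x. x \<in> L \<Longrightarrow> c *\<^sub>C x \<in> L"
    using assms complex_vector.subspace_0 complex_vector.subspace_add complex_vector.subspace_scale by blast+
  have "x + y \<in> closure L" if xy: "x \<in> closure L" "y \<in> closure L" for x y
  proof -
    obtain f g where "\<And>n::nat. f n \<in> L" "f \<longlonglongrightarrow> x" "\<And>n::nat. g n \<in> L" "g \<longlonglongrightarrow> y"
      using xy unfolding closure_sequential by blast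
    then have "(\<forall>n. f n + g n \<in> L) \<and> (\<lambda>n. f n + g n) \<longlonglongrightarrow> x + y" using add by (auto intro: tendsto_add)
    then show ?thesis unfolding closure_sequential by (intro exI[of _ "\<lambda>n. f n + g n"])
  qed
  moreover have "c *\<^sub>C x \<in> closure L" if x: "x \<in> closure L" for c x
  proof -
    obtain f where "\<And>n::nat. f n \<in> L" "f \<longlonglongrightarrow> x" using x unfolding closure_sequential by blast
    then have "(\<forall>n. c *\<^sub>C f n \<in> L) \<and> (\<lambda>n. c *\<^sub>C f n) \<longlonglongrightarrow> c *\<^sub>C x"
      using scale bounded_linear.tendsto[OF bounded_linear_scaleC_const] by blast
    then show ?thesis unfolding closure_sequential by (intro exI[of _ "\<lambda>n. c *\<^sub>C f n"])
  qed
  moreover have "0 \<in> closure L" using \<open>0 \<in> L\<close> closure_subset by blast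
  ultimately show ?thesis unfolding closed_csubspace_def complex_vector.subspace_def by blast
qed

text \<open>
  Complementation of the kernel gives a bounded section of \<open>T\<close> over its range, complementation
  of the range extends it to \<open>M\<close>.
\<close>

lemma Saphar_inner_inverse:
  fixes M :: "'a::complex_banach set"
  assumes M: "closed_csubspace M" and T: "T \<in> bounded_ops M" and Sa: "Saphar_on M T"
  shows "\<exists>S\<in>bounded_ops M. \<forall>y\<in>T ` M. T (S y) = y"
proof -
  obtain P where P: "proj_on M P" "P ` M = null_on M T"
    using Sa unfolding Saphar_on_def complemented_in_iff[OF M] by blast
  obtain R where R: "proj_on M R" "R ` M = T ` M"
    using Sa unfolding Saphar_on_def complemented_in_iff[OF M] by blast
  have cl: "closed (T ` M)" using Sa by (simp add: Saphar_on_def Kato_on_def)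
  obtain S c where S: "\<And>y. y \<in> T ` M \<Longrightarrow> S y \<in> M \<and> T (S y) = y \<and> norm (S y) \<le> c * norm y"
    and add: "\<And>x y. x \<in> T ` M \<Longrightarrow> y \<in> T ` M \<Longrightarrow> S (x + y) = S x + S y"
    and scale: "\<And>a x. x \<in> T ` M \<Longrightarrow> S (a *\<^sub>C x) = a *\<^sub>C S x"
  proof -
    obtain S c where *: "(\<forall>y\<in>T ` M. S y \<in> M \<and> T (S y) = y \<and> norm (S y) \<le> c * norm y)
        \<and> (\<forall>x\<in>T ` M. \<forall>y\<in>T ` M. S (x + y) = S x + S y) \<and> (\<forall>a. \<forall>x\<in>T ` M. S (a *\<^sub>C x) = a *\<^sub>C S x)"
      using bounded_section[OF M T cl P] by (elim exE)
    show thesis by (rule that[of S c]) (use * in blast)+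
  qed
  note Rb = proj_bo[OF R(1)]
  obtain K where K: "K > 0" "\<And>x. x \<in> M \<Longrightarrow> norm (R x) \<le> K * norm x" using bo_bound[OF Rb] by blast
  have RM: "R x \<in> T ` M" if "x \<in> M" for x using R(2) that by blast
  have "(\<lambda>x. S (R x)) \<in> bounded_ops M"
  proof (rule bounded_opsI[where K = "\<bar>c\<bar> * K"])
    fix x assume x: "x \<in> M"
    have "norm (S (R x)) \<le> c * norm (R x)" using S[OF RM[OF x]] by blast
    also have "\<dots> \<le> \<bar>c\<bar> * norm (R x)" by (rule mult_right_mono) auto
    also have "\<dots> \<le> \<bar>c\<bar> * (K * norm x)" by (rule mult_left_mono[OF K(2)[OF x]]) simp
    finally show "norm (S (R x)) \<le> \<bar>c\<bar> * K * norm x" by simp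
  qed (use S RM add scale bo_add[OF Rb] bo_scale[OF Rb] in auto)
  moreover have "T (S (R y)) = y" if y: "y \<in> T ` M" for y
  proof -
    have "R y = y" using y unfolding R(2)[symmetric] proj_range_eq[OF R(1)] by simp
    then show ?thesis using S[OF y] by simp
  qed
  ultimately show ?thesis by (intro bexI[of _ "\<lambda>x. S (R x)"] ballI)
qed

text \<open>
  Let \<open>L\<close> be the closure of the intersection of all ranges \<open>R(T\<^sup>n)\<close>. The Kato property gives
  \<open>N(T) \<subseteq> L \<subseteq> R(T)\<close>, and \<open>L\<close> is invariant under \<open>S\<close>, hence under \<open>V\<^sub>z = (I - z S)\<^sup>-\<^sup>1\<close>.
  Therefore \<open>V\<^sub>z (T - z) x = T x - z V\<^sub>z (I - S T) x\<close> lies in \<open>R(T)\<close>, since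
  \<open>(I - S T) x \<in> N(T)\<close>.

  For the last clause, \<open>T - z\<close> maps \<open>L\<close> onto a superset of \<open>L\<close>, because \<open>(T - z) S V\<^sub>z = I\<close> on
  \<open>L\<close>, and the identity above shows \<open>N(T - z) \<subseteq> L\<close>. Together these give \<open>N((T - z)\<^sup>n) \<subseteq> L\<close> by
  induction.
\<close>

lemma Saphar_perturbation:
  fixes M :: "'a::complex_banach set"
  assumes M: "closed_csubspace M" and T: "T \<in> bounded_ops M" and Sa: "Saphar_on M T"
  obtains S r V where "S \<in> bounded_ops M" "r > 0"
    "\<And>y. y \<in> T ` M \<Longrightarrow> T (S y) = y"
    "\<And>z. z \<in> ball 0 r \<Longrightarrow> V z \<in> bounded_ops M"
    "\<And>z x. z \<in> ball 0 r \<Longrightarrow> x \<in> M \<Longrightarrow> V z x - z *\<^sub>C S (V z x) = x"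
    "\<And>z x. z \<in> ball 0 r \<Longrightarrow> x \<in> M \<Longrightarrow> V z (x - z *\<^sub>C S x) = x"
    "\<And>z x. z \<in> ball 0 r \<Longrightarrow> x \<in> M \<Longrightarrow> norm (V z x) \<le> 2 * norm x"
    "\<And>z x. z \<in> ball 0 r \<Longrightarrow> x \<in> M \<Longrightarrow> V z (shift T z x) \<in> T ` M"
    "\<And>z n. z \<in> ball 0 r \<Longrightarrow> null_on M (shift T z ^^ n) \<subseteq> shift T z ` M"
proof -
  obtain S where S: "S \<in> bounded_ops M" and TS: "\<And>y. y \<in> T ` M \<Longrightarrow> T (S y) = y"
    using Saphar_inner_inverse[OF M T Sa] by blast
  have Kato: "closed (T ` M)" "\<And>n. null_on M T \<subseteq> (T ^^ n) ` M"
    using Sa by (auto simp: Saphar_on_def Kato_on_def)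
  define R where "R = (\<Inter>n. (T ^^ n) ` M)"
  have RM: "R \<subseteq> M" unfolding R_def by (rule INF_lower2[of 0]) auto
  have RT: "R \<subseteq> T ` M" unfolding R_def by (rule INF_lower2[of 1]) auto
  have nullR: "null_on M T \<subseteq> R" using Kato(2) by (auto simp: R_def)
  have "csubspace R"
    unfolding R_def by (rule complex_vector.subspace_Inter) (use image_csubspace[OF M bo_funpow[OF T]] in auto)
  define L where "L = closure R"
  have L: "closed_csubspace L" unfolding L_def by (rule closure_csubspace) fact
  have LM: "L \<subseteq> M" unfolding L_def by (rule closure_minimal[OF RM csub_closed[OF M]])
  have LT: "L \<subseteq> T ` M" unfolding L_def by (rule closure_minimal[OF RT Kato(1)])
  have nullL: "null_on M T \<subseteq> L" using nullR closure_subset unfolding L_def by blast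
  have ker: "x - S (T x) \<in> null_on M T" if x: "x \<in> M" for x
    using bo_diff[OF M T x bo_in[OF S bo_in[OF T x]]] TS[of "T x"] x csub_diff[OF M x bo_in[OF S bo_in[OF T x]]]
    by (simp add: null_on_def)
  have SR: "S y \<in> R" if y: "y \<in> R" for y
    unfolding R_def
  proof
    fix n
    have "y \<in> (T ^^ Suc n) ` M" using y unfolding R_def by blast
    then obtain u where u: "u \<in> M" "y = T ((T ^^ n) u)" by auto
    have v: "(T ^^ n) u \<in> M" by (rule funpow_in[OF T u(1)])
    obtain w where w: "w \<in> M" "(T ^^ n) u - S (T ((T ^^ n) u)) = (T ^^ n) w"
      using ker[OF v] Kato(2)[of n] by blast
    have "S y = (T ^^ n) u - ((T ^^ n) u - S (T ((T ^^ n) u)))" using u(2) by simp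
    also have "\<dots> = (T ^^ n) (u - w)" unfolding w(2) by (rule bo_diff[OF M bo_funpow[OF T] u(1) w(1), symmetric])
    finally have "S y = (T ^^ n) (u - w)" .
    then show "S y \<in> (T ^^ n) ` M" using csub_diff[OF M u(1) w(1)] by blast
  qed
  have SL: "S x \<in> L" if "x \<in> L" for x
  proof -
    have "S ` closure R \<subseteq> closure R"
      by (rule image_closure_subset[OF continuous_on_subset[OF bo_continuous[OF M S]]])
        (use LM SR closure_subset in \<open>auto simp: L_def\<close>)
    then show ?thesis using that unfolding L_def by blast
  qed
  obtain r V where r: "r > 0" and V: "\<And>z. z \<in> ball 0 r \<Longrightarrow> V z \<in> bounded_ops M"
    and Vr: "\<And>z x. z \<in> ball 0 r \<Longrightarrow> x \<in> M \<Longrightarrow> V z x - z *\<^sub>C S (V z x) = x"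
    and Vl: "\<And>z x. z \<in> ball 0 r \<Longrightarrow> x \<in> M \<Longrightarrow> V z (x - z *\<^sub>C S x) = x"
    and Vb: "\<And>z x. z \<in> ball 0 r \<Longrightarrow> x \<in> M \<Longrightarrow> norm (V z x) \<le> 2 * norm x"
    and Vc: "\<And>z x. z \<in> ball 0 r \<Longrightarrow> x \<in> M \<Longrightarrow> S (V z x) = V z (S x)"
    and VL: "\<And>z x. z \<in> ball 0 r \<Longrightarrow> x \<in> L \<Longrightarrow> V z x \<in> L"
    by (rule neumann_family[OF M S]) (use L LM SL in blast)
  have key: "V z (shift T z x) = T x - z *\<^sub>C V z (x - S (T x))" if z: "z \<in> ball 0 r" and x: "x \<in> M" for z x
  proof -
    note Tx = bo_in[OF T x] and Vz = V[OF z]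
    note STx = bo_in[OF S Tx]
    have 1: "V z (T x - z *\<^sub>C x) = V z (T x) - z *\<^sub>C V z x"
      using bo_diff[OF M Vz Tx csub_scale[OF M x]] bo_scale[OF Vz x] by simp
    have 2: "V z (T x) = T x + z *\<^sub>C V z (S (T x))"
      using Vr[OF z Tx] Vc[OF z Tx] by (simp add: algebra_simps)
    have 3: "V z (x - S (T x)) = V z x - V z (S (T x))" by (rule bo_diff[OF M Vz x STx])
    show ?thesis unfolding shift_def 1 2 3 by (simp add: scaleC_simps)
  qed
  have in_range: "V z (shift T z x) \<in> T ` M" if z: "z \<in> ball 0 r" and x: "x \<in> M" for z x
  proof -
    have "V z (x - S (T x)) \<in> T ` M" using VL[OF z] nullL ker[OF x] LT by blast
    then have "z *\<^sub>C V z (x - S (T x)) \<in> T ` M"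
      by (rule complex_vector.subspace_scale[OF image_csubspace[OF M T]])
    then show ?thesis
      unfolding key[OF z x] using x by (intro complex_vector.subspace_diff[OF image_csubspace[OF M T]]) auto
  qed
  have LL: "\<exists>u\<in>L. shift T z u = y" if z: "z \<in> ball 0 r" and y: "y \<in> L" for z y
  proof (intro bexI[of _ "S (V z y)"])
    show "S (V z y) \<in> L" using SL VL[OF z y] by blast
    have "T (S (V z y)) = V z y" using TS VL[OF z y] LT by blast
    then show "shift T z (S (V z y)) = y" using Vr[OF z] y LM by (auto simp: shift_def)
  qed
  have null1: "x \<in> L" if z: "z \<in> ball 0 r" and x: "x \<in> M" "shift T z x = 0" for z x
  proof (cases "z = 0")
    case True
    then show ?thesis using x nullL by (auto simp: shift_def null_on_def scaleC_simps)
  next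
    case False
    have "V z (x - S (T x)) \<in> L" using VL[OF z] nullL ker[OF x(1)] by blast
    moreover have "z *\<^sub>C V z (x - S (T x)) = z *\<^sub>C x"
    proof -
      have "T x = z *\<^sub>C x" using x(2) by (simp add: shift_def)
      moreover have "0 = T x - z *\<^sub>C V z (x - S (T x))"
        using key[OF z x(1)] unfolding x(2) bo_0[OF M V[OF z]] .
      ultimately show ?thesis by (metis eq_iff_diff_eq_0)
    qed
    then have "inverse z *\<^sub>C z *\<^sub>C V z (x - S (T x)) = inverse z *\<^sub>C z *\<^sub>C x" by simp
    then have "V z (x - S (T x)) = x" using False by (simp add: scaleC_scaleC scaleC_one)
    ultimately show ?thesis by simp
  qed
  have nullL': "x \<in> L" if z: "z \<in> ball 0 r" and x: "x \<in> M" "(shift T z ^^ n) x = 0" for z x n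
    using x
  proof (induction n arbitrary: x)
    case 0
    then show ?case using csub_0[OF L] by simp
  next
    case (Suc n)
    note A = bo_shift[OF M T, of z]
    have "shift T z x \<in> L" using Suc.IH[OF bo_in[OF A Suc.prems(1)]] Suc.prems(2) by (simp add: funpow_swap1)
    then obtain u where u: "u \<in> L" "shift T z u = shift T z x" using LL[OF z] by blast
    have "x - u \<in> L"
      by (rule null1[OF z]) (use u LM Suc.prems(1) csub_diff[OF M] bo_diff[OF M A] in auto)
    from csub_add[OF L this u(1)] show ?case by simp
  qed
  have "null_on M (shift T z ^^ n) \<subseteq> shift T z ` M" if z: "z \<in> ball 0 r" for z n
  proof
    fix x assume "x \<in> null_on M (shift T z ^^ n)"
    then have "x \<in> L" using nullL'[OF z] unfolding null_on_def by blast
    then show "x \<in> shift T z ` M" using LL[OF z] LM by blast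
  qed
  then show thesis using that[OF S r TS V Vr Vl Vb in_range] by blast
qed

text \<open>
  The vectors which \<open>V\<^sub>z\<close> sends into \<open>R(T)\<close> form a closed set containing \<open>R(T - z)\<close>; if this
  range is dense, then all of \<open>V\<^sub>z (M) = M\<close> lies in \<open>R(T)\<close>. Finite descent of \<open>T - z\<close> is a
  special case, for the kernels of the powers of \<open>T - z\<close> are contained in its range.
\<close>

theorem Saphar_right_invertible:
  fixes M :: "'a::complex_banach set"
  assumes M: "closed_csubspace M" and T: "T \<in> bounded_ops M" and Sa: "Saphar_on M T"
  shows "\<exists>r>0. \<forall>z\<in>ball 0 r. M \<subseteq> closure (shift T z ` M) \<or> descent_on M (shift T z) < \<infinity>
    \<longrightarrow> right_invertible_on M T"
proof -
  obtain S r V where S: "S \<in> bounded_ops M" and r: "r > 0" and TS: "\<And>y. y \<in> T ` M \<Longrightarrow> T (S y) = y"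
    and V: "\<And>z. z \<in> ball 0 r \<Longrightarrow> V z \<in> bounded_ops M"
    and Vl: "\<And>z x. z \<in> ball 0 r \<Longrightarrow> x \<in> M \<Longrightarrow> V z (x - z *\<^sub>C S x) = x"
    and VT: "\<And>z x. z \<in> ball 0 r \<Longrightarrow> x \<in> M \<Longrightarrow> V z (shift T z x) \<in> T ` M"
    and null: "\<And>z n. z \<in> ball 0 r \<Longrightarrow> null_on M (shift T z ^^ n) \<subseteq> shift T z ` M"
    by (rule Saphar_perturbation[OF M T Sa]) blast
  have cl: "closed (T ` M)" using Sa by (simp add: Saphar_on_def Kato_on_def)
  have dense: "right_invertible_on M T" if z: "z \<in> ball 0 r" and d: "M \<subseteq> closure (shift T z ` M)" for z
  proof -
    note A = bo_shift[OF M T, of z]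
    have "closed (M \<inter> V z -` (T ` M))"
      by (rule continuous_closed_preimage[OF bo_continuous[OF M V[OF z]] csub_closed[OF M] cl])
    then have "closure (shift T z ` M) \<subseteq> M \<inter> V z -` (T ` M)"
      by (rule closure_minimal[rotated]) (use VT[OF z] bo_in[OF A] in auto)
    then have all: "V z x \<in> T ` M" if "x \<in> M" for x using d that by blast
    have "x \<in> T ` M" if x: "x \<in> M" for x
    proof -
      have "x - z *\<^sub>C S x \<in> M" by (intro csub_diff[OF M] csub_scale[OF M] bo_in[OF S] x)
      from all[OF this] show ?thesis using Vl[OF z x] by simp
    qed
    then show ?thesis unfolding right_invertible_on_def using S TS by blast
  qed
  have desc: "M \<subseteq> closure (shift T z ` M)" if z: "z \<in> ball 0 r" and d: "descent_on M (shift T z) < \<infinity>" for z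
  proof -
    note A = bo_shift[OF M T, of z]
    obtain n where "(shift T z ^^ n) ` M = (shift T z ^^ Suc n) ` M"
      using d unfolding descent_attained(1)[OF M A] by blast
    then have "shift T z ` M + null_on M (shift T z ^^ n) = M" unfolding descent_step_iff[OF M A] .
    then have "M \<subseteq> shift T z ` M + shift T z ` M" using set_plus_mono2[OF subset_refl null[OF z]] by blast
    also have "\<dots> \<subseteq> shift T z ` M"
      using complex_vector.subspace_add[OF image_csubspace[OF M A]] by (auto simp: set_plus_def)
    finally show ?thesis using closure_subset by blast
  qed
  show ?thesis using r dense desc by blast
qed

lemma right_invertible_imp_Saphar:
  fixes M :: "'a::complex_banach set"
  assumes M: "closed_csubspace M" and T: "T \<in> bounded_ops M" and ri: "right_invertible_on M T"
  shows "Saphar_on M T"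
proof -
  obtain S where S: "S \<in> bounded_ops M" "\<And>x. x \<in> M \<Longrightarrow> T (S x) = x"
    using ri unfolding right_invertible_on_def by blast
  have onto: "T ` M = M" using S bo_in[OF T] bo_in[OF S(1)] by force
  have "(T ^^ n) ` M = M" for n
  proof (induction n)
    case (Suc n)
    have "(T ^^ Suc n) ` M = T ` (T ^^ n) ` M" by (simp add: image_comp comp_def)
    then show ?case using Suc onto by simp
  qed simp
  then have "Kato_on M T" using onto csub_closed[OF M] by (auto simp: Kato_on_def null_on_def)
  moreover have "complemented_in M (null_on M T)"
    unfolding complemented_in_iff[OF M] using right_inverse_null_projection[OF M T S] by blast
  moreover have "complemented_in M (T ` M)"
    unfolding complemented_in_iff[OF M] onto by (intro exI[of _ "\<lambda>x. x"]) (simp add: proj_on_def bo_id)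
  ultimately show ?thesis by (simp add: Saphar_on_def)
qed

section \<open>The single-valued extension property of the dual operator\<close>

lemma dual_op_apply:
  assumes "A \<in> bounded_ops UNIV"
  shows "blinfun_apply (dual_op A \<phi>) x = blinfun_apply \<phi> (A x)"
  unfolding dual_op_def
  by (subst bounded_linear_Blinfun_apply) (auto intro: bounded_linear_compose[OF blinfun.bounded_linear_right]
      bo_UNIV_bounded_linear[OF assms])

lemma scaleC_blinfun_apply: "blinfun_apply (c *\<^sub>C \<phi>) x = c *\<^sub>C blinfun_apply \<phi> x"
  by (simp add: scaleC_blinfun.rep_eq)

lemma dual_shift_apply:
  assumes A: "A \<in> bounded_ops UNIV" and \<phi>: "\<phi> \<in> dual_space"
  shows "blinfun_apply (shift (dual_op A) z \<phi>) x = blinfun_apply \<phi> (shift A z x)"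
  using \<phi> by (simp add: shift_def blinfun.diff_left blinfun.diff_right dual_op_apply[OF A] scaleC_blinfun_apply
      dual_space_def scaleC_complex_def)

text \<open>
  Where \<open>A - w\<close> is onto, a solution of \<open>f w \<circ> (A - w) = 0\<close> vanishes. Continuity extends this
  from a dense set of \<open>w\<close> to a small disc, and the identity theorem to the whole disc on which
  \<open>f\<close> is given.
\<close>

lemma SVEP_at_dual:
  fixes A :: "'a::complex_banach \<Rightarrow> 'a"
  assumes A: "A \<in> bounded_ops UNIV" and d: "d > 0"
    and onto: "\<And>z e. z \<in> ball 0 d \<Longrightarrow> e > 0 \<Longrightarrow> \<exists>w\<in>ball z e. shift A w ` UNIV = UNIV"
  shows "SVEP_at dual_space (dual_op A) 0"
  unfolding SVEP_at_def
proof (intro allI impI ballI)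
  fix r :: real and f and z :: complex
  assume r: "r > 0" and f: "vec_analytic_on dual_space f (ball 0 r) \<and> (\<forall>z\<in>ball 0 r. shift (dual_op A) z (f z) = 0)"
    and z: "z \<in> ball 0 r"
  have dual: "f z \<in> dual_space" if "z \<in> ball 0 r" for z using f that by (simp add: vec_analytic_on_def)
  have der: "\<exists>D. (f has_derivative (\<lambda>h. h *\<^sub>C D)) (at z)" if "z \<in> ball 0 r" for z
    using f that unfolding vec_analytic_on_def by blast
  have vanish: "f w = 0" if w: "w \<in> ball 0 r" and o: "shift A w ` UNIV = UNIV" for w
  proof (rule blinfun_eqI)
    fix x
    obtain y where "x = shift A w y" using o by blast
    then have "blinfun_apply (f w) x = blinfun_apply (shift (dual_op A) w (f w)) y"
      using dual_shift_apply[OF A dual[OF w]] by simp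
    then show "blinfun_apply (f w) x = blinfun_apply 0 x" using f w by simp
  qed
  have cont: "isCont f w" if "w \<in> ball 0 r" for w
    using der[OF that] has_derivative_continuous by blast
  \<comment> \<open>the solution is given on a disc that may be larger than the one on which ranges
      are controlled\<close>
  define s where "s = min r d"
  have s: "s > 0" "ball 0 s \<subseteq> ball (0::complex) r" "ball 0 s \<subseteq> ball (0::complex) d" using r d by (auto simp: s_def)
  have near: "f w = 0" if w: "w \<in> ball 0 s" for w
  proof (rule ccontr)
    assume nz: "f w \<noteq> 0"
    have "w \<in> ball 0 r" using w s by blast
    then have "\<forall>\<^sub>F v in at w. f v \<noteq> 0"
      by (rule tendsto_imp_eventually_ne[OF cont[unfolded isCont_def] nz])
    then have "\<forall>\<^sub>F v in nhds w. v \<noteq> w \<longrightarrow> f v \<noteq> 0" by (simp add: eventually_at_filter)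
    then have "\<forall>\<^sub>F v in nhds w. f v \<noteq> 0" by (rule eventually_mono) (use nz in auto)
    moreover have "\<forall>\<^sub>F v in nhds w. v \<in> ball 0 s" using w by (intro eventually_nhds_in_open) auto
    ultimately have "\<forall>\<^sub>F v in nhds w. f v \<noteq> 0 \<and> v \<in> ball 0 s" by eventually_elim simp
    then obtain e where e: "e > 0" "\<And>v. dist v w < e \<Longrightarrow> f v \<noteq> 0 \<and> v \<in> ball 0 s"
      by (auto simp: eventually_nhds_metric)
    obtain v where v: "v \<in> ball w e" "shift A v ` UNIV = UNIV" using onto[of w e] w s e(1) by blast
    then have "f v \<noteq> 0" "v \<in> ball 0 r" using e(2)[of v] s by (auto simp: dist_commute)
    then show False using vanish v(2) by blast
  qed
  show "f z = 0"
  proof (rule blinfun_eqI)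
    fix x
    have hol: "(\<lambda>z. blinfun_apply (f z) x) holomorphic_on ball 0 r"
      unfolding holomorphic_on_def
    proof
      fix w :: complex assume "w \<in> ball 0 r"
      then obtain D where "(f has_derivative (\<lambda>h. h *\<^sub>C D)) (at w)" using der by blast
      from bounded_linear.has_derivative[OF blinfun.bounded_linear_left this, of x]
      have "((\<lambda>z. blinfun_apply (f z) x) has_field_derivative blinfun_apply D x) (at w)"
        unfolding has_field_derivative_def by (simp add: scaleC_blinfun_apply scaleC_complex_def mult_commute_abs)
      then show "(\<lambda>z. blinfun_apply (f z) x) field_differentiable at w within ball 0 r"
        using field_differentiable_at_within field_differentiable_def by blast
    qed
    have "blinfun_apply (f z) x = (\<lambda>_. 0) z"
    proof (rule analytic_continuation_open[where f = "\<lambda>z. blinfun_apply (f z) x" and g = "\<lambda>_. 0" and s = "ball 0 s" and s' = "ball 0 r"])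
      show "(\<lambda>z. blinfun_apply (f z) x) holomorphic_on ball 0 r" by (rule hol)
    qed (use s z near in auto)
    then show "blinfun_apply (f z) x = blinfun_apply 0 x" by simp
  qed
qed

text \<open>
  If \<open>A\<close> is not onto on the range of \<open>P\<close>, a functional \<open>\<phi>\<close> that vanishes on \<open>A (P X)\<close> but not on
  all of \<open>P X\<close> gives the functionals \<open>\<phi> \<circ> V\<^sub>z \<circ> P\<close>. They depend analytically on \<open>z\<close>, vanish on
  the range of \<open>A - z\<close>, and are nonzero at \<open>z = 0\<close>.
\<close>

lemma SVEP_imp_right_invertible:
  fixes A :: "'a::complex_banach \<Rightarrow> 'a"
  assumes A: "A \<in> bounded_ops UNIV" and P: "proj_on UNIV P" and c: "\<And>x. P (A x) = A (P x)"
    and Sa: "Saphar_on (range P) A" and svep: "SVEP_at dual_space (dual_op A) 0"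
  shows "right_invertible_on (range P) A"
proof -
  let ?M = "range P"
  have M: "closed_csubspace ?M" by (rule proj_range_closed[OF csub_UNIV P])
  have T: "A \<in> bounded_ops ?M" by (rule proj_range_invariant[OF P A c])
  obtain S r V where S: "S \<in> bounded_ops ?M" and r: "r > 0" and TS: "\<And>y. y \<in> A ` ?M \<Longrightarrow> A (S y) = y"
    and V: "\<And>z. z \<in> ball 0 r \<Longrightarrow> V z \<in> bounded_ops ?M"
    and Vr: "\<And>z x. z \<in> ball 0 r \<Longrightarrow> x \<in> ?M \<Longrightarrow> V z x - z *\<^sub>C S (V z x) = x"
    and Vl: "\<And>z x. z \<in> ball 0 r \<Longrightarrow> x \<in> ?M \<Longrightarrow> V z (x - z *\<^sub>C S x) = x"
    and Vb: "\<And>z x. z \<in> ball 0 r \<Longrightarrow> x \<in> ?M \<Longrightarrow> norm (V z x) \<le> 2 * norm x"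
    and VT: "\<And>z x. z \<in> ball 0 r \<Longrightarrow> x \<in> ?M \<Longrightarrow> V z (shift A z x) \<in> A ` ?M"
    by (rule Saphar_perturbation[OF M T Sa]) blast
  have cl: "closed (A ` ?M)" using Sa by (simp add: Saphar_on_def Kato_on_def)
  have "?M \<subseteq> A ` ?M"
  proof (rule ccontr)
    assume "\<not> ?thesis"
    then obtain m where m: "m \<in> ?M" "m \<notin> A ` ?M" by blast
    obtain \<phi> where \<phi>: "bounded_linear \<phi>" "\<And>c x. \<phi> (c *\<^sub>C x) = c * \<phi> x" "\<And>x. x \<in> A ` ?M \<Longrightarrow> \<phi> x = 0" "\<phi> m \<noteq> 0"
      using complex_functional_separating[OF image_csubspace[OF M T] cl m(2)] by blast
    have ext: "(\<lambda>x. X (P x)) \<in> bounded_ops UNIV" if "X \<in> bounded_ops ?M" for X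
      by (rule bo_proj_comp[OF csub_UNIV P that])
    have bl: "bounded_linear (\<lambda>x. \<phi> (X (P x)))" if "X \<in> bounded_ops ?M" for X
      by (rule bounded_linear_compose[OF \<phi>(1) bo_UNIV_bounded_linear[OF ext[OF that]]])
    define F where "F X = Blinfun (\<lambda>x. \<phi> (X (P x)))" for X
    have F: "blinfun_apply (F X) x = \<phi> (X (P x))" if "X \<in> bounded_ops ?M" for X x
      unfolding F_def by (subst bounded_linear_Blinfun_apply[OF bl[OF that]]) simp
    have Fd: "F X \<in> dual_space" if "X \<in> bounded_ops ?M" for X
      using bo_scale[OF ext[OF that]] by (simp add: dual_space_def F[OF that] \<phi>(2))
    obtain K\<phi> where K\<phi>: "\<And>x. norm (\<phi> x) \<le> norm x * K\<phi>" "K\<phi> > 0" using bounded_linear.pos_bounded[OF \<phi>(1)] by blast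
    obtain KP where KP: "KP > 0" "\<And>x. norm (P x) \<le> KP * norm x" using bo_bound[OF proj_bo[OF P]] by auto
    have "vec_analytic_on dual_space (\<lambda>z. F (V z)) (ball 0 r)"
      unfolding vec_analytic_on_def
    proof (intro conjI ballI)
      show "F (V z) \<in> dual_space" if "z \<in> ball 0 r" for z by (rule Fd[OF V[OF that]])
      fix z :: complex assume z: "z \<in> ball 0 r"
      have "lip_diff_at ?M V z" by (rule lip_diff_at_neumann[OF M S open_ball z V Vb Vl Vr])
      then obtain D C \<delta> where D: "D \<in> bounded_ops ?M" and C: "C \<ge> 0" and \<delta>: "\<delta> > 0"
        and est: "\<And>w x. w \<in> ball z \<delta> \<Longrightarrow> x \<in> ?M \<Longrightarrow> norm (V w x - V z x - (w - z) *\<^sub>C D x) \<le> C * (cmod (w - z))\<^sup>2 * norm x"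
        unfolding lip_diff_at_def by metis
      have "((\<lambda>z. F (V z)) has_derivative (\<lambda>h. h *\<^sub>C F D)) (at z)"
        unfolding has_derivative_iff_norm
      proof (intro conjI)
        show "bounded_linear (\<lambda>h. h *\<^sub>C F D)"
          by (rule bounded_bilinear.bounded_linear_left[OF bounded_bilinear_scaleC])
        let ?C = "K\<phi> * C * KP"
        show "((\<lambda>w. norm (F (V w) - F (V z) - (w - z) *\<^sub>C F D) / norm (w - z)) \<longlongrightarrow> 0) (at z)"
        proof (rule Lim_null_comparison)
          have "\<forall>\<^sub>F w in at z. w \<in> ball 0 r \<inter> ball z \<delta>"
            using z \<delta> by (intro eventually_at_in_open' open_Int open_ball) auto
          moreover have "\<forall>\<^sub>F w in at z. w \<noteq> z" by (simp add: eventually_at_filter)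
          ultimately show "\<forall>\<^sub>F w in at z. norm (norm (F (V w) - F (V z) - (w - z) *\<^sub>C F D) / norm (w - z)) \<le> ?C * cmod (w - z)"
          proof eventually_elim
            case (elim w)
            then have w: "w \<in> ball 0 r" "w \<in> ball z \<delta>" "w \<noteq> z" by auto
            have "norm (F (V w) - F (V z) - (w - z) *\<^sub>C F D) \<le> ?C * (cmod (w - z))\<^sup>2"
            proof (rule norm_blinfun_bound)
              show "0 \<le> ?C * (cmod (w - z))\<^sup>2" using K\<phi> C KP by simp
              fix x
              let ?E = "V w (P x) - V z (P x) - (w - z) *\<^sub>C D (P x)"
              have "blinfun_apply (F (V w) - F (V z) - (w - z) *\<^sub>C F D) x = \<phi> ?E"
                using linear_diff[OF bounded_linear.linear[OF \<phi>(1)]]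
                by (simp add: blinfun.diff_left scaleC_blinfun_apply F[OF V[OF w(1)]] F[OF V[OF z]] F[OF D] \<phi>(2) scaleC_complex_def)
              also have "norm (\<phi> ?E) \<le> norm ?E * K\<phi>" by (rule K\<phi>(1))
              also have "\<dots> \<le> (C * (cmod (w - z))\<^sup>2 * norm (P x)) * K\<phi>"
                by (rule mult_right_mono[OF est[OF w(2)]]) (use K\<phi> in auto)
              also have "\<dots> \<le> (C * (cmod (w - z))\<^sup>2 * (KP * norm x)) * K\<phi>"
                by (intro mult_right_mono mult_left_mono KP(2)) (use K\<phi> C in auto)
              finally show "norm (blinfun_apply (F (V w) - F (V z) - (w - z) *\<^sub>C F D) x) \<le> ?C * (cmod (w - z))\<^sup>2 * norm x"
                by (simp add: mult_ac)
            qed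
            then have "norm (F (V w) - F (V z) - (w - z) *\<^sub>C F D) / cmod (w - z) \<le> ?C * (cmod (w - z))\<^sup>2 / cmod (w - z)"
              by (rule divide_right_mono) simp
            then show ?case using w(3) by (simp add: power2_eq_square)
          qed
          have "((\<lambda>w. ?C * cmod (w - z)) \<longlongrightarrow> ?C * cmod (z - z)) (at z)" by (intro tendsto_intros)
          then show "((\<lambda>w. ?C * cmod (w - z)) \<longlongrightarrow> 0) (at z)" by simp
        qed
      qed
      then show "\<exists>d\<in>dual_space. ((\<lambda>z. F (V z)) has_derivative (\<lambda>h. h *\<^sub>C d)) (at z)" using Fd[OF D] by blast
    qed
    moreover have "shift (dual_op A) z (F (V z)) = 0" if z: "z \<in> ball 0 r" for z
    proof (rule blinfun_eqI)
      fix x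
      have "P (shift A z x) = shift A z (P x)"
        by (rule shift_commute_proj[OF csub_UNIV P A]) (use c in auto)
      then have "V z (P (shift A z x)) \<in> A ` ?M" using VT[OF z, of "P x"] by simp
      then show "blinfun_apply (shift (dual_op A) z (F (V z))) x = blinfun_apply 0 x"
        using dual_shift_apply[OF A Fd[OF V[OF z]]] F[OF V[OF z]] \<phi>(3) by simp
    qed
    ultimately have "F (V 0) = 0" using svep r unfolding SVEP_at_def by (meson centre_in_ball)
    moreover have z0: "0 \<in> ball (0::complex) r" using r by simp
    moreover have "P m = m" using m(1) proj_idem[OF P] by auto
    moreover have "V 0 m = m" using Vr[OF z0 m(1)] by (simp add: scaleC_simps)
    ultimately have "\<phi> m = 0" using F[OF V[OF z0], of m] by simp
    then show False using \<phi>(4) by simp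
  qed
  then show ?thesis unfolding right_invertible_on_def using S TS by blast
qed

section \<open>Splittings into a right invertible and a meromorphic part\<close>

text \<open>
  \<open>T Q\<close> is the direct sum of \<open>T\<close> on the range of \<open>Q\<close> and of \<open>0\<close>.
\<close>

lemma meromorphic_on_comp_proj:
  fixes M :: "'a::complex_banach set"
  assumes M: "closed_csubspace M" and T: "T \<in> bounded_ops M" and Q: "proj_on M Q"
    and c: "\<And>x. x \<in> M \<Longrightarrow> Q (T x) = T (Q x)"
  shows "meromorphic_on M (\<lambda>x. T (Q x)) \<longleftrightarrow> meromorphic_on (Q ` M) T"
proof -
  note Qb = proj_bo[OF Q]
  let ?T = "\<lambda>x. T (Q x)"
  have R: "closed_csubspace (Q ` M)" by (rule proj_range_closed[OF M Q])
  have RT: "T \<in> bounded_ops (Q ` M)" by (rule proj_range_invariant[OF Q T c])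
  have TQ: "?T \<in> bounded_ops M" by (rule bo_comp[OF T Qb])
  have c': "Q (?T x) = ?T (Q x)" if "x \<in> M" for x
    by (rule c[OF bo_in[OF Qb that]])
  have eq: "?T x = T x" if "x \<in> Q ` M" for x using that unfolding proj_range_eq[OF Q] by simp
  have cong: "meromorphic_on (Q ` M) ?T \<longleftrightarrow> meromorphic_on (Q ` M) T"
    by (rule meromorphic_on_cong[OF R RT eq])
  show ?thesis
  proof
    assume "meromorphic_on M ?T"
    then show "meromorphic_on (Q ` M) T"
      using meromorphic_on_restrict[where T = ?T, OF M Q c'] cong by blast
  next
    assume m: "meromorphic_on (Q ` M) T"
    have "meromorphic_on ((\<lambda>x. x - Q x) ` M) ?T"
    proof (rule nilpotent_meromorphic[where d = 1])
      show "closed_csubspace ((\<lambda>x. x - Q x) ` M)" by (rule proj_range_closed[OF M proj_compl[OF M Q]])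
      have z: "?T x = 0" if "x \<in> (\<lambda>x. x - Q x) ` M" for x
        using that bo_0[OF M T] unfolding proj_compl_range[OF M Q] by simp
      show "(?T ^^ 1) x = 0" if "x \<in> (\<lambda>x. x - Q x) ` M" for x using z[OF that] by simp
      show "?T \<in> bounded_ops ((\<lambda>x. x - Q x) ` M)"
        by (rule bo_cong[OF \<open>closed_csubspace ((\<lambda>x. x - Q x) ` M)\<close> bo_zero[OF \<open>closed_csubspace ((\<lambda>x. x - Q x) ` M)\<close>] z])
    qed
    then show "meromorphic_on M ?T"
      using meromorphic_on_direct_sum[OF M Q TQ c'] m cong by blast
  qed
qed

lemma right_invertible_on_cong:
  assumes "right_invertible_on M T" and "\<And>x. x \<in> M \<Longrightarrow> T' x = T x"
  shows "right_invertible_on M T'"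
proof -
  obtain S where S: "S \<in> bounded_ops M" "\<And>x. x \<in> M \<Longrightarrow> T (S x) = x"
    using assms(1) unfolding right_invertible_on_def by blast
  then show ?thesis
    unfolding right_invertible_on_def using assms(2) bo_in[OF S(1)] by (intro bexI[of _ S]) auto
qed

lemma Red_iff:
  fixes A :: "'a::complex_banach \<Rightarrow> 'a"
  assumes A: "A \<in> bounded_ops UNIV"
  shows "(M, N) \<in> Red A \<longleftrightarrow>
    (\<exists>P. proj_on UNIV P \<and> (\<forall>x. P (A x) = A (P x)) \<and> M = range P \<and> N = range (\<lambda>x. x - P x))"
proof
  assume R: "(M, N) \<in> Red A"
  then have M: "closed_csubspace M" and N: "closed_csubspace N" and inv: "A ` M \<subseteq> M" "A ` N \<subseteq> N"
    and MN: "M \<inter> N = {0}" "M + N = UNIV"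
    by (auto simp: Red_def closed_csubspace_def)
  obtain P where P: "proj_on UNIV P" "range P = M" "{x \<in> UNIV. P x = 0} = N"
    using projection_of_direct_sum[OF csub_UNIV M N MN] by blast
  note Pb = proj_bo[OF P(1)]
  have fixed: "P x = x" if "x \<in> M" for x using that proj_range_eq[OF P(1)] unfolding P(2) by simp
  have "P (A x) = A (P x)" for x
  proof -
    have "P x \<in> M" using P(2) by blast
    then have m: "A (P x) \<in> M" using inv by blast
    have "P (x - P x) = 0" using bo_diff[OF csub_UNIV Pb] proj_idem[OF P(1)] by simp
    then have "x - P x \<in> N" using P(3) by blast
    then have "A (x - P x) \<in> N" using inv by blast
    then have "P (A (x - P x)) = 0" using P(3) by blast
    then show ?thesis using fixed[OF m] bo_diff[OF csub_UNIV A] bo_diff[OF csub_UNIV Pb] by simp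
  qed
  moreover have "N = range (\<lambda>x. x - P x)" using proj_compl_range[OF csub_UNIV P(1)] P(3) by simp
  ultimately show "\<exists>P. proj_on UNIV P \<and> (\<forall>x. P (A x) = A (P x)) \<and> M = range P \<and> N = range (\<lambda>x. x - P x)"
    using P by blast
next
  assume "\<exists>P. proj_on UNIV P \<and> (\<forall>x. P (A x) = A (P x)) \<and> M = range P \<and> N = range (\<lambda>x. x - P x)"
  then obtain P where P: "proj_on UNIV P" and c: "\<And>x. P (A x) = A (P x)"
    and MN: "M = range P" "N = range (\<lambda>x. x - P x)" by blast
  note Pb = proj_bo[OF P]
  have N: "N = {x. P x = 0}" using proj_compl_range[OF csub_UNIV P] MN by simp
  have M: "M = {x. P x = x}" using proj_range_eq[OF P] MN by simp
  have "closed_csubspace M" "closed_csubspace N"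
    using proj_range_closed[OF csub_UNIV P] proj_range_closed[OF csub_UNIV proj_compl[OF csub_UNIV P]] MN by auto
  moreover have "M \<inter> N = {0}" using bo_0[OF csub_UNIV Pb] by (auto simp: M N)
  moreover have "M + N = UNIV"
  proof -
    have "x \<in> M + N" for x
    proof -
      have "P x + (x - P x) \<in> M + N" unfolding MN by (intro set_plus_intro) auto
      then show ?thesis by simp
    qed
    then show ?thesis by blast
  qed
  moreover have "A ` M \<subseteq> M" using c by (auto simp: M)
  moreover have "A ` N \<subseteq> N" using c bo_0[OF csub_UNIV A] by (auto simp: N)
  ultimately show "(M, N) \<in> Red A" by (simp add: Red_def closed_csubspace_def)
qed

definition right_inv_mero_split :: "('a::complex_normed_vector \<Rightarrow> 'a) \<Rightarrow> bool" where
  "right_inv_mero_split A \<longleftrightarrow> (\<exists>P. proj_on UNIV P \<and> (\<forall>x. P (A x) = A (P x))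
     \<and> right_invertible_on (range P) A \<and> meromorphic_on (range (\<lambda>x. x - P x)) A)"

lemma right_inv_mero_splitI:
  assumes "proj_on UNIV P" "\<And>x. P (A x) = A (P x)" "right_invertible_on (range P) A"
    "meromorphic_on (range (\<lambda>x. x - P x)) A"
  shows "right_inv_mero_split A"
  using assms unfolding right_inv_mero_split_def by blast

lemma compl_commute:
  assumes A: "A \<in> bounded_ops UNIV" and c: "\<And>x. P (A x) = A (P x)"
  shows "A x - P (A x) = A (x - P x)"
  using bo_diff[OF csub_UNIV A, of x "P x"] c by simp

lemma meromorphic_compl_iff:
  fixes A :: "'a::complex_banach \<Rightarrow> 'a"
  assumes A: "A \<in> bounded_ops UNIV" and P: "proj_on UNIV P" and c: "\<And>x. P (A x) = A (P x)"
  shows "meromorphic_on UNIV (\<lambda>x. A (x - P x)) \<longleftrightarrow> meromorphic_on (range (\<lambda>x. x - P x)) A"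
  by (rule meromorphic_on_comp_proj[where Q = "\<lambda>x. x - P x", OF csub_UNIV A proj_compl[OF csub_UNIV P]])
    (rule compl_commute[where P = P, OF A c])

lemma right_inv_mero_splitI':
  fixes A :: "'a::complex_banach \<Rightarrow> 'a"
  assumes A: "A \<in> bounded_ops UNIV" and P: "proj_on UNIV P" and c: "\<And>x. P (A x) = A (P x)"
    and ri: "right_invertible_on (range P) A" and m: "meromorphic_on UNIV (\<lambda>x. A (x - P x))"
  shows "right_inv_mero_split A"
proof (rule right_inv_mero_splitI[OF P c ri])
  show "meromorphic_on (range (\<lambda>x. x - P x)) A"
    using m meromorphic_compl_iff[OF A P c] by blast
qed

text \<open>
  A right inverse on the range of \<open>P\<close>, composed with \<open>P\<close>, becomes a bounded operator \<open>S\<close> on the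
  whole space with \<open>A S = P\<close>; this \<open>S\<close> is at the same time the generalized inverse and the
  factor in the quasipolar condition.
\<close>

lemma right_inv_mero_splitE:
  fixes A :: "'a::complex_banach \<Rightarrow> 'a"
  assumes A: "A \<in> bounded_ops UNIV" and s: "right_inv_mero_split A"
  obtains P S where "proj_on UNIV P" "\<And>x. P (A x) = A (P x)" "right_invertible_on (range P) A"
    "meromorphic_on (range (\<lambda>x. x - P x)) A" "meromorphic_on UNIV (\<lambda>x. A (x - P x))"
    "S \<in> bounded_ops UNIV" "\<And>x. A (S x) = P x" "\<And>x. P (S x) = S x" "\<And>x. S (P x) = S x"
proof -
  obtain P where P: "proj_on UNIV P" and c: "\<And>x. P (A x) = A (P x)"
    and ri: "right_invertible_on (range P) A" and m: "meromorphic_on (range (\<lambda>x. x - P x)) A"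
    using s unfolding right_inv_mero_split_def by blast
  obtain S where S: "S \<in> bounded_ops (range P)" "\<And>x. x \<in> range P \<Longrightarrow> A (S x) = x"
    using ri unfolding right_invertible_on_def by blast
  show thesis
  proof (rule that[OF P c ri m])
    show "meromorphic_on UNIV (\<lambda>x. A (x - P x))"
      using m meromorphic_compl_iff[OF A P c] by blast
    show "(\<lambda>x. S (P x)) \<in> bounded_ops UNIV" by (rule bo_proj_comp[OF csub_UNIV P S(1)])
    show "A (S (P x)) = P x" for x using S(2) by blast
    show "P (S (P x)) = S (P x)" for x using bo_in[OF S(1), of "P x"] proj_idem[OF P] by auto
    show "S (P (P x)) = S (P x)" for x using proj_idem[OF P] by simp
  qed
qed

text \<open>
  The two identities make \<open>P = A B\<close> a projector commuting with \<open>A\<close>, and \<open>B\<close> a right inverse of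
  \<open>A\<close> on its range.
\<close>

lemma outer_inverse_imp_split:
  fixes A :: "'a::complex_banach \<Rightarrow> 'a"
  assumes A: "A \<in> bounded_ops UNIV" and g: "right_gDM_invertible A"
  shows "right_inv_mero_split A"
proof -
  obtain B where B: "B \<in> bounded_ops UNIV" and e1: "A \<circ> B \<circ> A = A \<circ> A \<circ> B" and e2: "A \<circ> B \<circ> B = B"
    and m: "meromorphic_on UNIV (\<lambda>x. A x - A (B (A x)))"
    using g unfolding right_gDM_invertible_def by blast
  have 1: "A (B (A x)) = A (A (B x))" for x using fun_cong[OF e1, of x] by simp
  have 2: "A (B (B x)) = B x" for x using fun_cong[OF e2, of x] by simp
  let ?P = "\<lambda>x. A (B x)"
  have P: "proj_on UNIV ?P" unfolding proj_on_def using bo_comp[OF A B] 1 2 by simp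
  show ?thesis
  proof (rule right_inv_mero_splitI'[OF A P])
    show "A (B (A x)) = A (A (B x))" for x by (rule 1)
    have Bin: "B x \<in> range ?P" for x using 2[of x] by (metis rangeI)
    have "B \<in> bounded_ops (range ?P)" by (rule bo_restrict[OF B]) (use Bin in auto)
    moreover have "A (B x) = x" if "x \<in> range ?P" for x using that 1 2 by auto
    ultimately show "right_invertible_on (range ?P) A" unfolding right_invertible_on_def by blast
    have "(\<lambda>x. A (x - A (B x))) = (\<lambda>x. A x - A (B (A x)))" using bo_diff[OF csub_UNIV A] 1 by simp
    then show "meromorphic_on UNIV (\<lambda>x. A (x - A (B x)))" using m by simp
  qed
qed

lemma split_imp_outer_inverse:
  fixes A :: "'a::complex_banach \<Rightarrow> 'a"
  assumes A: "A \<in> bounded_ops UNIV" and s: "right_inv_mero_split A"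
  shows "\<exists>C\<in>bounded_ops UNIV. A \<circ> C \<circ> A = A \<circ> A \<circ> C \<and> A \<circ> C \<circ> C = C \<and> C = C \<circ> A \<circ> C
          \<and> meromorphic_on UNIV (\<lambda>x. A x - A (C (A x)))"
proof -
  obtain P S where P: "proj_on UNIV P" and c: "\<And>x. P (A x) = A (P x)"
    and m: "meromorphic_on UNIV (\<lambda>x. A (x - P x))"
    and S: "S \<in> bounded_ops UNIV" "\<And>x. A (S x) = P x" "\<And>x. P (S x) = S x" "\<And>x. S (P x) = S x"
    by (rule right_inv_mero_splitE[OF A s]) (rule that; assumption)
  have "(\<lambda>x. A x - A (S (A x))) = (\<lambda>x. A (x - P x))" using bo_diff[OF csub_UNIV A] S(2) c by simp
  then show ?thesis using S m c by (intro bexI[of _ S]) (auto simp: fun_eq_iff)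
qed

lemma right_gDM_iff_split:
  fixes A :: "'a::complex_banach \<Rightarrow> 'a"
  assumes A: "A \<in> bounded_ops UNIV"
  shows "right_gDM_invertible A \<longleftrightarrow> right_inv_mero_split A"
    and "right_inv_mero_split A \<longleftrightarrow> (\<exists>C\<in>bounded_ops UNIV. A \<circ> C \<circ> A = A \<circ> A \<circ> C \<and> A \<circ> C \<circ> C = C \<and> C = C \<circ> A \<circ> C
          \<and> meromorphic_on UNIV (\<lambda>x. A x - A (C (A x))))"
  using outer_inverse_imp_split[OF A] split_imp_outer_inverse[OF A]
  unfolding right_gDM_invertible_def by blast+

lemma split_iff_Red:
  fixes A :: "'a::complex_banach \<Rightarrow> 'a"
  assumes A: "A \<in> bounded_ops UNIV"
  shows "right_inv_mero_split A \<longleftrightarrow> (\<exists>(M, N)\<in>Red A. right_invertible_on M A \<and> meromorphic_on N A)"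
proof -
  have "(\<exists>(M, N)\<in>Red A. right_invertible_on M A \<and> meromorphic_on N A) \<longleftrightarrow>
    (\<exists>M N. (M, N) \<in> Red A \<and> right_invertible_on M A \<and> meromorphic_on N A)" by blast
  also have "\<dots> \<longleftrightarrow> right_inv_mero_split A"
    unfolding Red_iff[OF A] right_inv_mero_split_def by blast
  finally show ?thesis by simp
qed

lemma GSMD_iff:
  fixes A :: "'a::complex_banach \<Rightarrow> 'a"
  assumes A: "A \<in> bounded_ops UNIV"
  shows "admits_GSMD A \<longleftrightarrow> (\<exists>P. proj_on UNIV P \<and> (\<forall>x. P (A x) = A (P x))
     \<and> Saphar_on (range P) A \<and> meromorphic_on (range (\<lambda>x. x - P x)) A)"
proof -
  have "admits_GSMD A \<longleftrightarrow> (\<exists>M N. (M, N) \<in> Red A \<and> Saphar_on M A \<and> meromorphic_on N A)"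
    unfolding admits_GSMD_def by blast
  then show ?thesis unfolding Red_iff[OF A] by blast
qed

section \<open>Splittings and right Drazin invertibility\<close>

text \<open>
  The projector is the complementary one, \<open>I - P\<close>. On its range \<open>A + (I - P)\<close> is \<open>A + 1\<close>, which
  is Drazin invertible because \<open>A\<close> is meromorphic there and \<open>-1 \<noteq> 0\<close>.
\<close>

lemma split_imp_plus_proj:
  fixes A :: "'a::complex_banach \<Rightarrow> 'a"
  assumes A: "A \<in> bounded_ops UNIV" and s: "right_inv_mero_split A"
  shows "\<exists>P. projector P \<and> A \<circ> P = P \<circ> A \<and> right_Drazin_on UNIV (\<lambda>x. A x + P x)
      \<and> right_Drazin_on UNIV (\<lambda>x. A (x - P x) + P x) \<and> meromorphic_on UNIV (A \<circ> P)"
proof -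
  obtain P where P: "proj_on UNIV P" and c: "\<And>x. P (A x) = A (P x)"
    and ri: "right_invertible_on (range P) A" and mN: "meromorphic_on (range (\<lambda>x. x - P x)) A"
    and m: "meromorphic_on UNIV (\<lambda>x. A (x - P x))"
    by (rule right_inv_mero_splitE[OF A s]) (rule that; assumption)
  note Pb = proj_bo[OF P]
  let ?Q = "\<lambda>x. x - P x"
  have Q: "proj_on UNIV ?Q" by (rule proj_compl[OF csub_UNIV P])
  have N: "closed_csubspace (range ?Q)" by (rule proj_range_closed[OF csub_UNIV Q])
  have AN: "A \<in> bounded_ops (range ?Q)" using mN by (simp add: meromorphic_on_def)
  have onP: "P x = x" if "x \<in> range P" for x using that proj_idem[OF P] by auto
  have onQ: "P x = 0" if "x \<in> range ?Q" for x using that proj_compl_range[OF csub_UNIV P] by auto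
  have Pd: "P (x - y) = P x - P y" "A (x - y) = A x - A y" for x y
    by (rule bo_diff[OF csub_UNIV Pb]; simp) (rule bo_diff[OF csub_UNIV A]; simp)
  have Pa: "P (x + y) = P x + P y" for x y using bo_add[OF Pb] by auto
  have 1: "right_Drazin_on UNIV (\<lambda>x. A x + ?Q x)"
  proof (rule right_Drazin_direct_sum[OF csub_UNIV P])
    show "(\<lambda>x. A x + ?Q x) \<in> bounded_ops UNIV" by (rule bo_plus[OF csub_UNIV A proj_bo[OF Q]])
    show "P (A x + ?Q x) = A (P x) + ?Q (P x)" for x using c by (simp add: Pa Pd)
    show "right_invertible_on (range P) (\<lambda>x. A x + ?Q x)"
    proof (rule right_invertible_on_cong[OF ri])
      show "A x + ?Q x = A x" if "x \<in> range P" for x using onP[OF that] by simp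
    qed
    have D: "Drazin_on (range ?Q) (shift A (-1))"
      using mN unfolding meromorphic_on_iff_Drazin[OF N] by simp
    have "A x + ?Q x = shift A (-1) x" if "x \<in> range ?Q" for x
      using onQ[OF that] by (simp add: shift_def scaleC_simps)
    from Drazin_on_cong[where B = "shift A (-1)" and B' = "\<lambda>x. A x + ?Q x", OF N bo_shift[OF N AN] this] D
    show "Drazin_on (range ?Q) (\<lambda>x. A x + ?Q x)" by simp
  qed
  have 2: "right_Drazin_on UNIV (\<lambda>x. A (x - ?Q x) + ?Q x)"
  proof (rule right_invertible_imp_right_Drazin[OF csub_UNIV])
    show b: "(\<lambda>x. A (x - ?Q x) + ?Q x) \<in> bounded_ops UNIV"
      by (rule bo_plus[OF csub_UNIV bo_comp[OF A bo_minus[OF csub_UNIV bo_id proj_bo[OF Q]]] proj_bo[OF Q]])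
    show "right_invertible_on UNIV (\<lambda>x. A (x - ?Q x) + ?Q x)"
    proof (rule right_invertible_direct_sum[OF csub_UNIV P b])
      show "right_invertible_on (range P) (\<lambda>x. A (x - ?Q x) + ?Q x)"
      proof (rule right_invertible_on_cong[OF ri])
        show "A (x - ?Q x) + ?Q x = A x" if "x \<in> range P" for x using onP[OF that] by simp
      qed
      have "right_invertible_on (range ?Q) (\<lambda>x. x)"
        unfolding right_invertible_on_def by (intro bexI[OF _ bo_id]) simp
      then show "right_invertible_on (range ?Q) (\<lambda>x. A (x - ?Q x) + ?Q x)"
      proof (rule right_invertible_on_cong)
        show "A (x - ?Q x) + ?Q x = x" if "x \<in> range ?Q" for x using onQ[OF that] bo_0[OF csub_UNIV A] by simp
      qed
    qed
  qed
  show ?thesis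
  proof (intro exI[of _ ?Q] conjI 1 2)
    show "projector ?Q" using Q by (simp add: proj_on_UNIV)
    show "A \<circ> ?Q = ?Q \<circ> A" using c by (simp add: fun_eq_iff Pd)
    show "meromorphic_on UNIV (A \<circ> ?Q)" using m by (simp add: comp_def)
  qed
qed

text \<open>
  On the kernel of \<open>P\<close> the operator \<open>A\<close> is \<open>C\<close>, which decomposes there into a right invertible
  and a nilpotent part; on the range of \<open>P\<close> it is the meromorphic operator \<open>D\<close>. The nilpotent
  part is meromorphic and joins \<open>D\<close>.
\<close>

lemma Drazin_meromorphic_sum_imp_split:
  fixes A :: "'a::complex_banach \<Rightarrow> 'a"
  assumes C: "C \<in> bounded_ops UNIV" and D: "D \<in> bounded_ops UNIV" and rD: "right_Drazin_on UNIV C"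
    and mD: "meromorphic_on UNIV D" and P: "proj_on UNIV P"
    and PC: "\<And>x. P (C x) = C (P x)" and PD: "\<And>x. P (D x) = D (P x)"
    and A: "A \<in> bounded_ops UNIV" and Aeq: "\<And>x. A x = C (x - P x) + D (P x)"
  shows "right_inv_mero_split A"
proof -
  note Pb = proj_bo[OF P]
  let ?R = "\<lambda>x. x - P x"
  have R: "proj_on UNIV ?R" by (rule proj_compl[OF csub_UNIV P])
  note Rb = proj_bo[OF R]
  let ?M = "range ?R"
  have M: "closed_csubspace ?M" by (rule proj_range_closed[OF csub_UNIV R])
  have PP: "P (P x) = P x" for x using proj_idem[OF P] by simp
  have Pd: "P (x - y) = P x - P y" for x y using bo_diff[OF csub_UNIV Pb] by simp
  have Pa: "P (x + y) = P x + P y" for x y using bo_add[OF Pb] by simp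
  have C0: "C 0 = 0" "D 0 = 0" "P 0 = 0" using bo_0[OF csub_UNIV C] bo_0[OF csub_UNIV D] bo_0[OF csub_UNIV Pb] by auto
  have inM: "x \<in> ?M \<longleftrightarrow> P x = 0" for x using proj_compl_range[OF csub_UNIV P] by auto
  have inP: "P x = x" if "x \<in> range P" for x using that PP by auto
  have RC: "?R (C x) = C (?R x)" for x by (rule compl_commute[where P = P, OF C PC])
  have CM: "C \<in> bounded_ops ?M" using proj_range_invariant[of UNIV ?R C] R C RC by blast
  have "right_Drazin_on ?M C" by (rule right_Drazin_restrict[OF csub_UNIV R C RC rD])
  then obtain Q0 d where Q0: "proj_on ?M Q0" and Q0C: "\<And>x. x \<in> ?M \<Longrightarrow> Q0 (C x) = C (Q0 x)"
    and ri: "right_invertible_on (Q0 ` ?M) C" and nil: "\<And>x. x \<in> ?M \<Longrightarrow> (C ^^ d) (x - Q0 x) = 0"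
    using right_Drazin_decomposition[OF M CM] by blast
  note Q0b = proj_bo[OF Q0]
  have RM: "?R x \<in> ?M" for x by blast
  have Q0M: "P (Q0 x) = 0" "Q0 x \<in> ?M" if "x \<in> ?M" for x using bo_in[OF Q0b that] inM by auto
  have AM: "A x = C x" if "x \<in> ?M" for x using that by (simp add: Aeq inM C0)
  have AP: "A x = D x" if "x \<in> range P" for x using inP[OF that] by (simp add: Aeq C0)
  have PA: "P (A x) = A (P x)" for x
    by (simp add: Aeq Pa Pd PC PD PP C0)
  let ?Q = "\<lambda>x. Q0 (?R x)"
  have Qb: "?Q \<in> bounded_ops UNIV" by (rule bo_proj_comp[OF csub_UNIV R Q0b])
  have Q: "proj_on UNIV ?Q"
    unfolding proj_on_def
  proof (intro conjI ballI Qb)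
    show "Q0 (?R (Q0 (?R x))) = Q0 (?R x)" for x
      using Q0M(1)[OF RM, of x] proj_idem[OF Q0 RM, of x] by simp
  qed
  have rangeQ: "range ?Q = Q0 ` ?M" by (simp add: image_image)
  have QA: "?Q (A x) = A (?Q x)" for x
  proof -
    have "?R (A x) = A (?R x)" by (rule compl_commute[where P = P, OF A PA])
    also have "\<dots> = C (?R x)" by (rule AM[OF RM])
    finally have "?Q (A x) = C (?Q x)" using Q0C[OF RM] by simp
    then show ?thesis using AM[OF Q0M(2)[OF RM]] by simp
  qed
  show ?thesis
  proof (rule right_inv_mero_splitI'[where P = ?Q, OF A Q])
    show "?Q (A x) = A (?Q x)" for x by (rule QA)
    have "Q0 ` ?M \<subseteq> ?M" using Q0M(2) by blast
    then show "right_invertible_on (range ?Q) A"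
      unfolding rangeQ by (intro right_invertible_on_cong[OF ri]) (use AM in blast)
    let ?T = "\<lambda>x. A (x - ?Q x)"
    have Tb: "?T \<in> bounded_ops UNIV" by (rule bo_comp[OF A bo_minus[OF csub_UNIV bo_id Qb]])
    show "meromorphic_on UNIV ?T"
    proof (rule meromorphic_on_direct_sum[where P = P and T = ?T, OF csub_UNIV P Tb])
      have PQ: "P (?Q x) = 0" "?Q (P x) = 0" for x
        using Q0M(1)[OF RM] bo_0[OF M Q0b] by (simp_all add: PP)
      show "P (?T x) = ?T (P x)" for x unfolding PA PQ Pd by simp
      have "meromorphic_on (range P) D" by (rule meromorphic_on_restrict[OF csub_UNIV P PD mD])
      moreover have "?T x = D x" if "x \<in> range P" for x
        using AP[OF that] inP[OF that] PQ(2)[of x] by simp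
      ultimately show "meromorphic_on (range P) ?T"
        using meromorphic_on_cong[where T = D and T' = ?T, OF proj_range_closed[OF csub_UNIV P]] by (simp add: meromorphic_on_def)
      have Q0': "proj_on ?M (\<lambda>x. x - Q0 x)" by (rule proj_compl[OF M Q0])
      have c0: "C x - Q0 (C x) = C (x - Q0 x)" if "x \<in> ?M" for x
        using bo_diff[OF M CM that Q0M(2)[OF that]] Q0C[OF that] by simp
      have "meromorphic_on ((\<lambda>x. x - Q0 x) ` ?M) C"
      proof (rule nilpotent_meromorphic[where d = d])
        show "closed_csubspace ((\<lambda>x. x - Q0 x) ` ?M)" by (rule proj_range_closed[OF M Q0'])
        show "C \<in> bounded_ops ((\<lambda>x. x - Q0 x) ` ?M)" using proj_range_invariant[of ?M "\<lambda>x. x - Q0 x" C] Q0' CM c0 by blast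
        show "(C ^^ d) x = 0" if "x \<in> (\<lambda>x. x - Q0 x) ` ?M" for x using that nil by blast
      qed
      then have "meromorphic_on ?M (\<lambda>x. C (x - Q0 x))"
        using meromorphic_on_comp_proj[where Q = "\<lambda>x. x - Q0 x" and T = C, OF M CM Q0' c0] by blast
      moreover have "?T x = C (x - Q0 x)" if "x \<in> ?M" for x
      proof -
        have "?R x = x" using that inM by simp
        then show ?thesis using AM[OF csub_diff[OF M that Q0M(2)[OF that]]] by simp
      qed
      ultimately show "meromorphic_on ?M ?T"
        using meromorphic_on_cong[where T = "\<lambda>x. C (x - Q0 x)" and T' = ?T, OF M bo_comp[OF CM proj_bo[OF Q0']]] by blast
    qed
  qed
qed

lemma split_iff_Drazin_meromorphic:
  fixes A :: "'a::complex_banach \<Rightarrow> 'a"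
  assumes A: "A \<in> bounded_ops UNIV"
  shows "right_inv_mero_split A \<longleftrightarrow> (\<exists>P. projector P \<and> A \<circ> P = P \<circ> A
          \<and> right_Drazin_on UNIV (\<lambda>x. A x + P x) \<and> meromorphic_on UNIV (A \<circ> P))" (is "_ \<longleftrightarrow> ?iv")
    and "right_inv_mero_split A \<longleftrightarrow> (\<exists>P. projector P \<and> A \<circ> P = P \<circ> A
          \<and> right_Drazin_on UNIV (\<lambda>x. A (x - P x) + P x) \<and> meromorphic_on UNIV (A \<circ> P))" (is "_ \<longleftrightarrow> ?v")
    and "right_inv_mero_split A \<longleftrightarrow>
       (\<exists>C\<in>bounded_ops UNIV. \<exists>D\<in>bounded_ops UNIV. \<exists>P\<in>bounded_ops UNIV.
          right_Drazin_on UNIV C \<and> meromorphic_on UNIV D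
          \<and> projector P \<and> P \<circ> C = C \<circ> P \<and> P \<circ> D = D \<circ> P
          \<and> A = (\<lambda>x. C (x - P x) + D (P x)))" (is "_ \<longleftrightarrow> ?vi")
proof -
  have s4: ?iv and s5: ?v if "right_inv_mero_split A" using split_imp_plus_proj[OF A that] by blast+
  have six: ?vi if P: "projector P" and AP: "A \<circ> P = P \<circ> A" and C: "C \<in> bounded_ops UNIV"
    and rD: "right_Drazin_on UNIV C" and m: "meromorphic_on UNIV (A \<circ> P)" and PC: "\<And>x. P (C x) = C (P x)"
    and eq: "\<And>x. C (x - P x) = A (x - P x)" for P C
  proof -
    have P': "proj_on UNIV P" using P by (simp add: proj_on_UNIV)
    have PP: "P (P x) = P x" for x using proj_idem[OF P'] by simp
    have c: "P (A x) = A (P x)" for x using fun_cong[OF AP, of x] by simp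
    have D: "(A \<circ> P) \<in> bounded_ops UNIV" using bo_comp[OF A proj_bo[OF P']] by (simp add: comp_def)
    have "A = (\<lambda>x. C (x - P x) + (A \<circ> P) (P x))"
      using bo_diff[OF csub_UNIV A] by (simp add: fun_eq_iff eq PP)
    moreover have "P \<circ> C = C \<circ> P" "P \<circ> (A \<circ> P) = (A \<circ> P) \<circ> P" using PC c by (simp_all add: fun_eq_iff)
    ultimately show ?vi using C D proj_bo[OF P'] rD m P by blast
  qed
  have i4: ?vi if iv: ?iv
  proof -
    obtain P where P: "projector P" "A \<circ> P = P \<circ> A" "right_Drazin_on UNIV (\<lambda>x. A x + P x)" "meromorphic_on UNIV (A \<circ> P)"
      using iv by blast
    have P': "proj_on UNIV P" using P by (simp add: proj_on_UNIV)
    have PP: "P (P x) = P x" for x using proj_idem[OF P'] by simp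
    have c: "P (A x) = A (P x)" for x using fun_cong[OF P(2), of x] by simp
    show ?vi
    proof (rule six[OF P(1,2) _ P(3,4)])
      show "(\<lambda>x. A x + P x) \<in> bounded_ops UNIV" by (rule bo_plus[OF csub_UNIV A proj_bo[OF P']])
      show "P (A x + P x) = A (P x) + P (P x)" for x using bo_add[OF proj_bo[OF P']] c by simp
      show "A (x - P x) + P (x - P x) = A (x - P x)" for x using bo_diff[OF csub_UNIV proj_bo[OF P']] PP by simp
    qed
  qed
  have i5: ?vi if v: ?v
  proof -
    obtain P where P: "projector P" "A \<circ> P = P \<circ> A" "right_Drazin_on UNIV (\<lambda>x. A (x - P x) + P x)" "meromorphic_on UNIV (A \<circ> P)"
      using v by blast
    have P': "proj_on UNIV P" using P by (simp add: proj_on_UNIV)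
    have PP: "P (P x) = P x" for x using proj_idem[OF P'] by simp
    have c: "P (A x) = A (P x)" for x using fun_cong[OF P(2), of x] by simp
    have Pd: "P (x - y) = P x - P y" "P (x + y) = P x + P y" for x y
      using bo_diff[OF csub_UNIV proj_bo[OF P']] bo_add[OF proj_bo[OF P']] by auto
    show ?vi
    proof (rule six[OF P(1,2) _ P(3,4)])
      show "(\<lambda>x. A (x - P x) + P x) \<in> bounded_ops UNIV"
        by (rule bo_plus[OF csub_UNIV bo_comp[OF A bo_minus[OF csub_UNIV bo_id proj_bo[OF P']]] proj_bo[OF P']])
      show "P (A (x - P x) + P x) = A (P x - P (P x)) + P (P x)" for x using c by (simp add: Pd PP)
      show "A (x - P x - P (x - P x)) + P (x - P x) = A (x - P x)" for x by (simp add: Pd PP)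
    qed
  qed
  have s6: "right_inv_mero_split A" if vi: ?vi
  proof -
    obtain C D P where C: "C \<in> bounded_ops UNIV" and D: "D \<in> bounded_ops UNIV" and rD: "right_Drazin_on UNIV C"
      and mD: "meromorphic_on UNIV D" and P: "projector P" and PC: "P \<circ> C = C \<circ> P" and PD: "P \<circ> D = D \<circ> P"
      and Aeq: "A = (\<lambda>x. C (x - P x) + D (P x))"
      using vi by blast
    show ?thesis
    proof (rule Drazin_meromorphic_sum_imp_split[OF C D rD mD _ _ _ A])
      show "proj_on UNIV P" using P by (simp add: proj_on_UNIV)
      show "P (C x) = C (P x)" "P (D x) = D (P x)" for x using fun_cong[OF PC, of x] fun_cong[OF PD, of x] by auto
      show "A x = C (x - P x) + D (P x)" for x by (rule fun_cong[OF Aeq])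
    qed
  qed
  show "right_inv_mero_split A \<longleftrightarrow> ?iv" using s4 i4 s6 by blast
  show "right_inv_mero_split A \<longleftrightarrow> ?v" using s5 i5 s6 by blast
  show "right_inv_mero_split A \<longleftrightarrow> ?vi" using s4 i4 s6 by blast
qed

lemma split_iff_quasipolar:
  fixes A :: "'a::complex_banach \<Rightarrow> 'a"
  assumes A: "A \<in> bounded_ops UNIV"
  shows "right_inv_mero_split A \<longleftrightarrow> right_meromorphic_quasipolar A"
proof
  assume s: "right_inv_mero_split A"
  obtain P S where P: "proj_on UNIV P" and c: "\<And>x. P (A x) = A (P x)"
    and m: "meromorphic_on UNIV (\<lambda>x. A (x - P x))"
    and S: "S \<in> bounded_ops UNIV" "\<And>x. A (S x) = P x"
    by (rule right_inv_mero_splitE[OF A s]) (rule that; assumption)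
  show "right_meromorphic_quasipolar A"
    unfolding right_meromorphic_quasipolar_def
    using P m S c by (intro exI[of _ P]) (auto simp: proj_on_UNIV fun_eq_iff intro!: bexI[of _ S])
next
  assume "right_meromorphic_quasipolar A"
  then obtain Q T where Q: "proj_on UNIV Q" and AQ: "A \<circ> Q = Q \<circ> A"
    and m: "meromorphic_on UNIV (\<lambda>x. A (x - Q x))" and T: "T \<in> bounded_ops UNIV" "Q = A \<circ> T"
    unfolding right_meromorphic_quasipolar_def proj_on_UNIV by blast
  have c: "Q (A x) = A (Q x)" for x using fun_cong[OF AQ, of x] by simp
  have QT: "Q x = A (T x)" for x using fun_cong[OF T(2), of x] by simp
  show "right_inv_mero_split A"
  proof (rule right_inv_mero_splitI'[OF A Q c _ m])
    have QTb: "(\<lambda>x. Q (T x)) \<in> bounded_ops (range Q)"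
      by (rule bo_restrict[OF bo_comp[OF proj_bo[OF Q] T(1)]]) auto
    have "A (Q (T x)) = x" if "x \<in> range Q" for x
    proof -
      have "A (Q (T x)) = Q (Q x)" using c QT by metis
      then show ?thesis using that proj_idem[OF Q] by auto
    qed
    then show "right_invertible_on (range Q) A"
      unfolding right_invertible_on_def by (intro bexI[OF _ QTb] ballI)
  qed
qed

section \<open>Splittings and spectra\<close>

text \<open>
  Near \<open>0\<close> the operator \<open>A - z\<close> stays right invertible on the range of \<open>P\<close>. What happens on the
  kernel is decided by the spectrum of a meromorphic operator, which is avoided by a dense set
  of \<open>z\<close> and which at \<open>z \<noteq> 0\<close> leaves Drazin invertibility.
\<close>

lemma split_spectral:
  fixes A :: "'a::complex_banach \<Rightarrow> 'a"
  assumes A: "A \<in> bounded_ops UNIV" and s: "right_inv_mero_split A"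
  shows "admits_GSMD A"
    and "\<exists>d>0. (\<forall>z\<in>ball 0 d. \<forall>e>0. \<exists>w\<in>ball z e. right_invertible_on UNIV (shift A w))
      \<and> (\<forall>z\<in>ball 0 d - {0}. right_Drazin_on UNIV (shift A z))"
proof -
  obtain P where P: "proj_on UNIV P" and c: "\<And>x. P (A x) = A (P x)"
    and ri: "right_invertible_on (range P) A" and mN: "meromorphic_on (range (\<lambda>x. x - P x)) A"
    by (rule right_inv_mero_splitE[OF A s]) (rule that; assumption)
  have M: "closed_csubspace (range P)" by (rule proj_range_closed[OF csub_UNIV P])
  have AM: "A \<in> bounded_ops (range P)" by (rule proj_range_invariant[OF P A c])
  have N: "closed_csubspace (range (\<lambda>x. x - P x))" by (rule proj_range_closed[OF csub_UNIV proj_compl[OF csub_UNIV P]])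
  show "admits_GSMD A"
    unfolding GSMD_iff[OF A] using P c mN right_invertible_imp_Saphar[OF M AM ri] by blast
  obtain d where d: "d > 0" "\<And>z. z \<in> ball 0 d \<Longrightarrow> right_invertible_on (range P) (shift A z)"
    using right_invertible_shift[OF M ri] by blast
  have Az: "shift A z \<in> bounded_ops UNIV" for z by (rule bo_shift[OF csub_UNIV A])
  have cz: "P (shift A z x) = shift A z (P x)" for z x
    by (rule shift_commute_proj[OF csub_UNIV P A]) (use c in auto)
  have "\<exists>w\<in>ball z e. right_invertible_on UNIV (shift A w)" if z: "z \<in> ball 0 d" and e: "e > 0" for z e
  proof -
    have "min e (d - norm z) > 0" using z e by simp
    then obtain w where w: "w \<in> ball z (min e (d - norm z))" "invertible_on (range (\<lambda>x. x - P x)) (shift A w)"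
      using meromorphic_invertible_dense[OF mN] by blast
    have "norm w \<le> norm z + dist z w" using norm_triangle_sub[of w z] by (simp add: dist_norm norm_minus_commute)
    then have "w \<in> ball 0 d" using w(1) by simp
    moreover have "right_invertible_on (range (\<lambda>x. x - P x)) (shift A w)"
      using w(2) unfolding invertible_on_def right_invertible_on_def by blast
    ultimately have "right_invertible_on UNIV (shift A w)"
      by (intro right_invertible_direct_sum[OF csub_UNIV P Az] d(2))
    then show ?thesis using w(1) by auto
  qed
  moreover have "right_Drazin_on UNIV (shift A z)" if z: "z \<in> ball 0 d - {0}" for z
  proof (rule right_Drazin_direct_sum[where T = "shift A z" and P = P, OF csub_UNIV P Az cz])
    show "right_invertible_on (range P) (shift A z)" using d(2) z by blast
    show "Drazin_on (range (\<lambda>x. x - P x)) (shift A z)"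
      using mN z unfolding meromorphic_on_iff_Drazin[OF N] by blast
  qed
  ultimately show "\<exists>d>0. (\<forall>z\<in>ball 0 d. \<forall>e>0. \<exists>w\<in>ball z e. right_invertible_on UNIV (shift A w))
      \<and> (\<forall>z\<in>ball 0 d - {0}. right_Drazin_on UNIV (shift A z))"
    using d(1) by blast
qed

lemma right_invertible_surj:
  assumes "right_invertible_on UNIV T"
  shows "surj T"
  using assms unfolding right_invertible_on_def surj_def by (metis UNIV_I)

text \<open>
  Dense range and finite descent of \<open>A - z\<close> are inherited by the range of \<open>P\<close>, where \<open>A\<close> is
  Saphar.
\<close>

lemma GSMD_imp_split:
  fixes A :: "'a::complex_banach \<Rightarrow> 'a"
  assumes A: "A \<in> bounded_ops UNIV" and g: "admits_GSMD A"
    and near: "\<And>r. r > 0 \<Longrightarrow> \<exists>z\<in>ball 0 r. closure (range (shift A z)) = UNIV \<or> descent_on UNIV (shift A z) < \<infinity>"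
  shows "right_inv_mero_split A"
proof -
  obtain P where P: "proj_on UNIV P" and c: "\<And>x. P (A x) = A (P x)"
    and Sa: "Saphar_on (range P) A" and mN: "meromorphic_on (range (\<lambda>x. x - P x)) A"
    using g unfolding GSMD_iff[OF A] by blast
  let ?M = "range P"
  have M: "closed_csubspace ?M" by (rule proj_range_closed[OF csub_UNIV P])
  have AM: "A \<in> bounded_ops ?M" by (rule proj_range_invariant[OF P A c])
  obtain r where r: "r > 0" "\<And>z. z \<in> ball 0 r \<Longrightarrow> ?M \<subseteq> closure (shift A z ` ?M) \<or> descent_on ?M (shift A z) < \<infinity>
      \<Longrightarrow> right_invertible_on ?M A"
    using Saphar_right_invertible[OF M AM Sa] by blast
  obtain z where z: "z \<in> ball 0 r" "closure (range (shift A z)) = UNIV \<or> descent_on UNIV (shift A z) < \<infinity>"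
    using near[OF r(1)] by blast
  let ?B = "shift A z"
  have B: "?B \<in> bounded_ops UNIV" by (rule bo_shift[OF csub_UNIV A])
  have cB: "P (?B x) = ?B (P x)" for x
    by (rule shift_commute_proj[OF csub_UNIV P A]) (use c in auto)
  have im: "(?B ^^ n) ` ?M = P ` range (?B ^^ n)" for n
  proof -
    have "P ((?B ^^ n) x) = (?B ^^ n) (P x)" for x
      by (rule funpow_commute_on[where M = UNIV and T = ?B and S = P]) (use cB in auto)
    then show ?thesis by (simp add: image_image)
  qed
  have "?M \<subseteq> closure (?B ` ?M) \<or> descent_on ?M ?B < \<infinity>"
    using z(2)
  proof
    assume dense: "closure (range ?B) = UNIV"
    have "P ` closure (range ?B) \<subseteq> closure (P ` range ?B)"
      by (rule image_closure_subset[OF continuous_on_subset[OF bo_continuous[OF csub_UNIV proj_bo[OF P]]]])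
        (auto intro: closure_subset[THEN subsetD])
    then show ?thesis using im[of 1] dense by simp
  next
    assume "descent_on UNIV ?B < \<infinity>"
    then obtain n where "range (?B ^^ n) = range (?B ^^ Suc n)"
      unfolding descent_attained(1)[OF csub_UNIV B] by blast
    then have "(?B ^^ n) ` ?M = (?B ^^ Suc n) ` ?M" unfolding im by simp
    then show ?thesis using descent_attained(1)[OF M bo_shift[OF M AM]] by blast
  qed
  then have "right_invertible_on ?M A" by (rule r(2)[OF z(1)])
  then show ?thesis by (rule right_inv_mero_splitI[OF P c _ mN])
qed

lemma not_interior_near:
  fixes S :: "complex set"
  assumes "0 \<notin> interior S" "r > 0"
  shows "\<exists>z\<in>ball 0 r. z \<notin> S"
proof -
  have "\<not> ball 0 r \<subseteq> S" using assms unfolding mem_interior by blast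
  then show ?thesis by blast
qed

lemma split_iff_GSMD:
  fixes A :: "'a::complex_banach \<Rightarrow> 'a"
  assumes A: "A \<in> bounded_ops UNIV"
  shows "right_inv_mero_split A \<longleftrightarrow> admits_GSMD A \<and> 0 \<notin> interior (right_spectrum UNIV A)"
    and "right_inv_mero_split A \<longleftrightarrow> admits_GSMD A \<and> SVEP_at dual_space (dual_op A) 0"
    and "right_inv_mero_split A \<longleftrightarrow> admits_GSMD A \<and> \<not> 0 islimpt right_Drazin_spectrum UNIV A"
    and "right_inv_mero_split A \<longleftrightarrow> admits_GSMD A \<and> 0 \<notin> interior (right_Drazin_spectrum UNIV A)"
    and "right_inv_mero_split A \<longleftrightarrow> admits_GSMD A \<and> \<not> 0 islimpt descent_spectrum UNIV A"
    and "right_inv_mero_split A \<longleftrightarrow> admits_GSMD A \<and> 0 \<notin> interior (descent_spectrum UNIV A)"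
    and "right_inv_mero_split A \<longleftrightarrow> admits_GSMD A \<and> 0 \<notin> interior (compression_spectrum UNIV A)"
proof -
  have sub1: "compression_spectrum UNIV A \<subseteq> right_spectrum UNIV A"
    unfolding compression_spectrum_def right_spectrum_def
    using right_invertible_surj by fastforce
  have sub2: "descent_spectrum UNIV A \<subseteq> right_Drazin_spectrum UNIV A"
    unfolding descent_spectrum_def right_Drazin_spectrum_def right_Drazin_on_def by auto
  have lim: "0 \<notin> interior S" if "\<not> 0 islimpt S" for S :: "complex set"
    using that interior_limit_point by blast
  have dsc: "right_inv_mero_split A" if "admits_GSMD A" "0 \<notin> interior (descent_spectrum UNIV A)"
  proof (rule GSMD_imp_split[OF A that(1)])
    show "\<exists>z\<in>ball 0 r. closure (range (shift A z)) = UNIV \<or> descent_on UNIV (shift A z) < \<infinity>" if "r > 0" for r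
      using not_interior_near[OF \<open>0 \<notin> interior (descent_spectrum UNIV A)\<close> that] by (auto simp: descent_spectrum_def)
  qed
  have cp: "right_inv_mero_split A" if "admits_GSMD A" "0 \<notin> interior (compression_spectrum UNIV A)"
  proof (rule GSMD_imp_split[OF A that(1)])
    show "\<exists>z\<in>ball 0 r. closure (range (shift A z)) = UNIV \<or> descent_on UNIV (shift A z) < \<infinity>" if "r > 0" for r
      using not_interior_near[OF \<open>0 \<notin> interior (compression_spectrum UNIV A)\<close> that] by (auto simp: compression_spectrum_def)
  qed
  have svep: "right_inv_mero_split A" if g: "admits_GSMD A" and sv: "SVEP_at dual_space (dual_op A) 0"
  proof -
    obtain P where P: "proj_on UNIV P" and c: "\<And>x. P (A x) = A (P x)"
      and Sa: "Saphar_on (range P) A" and mN: "meromorphic_on (range (\<lambda>x. x - P x)) A"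
      using g unfolding GSMD_iff[OF A] by blast
    show ?thesis by (rule right_inv_mero_splitI[OF P c SVEP_imp_right_invertible[OF A P c Sa sv] mN])
  qed
  have fwd: "0 \<notin> interior (right_spectrum UNIV A)" "SVEP_at dual_space (dual_op A) 0"
    "\<not> 0 islimpt right_Drazin_spectrum UNIV A" if s: "right_inv_mero_split A"
  proof -
    obtain d where d: "d > 0" and dense: "\<And>z e. z \<in> ball 0 d \<Longrightarrow> e > 0 \<Longrightarrow> \<exists>w\<in>ball z e. right_invertible_on UNIV (shift A w)"
      and rD: "\<And>z. z \<in> ball 0 d - {0} \<Longrightarrow> right_Drazin_on UNIV (shift A z)"
      using split_spectral(2)[OF A s] by blast
    show "0 \<notin> interior (right_spectrum UNIV A)"
    proof
      assume "0 \<in> interior (right_spectrum UNIV A)"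
      then obtain e where "e > 0" "ball 0 e \<subseteq> right_spectrum UNIV A" by (auto simp: mem_interior)
      then show False using dense[of 0 e] d by (auto simp: right_spectrum_def)
    qed
    show "SVEP_at dual_space (dual_op A) 0"
    proof (rule SVEP_at_dual[OF A d])
      show "\<exists>w\<in>ball z e. range (shift A w) = UNIV" if "z \<in> ball 0 d" "e > 0" for z e
        using dense[OF that] right_invertible_surj by blast
    qed
    show "\<not> 0 islimpt right_Drazin_spectrum UNIV A"
    proof
      assume "0 islimpt right_Drazin_spectrum UNIV A"
      then obtain z where "z \<in> right_Drazin_spectrum UNIV A" "z \<in> ball 0 d" "z \<noteq> 0"
        using islimptE[of 0 _ "ball 0 d"] d by (metis centre_in_ball open_ball)
      then show False using rD[of z] by (auto simp: right_Drazin_spectrum_def)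
    qed
  qed
  note G = split_spectral(1)[OF A]
  have m1: "0 \<notin> interior (right_spectrum UNIV A) \<Longrightarrow> 0 \<notin> interior (compression_spectrum UNIV A)"
    using interior_mono[OF sub1] by blast
  have m2: "0 \<notin> interior (right_Drazin_spectrum UNIV A) \<Longrightarrow> 0 \<notin> interior (descent_spectrum UNIV A)"
    using interior_mono[OF sub2] by blast
  have m3: "\<not> 0 islimpt right_Drazin_spectrum UNIV A \<Longrightarrow> \<not> 0 islimpt descent_spectrum UNIV A"
    using islimpt_subset[OF _ sub2] by blast
  show "right_inv_mero_split A \<longleftrightarrow> admits_GSMD A \<and> 0 \<notin> interior (right_spectrum UNIV A)"
    using G fwd(1) cp m1 by blast
  show "right_inv_mero_split A \<longleftrightarrow> admits_GSMD A \<and> SVEP_at dual_space (dual_op A) 0"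
    using G fwd(2) svep by blast
  show "right_inv_mero_split A \<longleftrightarrow> admits_GSMD A \<and> \<not> 0 islimpt right_Drazin_spectrum UNIV A"
    using G fwd(3) lim m2 dsc by blast
  show "right_inv_mero_split A \<longleftrightarrow> admits_GSMD A \<and> 0 \<notin> interior (right_Drazin_spectrum UNIV A)"
    using G fwd(3) lim m2 dsc by blast
  show "right_inv_mero_split A \<longleftrightarrow> admits_GSMD A \<and> \<not> 0 islimpt descent_spectrum UNIV A"
    using G fwd(3) m3 lim dsc by blast
  show "right_inv_mero_split A \<longleftrightarrow> admits_GSMD A \<and> 0 \<notin> interior (descent_spectrum UNIV A)"
    using G fwd(3) m3 lim dsc by blast
  show "right_inv_mero_split A \<longleftrightarrow> admits_GSMD A \<and> 0 \<notin> interior (compression_spectrum UNIV A)"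
    using G fwd(1) cp m1 by blast
qed

theorem theorem5p6:
  fixes A :: "'a::complex_banach \<Rightarrow> 'a"
  assumes infinite_dim: "\<not> finite_cdim TYPE('a)"
    and A: "A \<in> bounded_ops UNIV"
  shows
    "(right_gDM_invertible A \<longleftrightarrow>
       (\<exists>C\<in>bounded_ops UNIV. A \<circ> C \<circ> A = A \<circ> A \<circ> C \<and> A \<circ> C \<circ> C = C \<and> C = C \<circ> A \<circ> C
          \<and> meromorphic_on UNIV (\<lambda>x. A x - A (C (A x)))))
   \<and> (right_gDM_invertible A \<longleftrightarrow>
       (\<exists>(M, N)\<in>Red A. right_invertible_on M A \<and> meromorphic_on N A))
   \<and> (right_gDM_invertible A \<longleftrightarrow>
       (\<exists>P. projector P \<and> A \<circ> P = P \<circ> A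
          \<and> right_Drazin_on UNIV (\<lambda>x. A x + P x) \<and> meromorphic_on UNIV (A \<circ> P)))
   \<and> (right_gDM_invertible A \<longleftrightarrow>
       (\<exists>P. projector P \<and> A \<circ> P = P \<circ> A
          \<and> right_Drazin_on UNIV (\<lambda>x. A (x - P x) + P x) \<and> meromorphic_on UNIV (A \<circ> P)))
   \<and> (right_gDM_invertible A \<longleftrightarrow>
       (\<exists>C\<in>bounded_ops UNIV. \<exists>D\<in>bounded_ops UNIV. \<exists>P\<in>bounded_ops UNIV.
          right_Drazin_on UNIV C \<and> meromorphic_on UNIV D
          \<and> projector P \<and> P \<circ> C = C \<circ> P \<and> P \<circ> D = D \<circ> P
          \<and> A = (\<lambda>x. C (x - P x) + D (P x))))
   \<and> (right_gDM_invertible A \<longleftrightarrow> right_meromorphic_quasipolar A)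
   \<and> (right_gDM_invertible A \<longleftrightarrow> admits_GSMD A \<and> 0 \<notin> interior (right_spectrum UNIV A))
   \<and> (right_gDM_invertible A \<longleftrightarrow> admits_GSMD A \<and> SVEP_at dual_space (dual_op A) 0)
   \<and> (right_gDM_invertible A \<longleftrightarrow> admits_GSMD A \<and> \<not> 0 islimpt right_Drazin_spectrum UNIV A)
   \<and> (right_gDM_invertible A \<longleftrightarrow> admits_GSMD A \<and> 0 \<notin> interior (right_Drazin_spectrum UNIV A))
   \<and> (right_gDM_invertible A \<longleftrightarrow> admits_GSMD A \<and> \<not> 0 islimpt descent_spectrum UNIV A)
   \<and> (right_gDM_invertible A \<longleftrightarrow> admits_GSMD A \<and> 0 \<notin> interior (descent_spectrum UNIV A))
   \<and> (right_gDM_invertible A \<longleftrightarrow> admits_GSMD A \<and> 0 \<notin> interior (compression_spectrum UNIV A))"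
  unfolding right_gDM_iff_split(1)[OF A]
  using right_gDM_iff_split(2)[OF A] split_iff_Red[OF A] split_iff_Drazin_meromorphic[OF A]
    split_iff_quasipolar[OF A] split_iff_GSMD[OF A]
  by (intro conjI)

end
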